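(* Let $\Omega\subset\mathbb{C}^n$ be a smoothly bounded strongly pseudoconvex domain with Bergman projection $P$. Then there exist $2<p_0<\infty$ and a constant $C'>0$, depending on $n$ but not on $p$, such that $$C'\,\frac{p^2}{p-1}\le\|P\|_p$$ for all $p\in(1,q_0)\cup(p_0,\infty)$, where $\frac{1}{p_0}+\frac{1}{q_0}=1$.
   Context: All domains are bounded domains in $\mathbb{C}^n$, and $L^p(\Omega)$ is taken with respect to Lebesgue measure. $H(\Omega)$ denotes the holomorphic functions on $\Omega$, and $A^p(\Omega)=H(\Omega)\cap L^p(\Omega)$. The Bergman projection $P$ is the orthogonal projection of $L^2(\Omega)$ onto $A^2(\Omega)$. On a smoothly bounded strongly pseudoconvex domain, $P$ is bounded on $L^p(\Omega)$ for $1<p<\infty$, and $\|P\|_p$ denotes the norm of the operator $P:L^p(\Omega)\to A^p(\Omega)$. $\Omega$ is smoothly bounded if it is bounded and there is a $C^\infty$ real-valued function $r$ on a neighborhood of $\overline\Omega$ such that $\Omega=\{z: r(z)<0\}$ and $dr\neq0$ where $r=0$. Such an $\Omega$ is strongly pseudoconvex if $i\partial\bar\partial r(x)(\xi,\bar\xi)>0$ (that is, $\sum_{j,k}\frac{\partial^2 r}{\partial z_j\partial\bar z_k}(x)\xi_j\bar\xi_k>0$) for all $x$ in the boundary $b\Omega$ and all nonzero vectors $\xi\in\mathbb{C}^n$ with $\partial r(x)(\xi)=\sum_j\frac{\partial r}{\partial z_j}(x)\xi_j=0$. *)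

theory Defs
  imports "HOL-Analysis.Analysis"
begin

text \<open>
  Points of \<open>\<complex>\<^sup>n\<close> are vectors \<^typ>\<open>complex ^ 'n\<close> with \<open>n = CARD('n)\<close>; as a real Euclidean space
  this is \<open>\<real>\<^sup>2\<^sup>n\<close>, so \<^const>\<open>lebesgue\<close> on it is \<open>2n\<close>-dimensional Lebesgue measure.
  Functions on \<open>\<Omega>\<close> are represented by total functions whose values off \<open>\<Omega>\<close> play no role.
\<close>

definition bounded_domain :: "(complex ^ 'n::finite) set \<Rightarrow> bool" where
  "bounded_domain \<Omega> \<longleftrightarrow> open \<Omega> \<and> connected \<Omega> \<and> \<Omega> \<noteq> {} \<and> bounded \<Omega>"

primrec Ck_on :: "nat \<Rightarrow> ('a::real_normed_vector) set \<Rightarrow> ('a \<Rightarrow> 'b::real_normed_vector) \<Rightarrow> bool" where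
  "Ck_on 0 U f \<longleftrightarrow> continuous_on U f"
| "Ck_on (Suc k) U f \<longleftrightarrow>
     (\<forall>x\<in>U. f differentiable (at x)) \<and> (\<forall>v. Ck_on k U (\<lambda>x. frechet_derivative f (at x) v))"

definition smooth_on :: "('a::real_normed_vector) set \<Rightarrow> ('a \<Rightarrow> 'b::real_normed_vector) \<Rightarrow> bool" where
  "smooth_on U f \<longleftrightarrow> (\<forall>k. Ck_on k U f)"

definition defining_function ::
    "(complex ^ 'n::finite) set \<Rightarrow> (complex ^ 'n) set \<Rightarrow> (complex ^ 'n \<Rightarrow> real) \<Rightarrow> bool" where
  "defining_function \<Omega> U r \<longleftrightarrow>
     open U \<and> closure \<Omega> \<subseteq> U \<and> smooth_on U r \<and> \<Omega> = {z \<in> U. r z < 0} \<and>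
     (\<forall>z\<in>U. r z = 0 \<longrightarrow> frechet_derivative r (at z) \<noteq> (\<lambda>_. 0))"

definition smoothly_bounded :: "(complex ^ 'n::finite) set \<Rightarrow> bool" where
  "smoothly_bounded \<Omega> \<longleftrightarrow> bounded \<Omega> \<and> (\<exists>U r. defining_function \<Omega> U r)"

text \<open>
  Wirtinger derivatives \<open>\<partial>/\<partial>z\<^sub>j = (\<partial>/\<partial>x\<^sub>j - i \<partial>/\<partial>y\<^sub>j) / 2\<close> and
  its conjugate \<open>(\<partial>/\<partial>x\<^sub>j + i \<partial>/\<partial>y\<^sub>j) / 2\<close>, where \<open>axis j 1\<close> and \<open>axis j \<i>\<close> are the unit
  vectors in the \<open>x\<^sub>j\<close> and \<open>y\<^sub>j\<close> directions.
\<close>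

definition dz :: "'n::finite \<Rightarrow> (complex ^ 'n \<Rightarrow> complex) \<Rightarrow> complex ^ 'n \<Rightarrow> complex" where
  "dz j f x = (frechet_derivative f (at x) (axis j 1)
               - \<i> * frechet_derivative f (at x) (axis j \<i>)) / 2"

definition dzbar :: "'n::finite \<Rightarrow> (complex ^ 'n \<Rightarrow> complex) \<Rightarrow> complex ^ 'n \<Rightarrow> complex" where
  "dzbar j f x = (frechet_derivative f (at x) (axis j 1)
                  + \<i> * frechet_derivative f (at x) (axis j \<i>)) / 2"

definition levi_form :: "(complex ^ 'n::finite \<Rightarrow> real) \<Rightarrow> complex ^ 'n \<Rightarrow> complex ^ 'n \<Rightarrow> complex" where
  "levi_form r x \<xi> =
     (\<Sum>j\<in>UNIV. \<Sum>k\<in>UNIV. dz j (dzbar k (\<lambda>z. complex_of_real (r z))) x * \<xi> $ j * cnj (\<xi> $ k))"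

text \<open>
  For real \<open>C\<^sup>2\<close> functions \<open>r\<close> the Levi form is Hermitian, hence real-valued on the diagonal;
  \<^const>\<open>Re\<close> below only converts it to type \<^typ>\<open>real\<close>.
\<close>

definition strongly_pseudoconvex :: "(complex ^ 'n::finite) set \<Rightarrow> bool" where
  "strongly_pseudoconvex \<Omega> \<longleftrightarrow>
     (\<exists>U r. defining_function \<Omega> U r \<and>
        (\<forall>x\<in>frontier \<Omega>. \<forall>\<xi>. \<xi> \<noteq> 0 \<longrightarrow>
           (\<Sum>j\<in>UNIV. dz j (\<lambda>z. complex_of_real (r z)) x * \<xi> $ j) = 0 \<longrightarrow>
           0 < Re (levi_form r x \<xi>)))"

text \<open>A Frechet derivative \<open>D\<close> is only real-linear in general; the second conjunct makes it complex-linear.\<close>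

definition holomorphic_Cn :: "(complex ^ 'n::finite) set \<Rightarrow> (complex ^ 'n \<Rightarrow> complex) set" where
  "holomorphic_Cn \<Omega> =
     {f. \<forall>z\<in>\<Omega>. \<exists>D. (f has_derivative D) (at z) \<and> (\<forall>c v. D (c *s v) = c * D v)}"

definition Lp_space :: "(complex ^ 'n::finite) set \<Rightarrow> real \<Rightarrow> (complex ^ 'n \<Rightarrow> complex) set" where
  "Lp_space \<Omega> p =
     {f. f \<in> borel_measurable (lebesgue_on \<Omega>) \<and>
         integrable (lebesgue_on \<Omega>) (\<lambda>z. cmod (f z) powr p)}"

definition Lp_norm :: "(complex ^ 'n::finite) set \<Rightarrow> real \<Rightarrow> (complex ^ 'n \<Rightarrow> complex) \<Rightarrow> ennreal" where
  "Lp_norm \<Omega> p f =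
     (if f \<in> Lp_space \<Omega> p
      then ennreal ((integral\<^sup>L (lebesgue_on \<Omega>) (\<lambda>z. cmod (f z) powr p)) powr (1 / p))
      else \<infinity>)"

definition L2_inner ::
    "(complex ^ 'n::finite) set \<Rightarrow> (complex ^ 'n \<Rightarrow> complex) \<Rightarrow> (complex ^ 'n \<Rightarrow> complex) \<Rightarrow> complex" where
  "L2_inner \<Omega> f g = integral\<^sup>L (lebesgue_on \<Omega>) (\<lambda>z. f z * cnj (g z))"

definition bergman_space :: "(complex ^ 'n::finite) set \<Rightarrow> real \<Rightarrow> (complex ^ 'n \<Rightarrow> complex) set" where
  "bergman_space \<Omega> p = holomorphic_Cn \<Omega> \<inter> Lp_space \<Omega> p"

text \<open>
  Orthogonal projection of \<open>L\<^sup>2(\<Omega>)\<close> onto \<open>A\<^sup>2(\<Omega>)\<close>; the chosen function is unique on \<open>\<Omega>\<close>.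
\<close>

definition bergman_projection ::
    "(complex ^ 'n::finite) set \<Rightarrow> (complex ^ 'n \<Rightarrow> complex) \<Rightarrow> (complex ^ 'n \<Rightarrow> complex)" where
  "bergman_projection \<Omega> f =
     (SOME g. g \<in> bergman_space \<Omega> 2 \<and>
              (\<forall>h\<in>bergman_space \<Omega> 2. L2_inner \<Omega> (\<lambda>z. f z - g z) h = 0))"

text \<open>
  The Bergman projection as an operator \<open>L\<^sup>p(\<Omega>) \<rightarrow> A\<^sup>p(\<Omega>)\<close>: it is \<^const>\<open>bergman_projection\<close> on
  \<open>L\<^sup>2(\<Omega>) \<inter> L\<^sup>p(\<Omega>)\<close> (which is all of \<open>L\<^sup>p(\<Omega>)\<close> if \<open>p \<ge> 2\<close> and \<open>\<Omega>\<close> is bounded), extended to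
  \<open>L\<^sup>p(\<Omega>)\<close> by \<open>L\<^sup>p\<close>-continuity.  When the projection is \<open>L\<^sup>p\<close>-bounded the limit \<open>g\<close> exists,
  is unique on \<open>\<Omega>\<close>, and does not depend on the approximating sequence.
\<close>

definition bergman_projection_Lp ::
    "(complex ^ 'n::finite) set \<Rightarrow> real \<Rightarrow> (complex ^ 'n \<Rightarrow> complex) \<Rightarrow> (complex ^ 'n \<Rightarrow> complex)" where
  "bergman_projection_Lp \<Omega> p f =
     (if f \<in> Lp_space \<Omega> 2 then bergman_projection \<Omega> f
      else (SOME g. g \<in> bergman_space \<Omega> p \<and>
              (\<exists>F. (\<forall>k. F k \<in> Lp_space \<Omega> 2 \<inter> Lp_space \<Omega> p) \<and>
                   (\<lambda>k::nat. Lp_norm \<Omega> p (\<lambda>z. F k z - f z)) \<longlonglongrightarrow> 0 \<and>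
                   (\<lambda>k. Lp_norm \<Omega> p (\<lambda>z. bergman_projection \<Omega> (F k) z - g z)) \<longlonglongrightarrow> 0)))"

definition bergman_norm :: "(complex ^ 'n::finite) set \<Rightarrow> real \<Rightarrow> ennreal" where
  "bergman_norm \<Omega> p =
     (SUP f \<in> {f \<in> Lp_space \<Omega> p. Lp_norm \<Omega> p f \<le> 1}. Lp_norm \<Omega> p (bergman_projection_Lp \<Omega> p f))"

end

theory Submission
  imports Defs "HOL-Complex_Analysis.Cauchy_Integral_Formula" "HOL-Real_Asymp.Real_Asymp"
begin

text \<open>
  The reason for the lower bound is that \<open>P\<close> maps suitable bounded functions to functions with a
  logarithmic singularity at a boundary point, and the \<open>L\<^sup>p\<close> norm of a logarithm grows like \<open>p\<close>.
  For \<open>p\<close> near \<open>1\<close> the same functions are used through the self-adjointness of \<open>P\<close>: if \<open>q\<close> is the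
  conjugate exponent, then \<open>p\<^sup>2 / (p - 1) = p q\<close> is comparable to \<open>max p q\<close>, so in both ranges the
  norm has to be bounded below by a multiple of the larger one of the two exponents.

  To find such functions, let \<open>\<zeta>\<close> be a point of the closure of \<open>\<Omega>\<close> with maximal norm and put
  \<open>e = \<zeta> / \<bar>\<zeta>\<bar>\<close>. The domain lies in the ball of radius \<open>\<bar>\<zeta>\<bar>\<close>, so \<open>\<phi> z = \<langle>\<zeta> - z, e\<rangle>\<close> has positive
  real part on \<open>\<Omega>\<close>, indeed \<open>Re (\<phi> z) \<ge> \<bar>\<zeta> - z\<bar>\<^sup>2 / (2 \<bar>\<zeta>\<bar>)\<close>, and \<open>h = Ln (\<phi> + \<epsilon>)\<close> is holomorphic and
  bounded. It is the projection of every function \<open>h - u\<close> with \<open>u\<close> orthogonal to the Bergman space.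
  Let \<open>\<partial>\<close> be the derivative of type \<open>(1,0)\<close> in the direction \<open>e\<close>. For \<open>v\<close> vanishing on the boundary
  and \<open>g\<close> holomorphic, \<open>\<integral> \<partial>v cnj g = 0\<close> because \<open>\<partial> (cnj g) = 0\<close>; this is
  \<open>orthogonal_to_bergman_space\<close> for \<open>v = r h\<close>, where \<open>r\<close> is the defining function. With
  \<open>c = \<partial>r(\<zeta>)\<close>, which does not vanish since \<open>e\<close> is normal to the boundary at \<open>\<zeta>\<close>, the choice
  \<open>f = h - \<partial>(r h) / c = h (1 - \<partial>r / c) + r / (c (\<phi> + \<epsilon>))\<close> is bounded uniformly in \<open>\<epsilon>\<close>: the factor
  \<open>1 - \<partial>r / c\<close> is \<open>O(\<bar>z - \<zeta>\<bar>)\<close> and beats the logarithm, and \<open>\<bar>r\<bar> \<le> C Re \<phi>\<close> because moving from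
  \<open>z\<close> by the distance \<open>Re (\<phi> z)\<close> in the direction \<open>e\<close> leads out of \<open>\<Omega>\<close>. This is
  \<open>logarithmic_test_functions\<close>. On the part \<open>S\<close> of \<open>\<Omega>\<close> within distance \<open>\<epsilon>\<close> of \<open>\<zeta>\<close>, whose
  measure is at least a multiple of \<open>\<epsilon>\<^sup>2\<^sup>n\<close>, the real part of \<open>h\<close> is at most \<open>ln (2 \<epsilon>)\<close>.

  Taking \<open>\<epsilon> = exp (- q)\<close> for the larger exponent \<open>q\<close> makes \<open>\<bar>S\<bar>\<close> to the power \<open>1 / q\<close> bounded below
  while \<open>\<bar>h\<bar> \<ge> q / 2\<close> on \<open>S\<close>. For large exponents one tests \<open>P\<close> on \<open>f\<close>; for exponents near \<open>1\<close> one
  tests \<open>P\<close> on a multiple of the indicator function of \<open>S\<close> and pairs the result with \<open>f\<close>.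
  The second case needs the projection of a function for which no explicit formula is available,
  so the existence of the orthogonal projection onto the Bergman space has to be established. It
  comes from a minimizing sequence, which converges locally uniformly because point
  evaluations are bounded on the Bergman space (\<open>bergman_space_sup_bound\<close>).
\<close>

section \<open>Differentiation under the integral and integration by parts\<close>

text \<open>
  The difference quotients converge pointwise and are dominated by \<open>w\<close>. Dominated convergence is
  applied along an arbitrary sequence of increments tending to \<open>0\<close>.
\<close>
lemma has_vector_derivative_integral:
  fixes F :: "real \<Rightarrow> 'a \<Rightarrow> 'b::{banach, second_countable_topology}"
  assumes d: "0 < d"
    and int: "\<And>t. \<bar>t - t0\<bar> < d \<Longrightarrow> integrable M (F t)"
    and der: "\<And>x. x \<in> space M \<Longrightarrow> ((\<lambda>t. F t x) has_vector_derivative F' x) (at t0)"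
    and w: "integrable M w"
    and bd: "\<And>t x. \<bar>t - t0\<bar> < d \<Longrightarrow> x \<in> space M \<Longrightarrow> norm (F t x - F t0 x) \<le> \<bar>t - t0\<bar> * w x"
  shows "((\<lambda>t. integral\<^sup>L M (F t)) has_vector_derivative integral\<^sup>L M F') (at t0)"
    and "integrable M F'"
proof -
  have lim: "integrable M F' \<and> (\<lambda>n. integral\<^sup>L M (\<lambda>x. (F (t0 + s n) x - F t0 x) /\<^sub>R s n)) \<longlonglongrightarrow> integral\<^sup>L M F'"
    if s0: "\<And>n. s n \<noteq> 0" "\<And>n. \<bar>s n\<bar> < d" and s: "s \<longlonglongrightarrow> 0" for s :: "nat \<Rightarrow> real"
  proof -
    have meas: "(\<lambda>x. (F (t0 + s n) x - F t0 x) /\<^sub>R s n) \<in> borel_measurable M" for n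
      using int[of "t0 + s n", THEN borel_measurable_integrable] int[of t0, THEN borel_measurable_integrable] s0 d
      by (intro borel_measurable_scaleR borel_measurable_const borel_measurable_diff) auto
    have conv: "(\<lambda>n. (F (t0 + s n) x - F t0 x) /\<^sub>R s n) \<longlonglongrightarrow> F' x" if "x \<in> space M" for x
    proof -
      have "((\<lambda>h. (F (t0 + h) x - F t0 x) /\<^sub>R h) \<longlongrightarrow> F' x) (at 0)"
        using der[OF that] unfolding has_vector_derivative_def has_derivative_at
      proof -
        assume a: "bounded_linear (\<lambda>xa. xa *\<^sub>R F' x) \<and> (\<lambda>h. norm (F (t0 + h) x - F t0 x - h *\<^sub>R F' x) / norm h) \<midarrow>0\<rightarrow> 0"
        have eq: "norm (F (t0 + h) x - F t0 x - h *\<^sub>R F' x) / norm h = norm ((F (t0 + h) x - F t0 x) /\<^sub>R h - F' x)"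
          if "h \<noteq> 0" for h
        proof -
          have "(F (t0 + h) x - F t0 x) /\<^sub>R h - F' x = (F (t0 + h) x - F t0 x - h *\<^sub>R F' x) /\<^sub>R h"
            using that by (simp add: algebra_simps)
          then show ?thesis by (simp add: divide_inverse mult.commute)
        qed
        have "(\<lambda>h. norm ((F (t0 + h) x - F t0 x) /\<^sub>R h - F' x)) \<midarrow>0\<rightarrow> 0"
          by (rule Lim_transform_eventually[OF conjunct2[OF a]])
             (rule eventually_mono[OF eventually_neq_at_within], rule eq)
        then show ?thesis
          unfolding tendsto_dist_iff[of _ "F' x"] dist_norm .
      qed
      moreover have "filterlim s (at 0) sequentially"
        using s s0 by (simp add: filterlim_at)
      ultimately show ?thesis
        by (rule filterlim_compose)
    qed
    have F'meas: "F' \<in> borel_measurable M"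
      by (rule borel_measurable_LIMSEQ_metric[OF meas conv])
    have bnd: "norm ((F (t0 + s n) x - F t0 x) /\<^sub>R s n) \<le> w x" if "x \<in> space M" for n x
    proof -
      have "norm (F (t0 + s n) x - F t0 x) \<le> \<bar>s n\<bar> * w x"
        using bd[of "t0 + s n" x] s0[of n] that by simp
      then have "norm (F (t0 + s n) x - F t0 x) / \<bar>s n\<bar> \<le> w x"
        using s0(1)[of n] by (simp add: field_simps)
      then show ?thesis
        by (simp add: divide_inverse mult.commute)
    qed
    show ?thesis
    proof
      show "integrable M F'"
        by (rule integrable_dominated_convergence[where w = w, OF F'meas meas w])
           (rule AE_I2, erule conv, rule AE_I2, erule bnd)
      show "(\<lambda>n. integral\<^sup>L M (\<lambda>x. (F (t0 + s n) x - F t0 x) /\<^sub>R s n)) \<longlonglongrightarrow> integral\<^sup>L M F'"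
        by (rule integral_dominated_convergence[where w = w, OF F'meas meas w])
           (rule AE_I2, erule conv, rule AE_I2, erule bnd)
    qed
  qed
  have "integrable M F' \<and> (\<lambda>n. integral\<^sup>L M (\<lambda>x. (F (t0 + d / (real n + 2)) x - F t0 x) /\<^sub>R (d / (real n + 2)))) \<longlonglongrightarrow> integral\<^sup>L M F'"
  proof (rule lim)
    show "(\<lambda>n. d / (real n + 2)) \<longlonglongrightarrow> 0"
      by real_asymp
  qed (use d in \<open>auto simp: field_simps add_pos_nonneg\<close>)
  then show "integrable M F'" by simp
  have "((\<lambda>h. (integral\<^sup>L M (F (t0 + h)) - integral\<^sup>L M (F t0)) /\<^sub>R h) \<longlongrightarrow> integral\<^sup>L M F') (at 0)"
    unfolding tendsto_at_iff_sequentially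
  proof (intro allI impI)
    fix X :: "nat \<Rightarrow> real"
    assume X: "\<forall>i. X i \<in> UNIV - {0}" "X \<longlonglongrightarrow> 0"
    have "\<forall>\<^sub>F n in sequentially. \<bar>X n\<bar> < d"
      using order_tendstoD(2)[OF tendsto_rabs_zero[OF X(2)] d] .
    then obtain N where N: "\<And>n. n \<ge> N \<Longrightarrow> \<bar>X n\<bar> < d" by (auto simp: eventually_sequentially)
    have eq: "integral\<^sup>L M (\<lambda>x. (F (t0 + X (n + N)) x - F t0 x) /\<^sub>R X (n + N))
        = (integral\<^sup>L M (F (t0 + X (n + N))) - integral\<^sup>L M (F t0)) /\<^sub>R X (n + N)" for n
      using int[of "t0 + X (n + N)"] int[of t0] N[of "n + N"] d by simp
    have "(\<lambda>n. integral\<^sup>L M (\<lambda>x. (F (t0 + X (n + N)) x - F t0 x) /\<^sub>R X (n + N))) \<longlonglongrightarrow> integral\<^sup>L M F'"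
      using lim[of "\<lambda>n. X (n + N)"] X N LIMSEQ_ignore_initial_segment[OF X(2)] by auto
    then have "(\<lambda>n. (integral\<^sup>L M (F (t0 + X (n + N))) - integral\<^sup>L M (F t0)) /\<^sub>R X (n + N)) \<longlonglongrightarrow> integral\<^sup>L M F'"
      by (simp only: eq)
    then show "((\<lambda>h. (integral\<^sup>L M (F (t0 + h)) - integral\<^sup>L M (F t0)) /\<^sub>R h) \<circ> X) \<longlonglongrightarrow> integral\<^sup>L M F'"
      unfolding o_def by (rule LIMSEQ_offset)
  qed
  then have L: "(\<lambda>h. norm ((integral\<^sup>L M (F (t0 + h)) - integral\<^sup>L M (F t0)) /\<^sub>R h - integral\<^sup>L M F')) \<midarrow>0\<rightarrow> 0"
    unfolding tendsto_dist_iff[of _ "integral\<^sup>L M F'"] dist_norm .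
  show "((\<lambda>t. integral\<^sup>L M (F t)) has_vector_derivative integral\<^sup>L M F') (at t0)"
    unfolding has_vector_derivative_def has_derivative_at
  proof (intro conjI bounded_linear_scaleR_left)
    have eq: "norm ((integral\<^sup>L M (F (t0 + h)) - integral\<^sup>L M (F t0)) /\<^sub>R h - integral\<^sup>L M F')
       = norm (integral\<^sup>L M (F (t0 + h)) - integral\<^sup>L M (F t0) - h *\<^sub>R integral\<^sup>L M F') / norm h" if "h \<noteq> 0" for h
    proof -
      have "(integral\<^sup>L M (F (t0 + h)) - integral\<^sup>L M (F t0)) /\<^sub>R h - integral\<^sup>L M F'
         = (integral\<^sup>L M (F (t0 + h)) - integral\<^sup>L M (F t0) - h *\<^sub>R integral\<^sup>L M F') /\<^sub>R h"
        using that by (simp add: algebra_simps)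
      then show ?thesis by (simp add: divide_inverse mult.commute)
    qed
    show "(\<lambda>h. norm (integral\<^sup>L M (F (t0 + h)) - integral\<^sup>L M (F t0) - h *\<^sub>R integral\<^sup>L M F') / norm h) \<midarrow>0\<rightarrow> 0"
      by (rule Lim_transform_eventually[OF L]) (rule eventually_mono[OF eventually_neq_at_within], rule eq)
  qed
qed

lemma integral_lborel_translation:
  fixes F :: "'a::euclidean_space \<Rightarrow> 'b::{banach, second_countable_topology}"
  assumes [measurable]: "F \<in> borel_measurable borel"
  shows "(\<integral>x. F (x + a) \<partial>lborel) = (\<integral>x. F x \<partial>lborel)"
proof -
  have "(\<integral>x. F x \<partial>lborel) = (\<integral>x. F x \<partial>distr lborel borel ((+) a))"
    by (simp add: lborel_distr_plus)
  also have "\<dots> = (\<integral>x. F (a + x) \<partial>lborel)"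
    by (rule integral_distr) auto
  finally show ?thesis by (simp add: add.commute)
qed

lemma integrable_continuous_bounded_support:
  fixes F :: "'a::euclidean_space \<Rightarrow> 'b::{banach, second_countable_topology}"
  assumes "continuous_on UNIV F" "\<And>x. norm x > R \<Longrightarrow> F x = 0"
  shows "integrable lborel F"
proof -
  have "integrable lborel (\<lambda>x. indicator (cball 0 R) x *\<^sub>R F x)"
    by (rule borel_integrable_compact) (auto intro: continuous_on_subset[OF assms(1)])
  moreover have "(\<lambda>x. indicator (cball 0 R) x *\<^sub>R F x) = F"
    using assms(2) by (auto simp: indicator_def fun_eq_iff)
  ultimately show ?thesis by simp
qed

text \<open>
  By translation invariance \<open>\<integral> F (x + t b) dx\<close> is constant in \<open>t\<close>; the integral in question is its
  derivative at \<open>t = 0\<close>. All integrations by parts below are instances of this fact.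
\<close>
lemma integral_directional_derivative_eq_0:
  fixes F :: "'a::euclidean_space \<Rightarrow> 'b::{banach, second_countable_topology}"
  assumes der: "\<And>x. (F has_derivative F' x) (at x)"
    and bd: "\<And>x. norm (F' x b) \<le> B"
    and supp: "\<And>x. norm x > R \<Longrightarrow> F x = 0"
  shows "(\<integral>x. F' x b \<partial>lborel) = 0" and "integrable lborel (\<lambda>x. F' x b)"
proof -
  have B: "B \<ge> 0" using bd[of 0] norm_ge_zero order_trans by blast
  have cont: "continuous_on UNIV F"
    using der has_derivative_continuous_on has_derivative_at_withinI by blast
  have meas [measurable]: "F \<in> borel_measurable borel"
    using cont by (rule borel_measurable_continuous_onI)
  define S where "S = R + norm b"
  have shift: "((\<lambda>t. F (x + t *\<^sub>R b)) has_vector_derivative F' (x + t *\<^sub>R b) b) (at t)" for x t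
  proof -
    have "((\<lambda>t. F (x + t *\<^sub>R b)) has_derivative (\<lambda>s. F' (x + t *\<^sub>R b) (s *\<^sub>R b))) (at t)"
      by (rule has_derivative_compose[where f = "\<lambda>t. x + t *\<^sub>R b" and g = F, OF _ der])
         (auto intro!: derivative_eq_intros)
    moreover have "F' (x + t *\<^sub>R b) (s *\<^sub>R b) = s *\<^sub>R F' (x + t *\<^sub>R b) b" for s
      using der has_derivative_bounded_linear bounded_linear.linear linear_scale by blast
    ultimately show ?thesis by (simp add: has_vector_derivative_def)
  qed
  have bound: "norm (F (x + t *\<^sub>R b) - F (x + 0 *\<^sub>R b)) \<le> \<bar>t - 0\<bar> * (B * indicator (cball 0 S) x)"
    if "\<bar>t - 0\<bar> < 1" for t x
  proof (cases "norm x \<le> S")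
    case True
    have "norm ((\<lambda>t. F (x + t *\<^sub>R b)) t - (\<lambda>t. F (x + t *\<^sub>R b)) 0) \<le> B * norm (t - 0)"
    proof (rule differentiable_bound[of UNIV])
      fix s :: real
      show "((\<lambda>t. F (x + t *\<^sub>R b)) has_derivative (\<lambda>r. r *\<^sub>R F' (x + s *\<^sub>R b) b)) (at s within UNIV)"
        using shift[of x s] by (simp add: has_vector_derivative_def)
      show "onorm (\<lambda>r. r *\<^sub>R F' (x + s *\<^sub>R b) b) \<le> B"
        by (rule onorm_le) (use mult_right_mono[OF bd abs_ge_zero] in \<open>simp add: mult.commute\<close>)
    qed auto
    then show ?thesis using True by (simp add: mult.commute)
  next
    case False
    then have x: "norm x > R + norm b" by (simp add: S_def)
    have "norm (t *\<^sub>R b) \<le> norm b" using that mult_right_mono[of "\<bar>t\<bar>" 1 "norm b"] by simp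
    then have "norm (x + t *\<^sub>R b) > R"
      using x norm_triangle_ineq2[of x "- (t *\<^sub>R b)"] by simp
    moreover have "norm x > R" using x norm_ge_zero[of b] by linarith
    ultimately show ?thesis using supp False by simp
  qed
  have int: "integrable lborel F"
    by (rule integrable_continuous_bounded_support[OF cont supp])
  have intt: "integrable lborel (\<lambda>x. F (x + t *\<^sub>R b))" for t
  proof (rule integrable_continuous_bounded_support[where R = "R + norm (t *\<^sub>R b)"])
    show "continuous_on UNIV (\<lambda>x. F (x + t *\<^sub>R b))"
      by (intro continuous_on_compose2[OF cont] continuous_intros) auto
    show "F (x + t *\<^sub>R b) = 0" if "R + norm (t *\<^sub>R b) < norm x" for x
      by (rule supp) (use that norm_triangle_ineq2[of x "- (t *\<^sub>R b)"] in simp)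
  qed
  have w: "integrable lborel (\<lambda>x. B * indicator (cball 0 S) x :: real)"
    using emeasure_lborel_cball_finite[of 0 S]
    by (intro integrable_mult_right integrable_real_indicator) (auto simp: less_top)
  have der0: "((\<lambda>t. F (x + t *\<^sub>R b)) has_vector_derivative F' x b) (at 0)" for x
    using shift[of x 0] by simp
  note D = has_vector_derivative_integral[where F = "\<lambda>t x. F (x + t *\<^sub>R b)" and F' = "\<lambda>x. F' x b" and ?t0.0 = 0,
      OF zero_less_one intt der0 w bound]
  show "integrable lborel (\<lambda>x. F' x b)" using D(2) .
  have "((\<lambda>t. \<integral>x. F x \<partial>lborel) has_vector_derivative (\<integral>x. F' x b \<partial>lborel)) (at (0::real))"
    using D(1) by (simp add: integral_lborel_translation[OF meas])
  then show "(\<integral>x. F' x b \<partial>lborel) = 0"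
    using vector_derivative_unique_at[OF _ has_vector_derivative_const] by metis
qed

section \<open>Holomorphic functions of several variables\<close>

lemma norm_vector_smult: "norm (c *s v) = cmod c * norm (v :: complex ^ 'n::finite)"
  by (simp add: norm_vec_def norm_mult L2_set_right_distrib)

lemma bounded_linear_vector_smult_left: "bounded_linear (\<lambda>c. c *s (v :: complex ^ 'n::finite))"
  by (rule bounded_linear_intro[where K = "norm v"])
     (auto simp: vec_eq_iff norm_vector_smult algebra_simps)

lemma scaleR_eq_vector_smult: "r *\<^sub>R v = complex_of_real r *s (v :: complex ^ 'n::finite)"
  by (simp add: vec_eq_iff scaleR_conv_of_real[where 'a = complex])

lemma inner_vector_smult_i: "(\<i> *s v) \<bullet> v = (0::real)" for v :: "complex ^ 'n::finite"
  by (simp add: inner_vec_def inner_complex_def)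

lemma holomorphic_CnD:
  assumes "f \<in> holomorphic_Cn \<Omega>" "z \<in> \<Omega>"
  shows "(f has_derivative frechet_derivative f (at z)) (at z)"
    and "frechet_derivative f (at z) (c *s v) = c * frechet_derivative f (at z) v"
proof -
  obtain D where D: "(f has_derivative D) (at z)" "\<And>c v. D (c *s v) = c * D v"
    using assms unfolding holomorphic_Cn_def by blast
  then have "frechet_derivative f (at z) = D"
    by (metis frechet_derivative_at)
  with D show "(f has_derivative frechet_derivative f (at z)) (at z)"
    "frechet_derivative f (at z) (c *s v) = c * frechet_derivative f (at z) v"
    by auto
qed

lemma holomorphic_CnI:
  assumes "\<And>z. z \<in> \<Omega> \<Longrightarrow> (f has_derivative f' z) (at z)"
    and "\<And>z c v. z \<in> \<Omega> \<Longrightarrow> f' z (c *s v) = c * f' z v"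
  shows "f \<in> holomorphic_Cn \<Omega>"
  unfolding holomorphic_Cn_def using assms by blast

lemma holomorphic_Cn_continuous_on:
  assumes "f \<in> holomorphic_Cn \<Omega>" shows "continuous_on \<Omega> f"
  using holomorphic_CnD(1)[OF assms] has_derivative_continuous continuous_at_imp_continuous_on
  by blast

lemma holomorphic_Cn_add:
  assumes "f \<in> holomorphic_Cn \<Omega>" "g \<in> holomorphic_Cn \<Omega>"
  shows "(\<lambda>z. f z + g z) \<in> holomorphic_Cn \<Omega>"
  by (rule holomorphic_CnI[where f' = "\<lambda>z v. frechet_derivative f (at z) v + frechet_derivative g (at z) v"])
     (auto intro!: has_derivative_add holomorphic_CnD assms
       simp: holomorphic_CnD[OF assms(1)] holomorphic_CnD[OF assms(2)] algebra_simps)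

lemma holomorphic_Cn_mult:
  assumes "f \<in> holomorphic_Cn \<Omega>" "g \<in> holomorphic_Cn \<Omega>"
  shows "(\<lambda>z. f z * g z) \<in> holomorphic_Cn \<Omega>"
proof (rule holomorphic_CnI)
  fix z assume z: "z \<in> \<Omega>"
  show "((\<lambda>z. f z * g z) has_derivative
      (\<lambda>v. f z * frechet_derivative g (at z) v + frechet_derivative f (at z) v * g z)) (at z)"
    by (intro has_derivative_mult holomorphic_CnD(1)[OF assms(1) z] holomorphic_CnD(1)[OF assms(2) z])
  show "f z * frechet_derivative g (at z) (c *s v) + frechet_derivative f (at z) (c *s v) * g z =
      c * (f z * frechet_derivative g (at z) v + frechet_derivative f (at z) v * g z)" for c v
    by (simp add: holomorphic_CnD(2)[OF assms(1) z] holomorphic_CnD(2)[OF assms(2) z] algebra_simps)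
qed

lemma holomorphic_Cn_const: "(\<lambda>z. c) \<in> holomorphic_Cn \<Omega>"
  by (rule holomorphic_CnI[where f' = "\<lambda>z v. 0"]) auto

lemma holomorphic_Cn_diff:
  assumes "f \<in> holomorphic_Cn \<Omega>" "g \<in> holomorphic_Cn \<Omega>"
  shows "(\<lambda>z. f z - g z) \<in> holomorphic_Cn \<Omega>"
  using holomorphic_Cn_add[OF assms(1) holomorphic_Cn_mult[OF holomorphic_Cn_const[of "-1"] assms(2)]] by simp

text \<open>
  The one-variable Cauchy inequality for \<open>c \<mapsto> f (z + c v)\<close> on the disc of radius \<open>\<rho> / \<bar>v\<bar>\<close>. In
  particular a holomorphic function is locally Lipschitz, although the definition of
  holomorphy only asks for a complex-linear derivative at each point.
\<close>
lemma holomorphic_Cn_cauchy_estimate: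
  fixes \<Omega> :: "(complex ^ 'n::finite) set"
  assumes f: "f \<in> holomorphic_Cn \<Omega>" and sub: "cball z \<rho> \<subseteq> \<Omega>" and \<rho>: "\<rho> > 0"
    and M: "\<And>w. w \<in> cball z \<rho> \<Longrightarrow> cmod (f w) \<le> M"
  shows "cmod (frechet_derivative f (at z) v) \<le> M / \<rho> * norm v"
proof (cases "v = 0")
  case True
  then show ?thesis
    using holomorphic_CnD(2)[OF f, of z 0 0] sub \<rho> by (auto simp: subset_iff)
next
  case False
  define \<phi> where "\<phi> c = f (z + c *s v)" for c
  define R where "R = \<rho> / norm v"
  have R: "R > 0" using False \<rho> by (simp add: R_def)
  have mem: "z + c *s v \<in> cball z \<rho>" if "c \<in> cball 0 R" for c
    using that False by (auto simp: dist_norm norm_vector_smult R_def field_simps)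
  have der: "(\<phi> has_field_derivative frechet_derivative f (at (z + c *s v)) v) (at c)" if "c \<in> cball 0 R" for c
  proof -
    have "z + c *s v \<in> \<Omega>" using mem[OF that] sub by blast
    note D = holomorphic_CnD[OF f this]
    have "((\<lambda>c. f (z + c *s v)) has_derivative (\<lambda>h. frechet_derivative f (at (z + c *s v)) (h *s v))) (at c)"
      by (rule has_derivative_compose[where f = "\<lambda>c. z + c *s v" and g = f, OF _ D(1)])
         (auto intro!: derivative_eq_intros bounded_linear.has_derivative[OF bounded_linear_vector_smult_left])
    then show ?thesis
      unfolding \<phi>_def has_field_derivative_def by (simp add: D(2) mult.commute[of _ "frechet_derivative f (at (z + c *s v)) v"])
  qed
  have "cmod ((deriv ^^ 1) \<phi> 0) \<le> fact 1 * M / R ^ 1"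
  proof (rule Cauchy_inequality)
    show "\<phi> holomorphic_on ball 0 R"
      using der unfolding holomorphic_on_def field_differentiable_def
      by (meson ball_subset_cball has_field_derivative_at_within subsetD)
    show "continuous_on (cball 0 R) \<phi>"
      using der by (meson DERIV_isCont continuous_at_imp_continuous_on)
    show "cmod (\<phi> x) \<le> M" if "cmod (0 - x) = R" for x
      unfolding \<phi>_def using that by (intro M mem) auto
  qed (rule R)
  moreover have "deriv \<phi> 0 = frechet_derivative f (at z) v"
    using der[of 0] R by (simp add: DERIV_imp_deriv)
  ultimately show ?thesis by (simp add: R_def mult.commute)
qed

lemma max_square_has_derivative:
  "((\<lambda>t::real. (max 0 (t - \<delta>))\<^sup>2) has_real_derivative 2 * max 0 (t - \<delta>)) (at t)"
proof -
  consider "t > \<delta>" | "t < \<delta>" | "t = \<delta>" by linarith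
  then show ?thesis
  proof cases
    case 1
    show ?thesis
    proof (rule has_field_derivative_transform_within_open[where S = "{\<delta><..}" and f = "\<lambda>t. (t - \<delta>)\<^sup>2"])
      show "((\<lambda>t. (t - \<delta>)\<^sup>2) has_real_derivative 2 * max 0 (t - \<delta>)) (at t)"
        using 1 by (auto intro!: derivative_eq_intros)
    qed (use 1 in auto)
  next
    case 2
    show ?thesis
    proof (rule has_field_derivative_transform_within_open[where S = "{..<\<delta>}" and f = "\<lambda>t. 0"])
      show "((\<lambda>t. 0) has_real_derivative 2 * max 0 (t - \<delta>)) (at t)"
        using 2 by (auto intro!: derivative_eq_intros)
    qed (use 2 in auto)
  next
    case 3
    have "(\<lambda>h::real. ((max 0 (\<delta> + h - \<delta>))\<^sup>2 - (max 0 (\<delta> - \<delta>))\<^sup>2) / h) = (\<lambda>h. max 0 h)"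
      by (auto simp: fun_eq_iff max_def power2_eq_square)
    moreover have "((\<lambda>h::real. max 0 h) \<longlongrightarrow> max 0 0) (at 0)"
      by (intro tendsto_intros)
    ultimately show ?thesis using 3 by (simp add: DERIV_def)
  qed
qed

text \<open>
  The radial weight of the mean value formula. Squaring the positive part makes it continuously
  differentiable across the sphere that bounds its support.
\<close>
lemma weight_has_derivative:
  fixes w :: "'a::real_inner"
  shows "((\<lambda>w. (max 0 (a - w \<bullet> w))\<^sup>2) has_derivative (\<lambda>v. - 4 * max 0 (a - w \<bullet> w) * (w \<bullet> v))) (at w)"
proof -
  have "((\<lambda>t::real. (max 0 t)\<^sup>2) has_derivative (\<lambda>h. 2 * max 0 t * h)) (at t)" for t
    using max_square_has_derivative[of 0 t] unfolding has_field_derivative_def by simp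
  moreover have "((\<lambda>w. a - w \<bullet> w) has_derivative (\<lambda>v. - 2 * (w \<bullet> v))) (at w)"
    by (auto intro!: derivative_eq_intros simp: inner_commute fun_eq_iff)
  ultimately have "((\<lambda>w. (max 0 (a - w \<bullet> w))\<^sup>2) has_derivative (\<lambda>v. 2 * max 0 (a - w \<bullet> w) * (- 2 * (w \<bullet> v)))) (at w)"
    by (rule has_derivative_compose[rotated])
  then show ?thesis by (simp add: algebra_simps)
qed

text \<open>
  The vector field \<open>w \<mapsto> \<i> w\<close> generates the rotations \<open>w \<mapsto> exp (\<i> \<theta>) w\<close> and is divergence-free, since
  \<open>\<i> b\<close> is perpendicular to \<open>b\<close>. Hence the derivative of \<open>G\<close> along it integrates to \<open>0\<close>. This is
  the infinitesimal form of the rotation invariance of Lebesgue measure.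
\<close>
lemma integral_rotation_derivative_eq_0:
  fixes G :: "complex ^ 'n::finite \<Rightarrow> complex"
  assumes der: "\<And>w. (G has_derivative G' w) (at w)"
    and bd: "\<And>w v. cmod (G' w v) \<le> B * norm v"
    and supp: "\<And>w. norm w > R \<Longrightarrow> G w = 0"
  shows "(\<integral>w. G' w (\<i> *s w) \<partial>lborel) = 0"
proof -
  have R: "B \<ge> 0"
  proof -
    obtain b :: "complex ^ 'n" where "b \<in> Basis" using SOME_Basis by blast
    then have "cmod (G' 0 b) \<le> B" using bd[of 0 b] by simp
    then show ?thesis by (rule order_trans[OF norm_ge_zero])
  qed
  have G'0: "G' w v = 0" if "norm w > R" for w v
  proof -
    have "(G has_derivative (\<lambda>v. 0)) (at w)"
    proof (rule has_derivative_transform_within_open[where s = "- cball 0 R"])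
      show "((\<lambda>w. 0) has_derivative (\<lambda>v. 0)) (at w)" by simp
    qed (use that supp in \<open>auto simp: not_le\<close>)
    with der[of w] have "G' w = (\<lambda>v. 0)" by (rule has_derivative_unique)
    then show ?thesis by simp
  qed
  have "continuous_on UNIV G"
    using der has_derivative_continuous_on has_derivative_at_withinI by blast
  then have "compact (G ` cball 0 R)"
    by (intro compact_continuous_image) (auto intro: continuous_on_subset)
  then obtain K where K: "\<And>w. w \<in> cball 0 R \<Longrightarrow> cmod (G w) \<le> K"
    by (drule_tac compact_imp_bounded) (unfold bounded_iff, blast)
  have GK: "cmod (G w) \<le> \<bar>K\<bar>" for w
    using K[of w] supp[of w] by (cases "norm w \<le> R") auto
  have lin: "linear (G' w)" for w
    using der has_derivative_bounded_linear bounded_linear.linear by blast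
  have rot: "((\<lambda>w. \<i> *s w) has_derivative (\<lambda>v. \<i> *s v)) (at w)" for w :: "complex ^ 'n"
    by (rule bounded_linear_imp_has_derivative, rule bounded_linear_intro[where K = 1])
       (auto simp: vec_eq_iff norm_vector_smult algebra_simps)
  have part: "(\<integral>w. ((\<i> *s w) \<bullet> b) *\<^sub>R G' w b \<partial>lborel) = 0 \<and> integrable lborel (\<lambda>w. ((\<i> *s w) \<bullet> b) *\<^sub>R G' w b)"
    if b: "b \<in> Basis" for b
  proof -
    have d: "((\<lambda>w. ((\<i> *s w) \<bullet> b) *\<^sub>R G w) has_derivative
         (\<lambda>v. ((\<i> *s w) \<bullet> b) *\<^sub>R G' w v + ((\<i> *s v) \<bullet> b) *\<^sub>R G w)) (at w)" for w
      by (intro has_derivative_scaleR has_derivative_inner_left der rot)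
    have "cmod (((\<i> *s w) \<bullet> b) *\<^sub>R G' w b + ((\<i> *s b) \<bullet> b) *\<^sub>R G w) \<le> \<bar>R\<bar> * B" for w
    proof (cases "norm w \<le> R")
      case True
      have "\<bar>(\<i> *s w) \<bullet> b\<bar> \<le> \<bar>R\<bar>"
        using Cauchy_Schwarz_ineq2[of "\<i> *s w" b] b True by (simp add: norm_vector_smult)
      moreover have "cmod (G' w b) \<le> B" using bd[of w b] b by simp
      ultimately show ?thesis
        by (simp add: inner_vector_smult_i mult_mono)
    next
      case False
      then show ?thesis using R by (simp add: G'0 inner_vector_smult_i)
    qed
    note E = integral_directional_derivative_eq_0[OF d this, of R]
    show ?thesis using E supp by (simp add: inner_vector_smult_i)
  qed
  have "G' w (\<i> *s w) = (\<Sum>b\<in>Basis. ((\<i> *s w) \<bullet> b) *\<^sub>R G' w b)" for w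
    by (subst euclidean_representation[of "\<i> *s w", symmetric])
       (simp only: linear_sum[OF lin] linear_scale[OF lin])
  then show ?thesis
    using part by (simp add: Bochner_Integration.integral_sum)
qed

text \<open>
  Let \<open>I t\<close> be the integral of \<open>\<eta> w f (z + t w)\<close> over \<open>w\<close>. Its derivative is the integral of
  \<open>\<eta> w f' (z + t w) w\<close>. Since \<open>f'\<close> is complex-linear, multiplying this by \<open>\<i> t\<close> gives the integral of the
  derivative of \<open>\<eta> w f (z + t w)\<close> along the rotation field \<open>\<i> w\<close>, along which the radial weight \<open>\<eta>\<close> is
  constant; so \<open>I\<close> is constant, and \<open>I 0\<close> is the value at the centre.
\<close>
lemma holomorphic_Cn_weighted_mean_value:
  fixes \<Omega> :: "(complex ^ 'n::finite) set"
  assumes f: "f \<in> holomorphic_Cn \<Omega>" and sub: "cball z (3 * \<rho>) \<subseteq> \<Omega>" and \<rho>: "\<rho> > 0"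
  defines "\<eta> \<equiv> \<lambda>w :: complex ^ 'n. (max 0 (\<rho>\<^sup>2 - w \<bullet> w))\<^sup>2"
  shows "(\<integral>w. \<eta> w *\<^sub>R f (z + w) \<partial>lborel) = (\<integral>w. \<eta> w \<partial>lborel) *\<^sub>R f z"
proof -
  let ?f' = "\<lambda>z. frechet_derivative f (at z)"
  define \<eta>' where "\<eta>' w v = - 4 * max 0 (\<rho>\<^sup>2 - w \<bullet> w) * (w \<bullet> v)" for w v :: "complex ^ 'n"
  have der\<eta>: "(\<eta> has_derivative \<eta>' w) (at w)" for w
    unfolding \<eta>_def \<eta>'_def by (rule weight_has_derivative)
  have \<eta>0: "\<eta> w = 0" if "norm w \<ge> \<rho>" for w
    using power_mono[OF that, of 2] \<rho> by (simp add: \<eta>_def dot_square_norm)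
  have \<eta>'0: "\<eta>' w v = 0" if "norm w \<ge> \<rho>" for w v
    using power_mono[OF that, of 2] \<rho> by (simp add: \<eta>'_def dot_square_norm)
  have \<eta>le: "0 \<le> \<eta> w" "\<eta> w \<le> \<rho>^4" for w
  proof -
    show "0 \<le> \<eta> w" by (simp add: \<eta>_def)
    have "(max 0 (\<rho>\<^sup>2 - w \<bullet> w))\<^sup>2 \<le> (\<rho>\<^sup>2)\<^sup>2"
      by (rule power_mono) auto
    then show "\<eta> w \<le> \<rho>^4" by (simp add: \<eta>_def)
  qed
  have \<eta>'le: "\<bar>\<eta>' w v\<bar> \<le> 4 * \<rho>^3 * norm v" for w v
  proof (cases "norm w \<le> \<rho>")
    case True
    have "\<bar>\<eta>' w v\<bar> = 4 * max 0 (\<rho>\<^sup>2 - w \<bullet> w) * \<bar>w \<bullet> v\<bar>"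
      by (simp add: \<eta>'_def abs_mult)
    also have "\<dots> \<le> 4 * \<rho>\<^sup>2 * (\<rho> * norm v)"
      by (intro mult_mono order_trans[OF Cauchy_Schwarz_ineq2] mult_right_mono True) (use \<rho> in auto)
    finally show ?thesis by (simp add: power2_eq_square power3_eq_cube mult_ac)
  qed (use \<eta>'0 \<rho> in auto)
  have "compact (f ` cball z (3 * \<rho>))"
    by (intro compact_continuous_image continuous_on_subset[OF holomorphic_Cn_continuous_on[OF f] sub]) auto
  then obtain M where M: "\<And>w. w \<in> cball z (3 * \<rho>) \<Longrightarrow> cmod (f w) \<le> M"
    by (drule_tac compact_imp_bounded) (unfold bounded_iff, blast)
  have M0: "M \<ge> 0" using M[of z] \<rho> norm_ge_zero[of "f z"] by (simp del: norm_ge_zero)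
  define L where "L = M / \<rho>"
  have L0: "L \<ge> 0" using M0 \<rho> by (simp add: L_def)
  have f'L: "cmod (?f' w v) \<le> L * norm v" if "w \<in> cball z (2 * \<rho>)" for w v
  proof -
    have "cball w \<rho> \<subseteq> cball z (3 * \<rho>)"
      using that by (intro cball_subset_cball_iff[THEN iffD2] disjI1) (simp add: dist_commute)
    then show ?thesis
      unfolding L_def using sub M \<rho> by (intro holomorphic_Cn_cauchy_estimate[OF f]) auto
  qed
  have mem: "z + t *\<^sub>R w \<in> cball z (2 * \<rho>)" if "\<bar>t\<bar> \<le> 2" "norm w \<le> \<rho>" for t w
    using mult_mono[OF that] by (simp add: dist_norm)
  have sub2: "cball z (2 * \<rho>) \<subseteq> \<Omega>" using sub \<rho> by (auto simp: subset_iff)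
  have line: "((\<lambda>t. f (z + t *\<^sub>R w)) has_vector_derivative ?f' (z + t *\<^sub>R w) w) (at t)"
    if "\<bar>t\<bar> \<le> 2" "norm w \<le> \<rho>" for t w
  proof -
    have D: "(f has_derivative ?f' (z + t *\<^sub>R w)) (at (z + t *\<^sub>R w))"
      using mem[OF that] sub2 by (intro holomorphic_CnD(1)[OF f]) auto
    have "((\<lambda>t. f (z + t *\<^sub>R w)) has_derivative (\<lambda>s. ?f' (z + t *\<^sub>R w) (s *\<^sub>R w))) (at t)"
      by (rule has_derivative_compose[where f = "\<lambda>t. z + t *\<^sub>R w" and g = f, OF _ D])
         (auto intro!: derivative_eq_intros)
    then show ?thesis
      by (simp add: has_vector_derivative_def linear_scale[OF bounded_linear.linear[OF has_derivative_bounded_linear[OF D]]])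
  qed
  define G where "G t w = \<eta> w *\<^sub>R f (z + t *\<^sub>R w)" for t w
  define G' where "G' t w v = \<eta> w *\<^sub>R ?f' (z + t *\<^sub>R w) (t *\<^sub>R v) + \<eta>' w v *\<^sub>R f (z + t *\<^sub>R w)" for t w v
  have G0: "G t w = 0" if "norm w > \<rho>" for t w
    using that by (simp add: G_def \<eta>0)
  have derG: "(G t has_derivative G' t w) (at w)" if t: "\<bar>t\<bar> \<le> 2" for t w
  proof (cases "norm w \<le> \<rho>")
    case True
    have D: "(f has_derivative ?f' (z + t *\<^sub>R w)) (at (z + t *\<^sub>R w))"
      using mem[OF t True] sub2 by (intro holomorphic_CnD(1)[OF f]) auto
    have "((\<lambda>w. f (z + t *\<^sub>R w)) has_derivative (\<lambda>v. ?f' (z + t *\<^sub>R w) (t *\<^sub>R v))) (at w)"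
      by (rule has_derivative_compose[where f = "\<lambda>w. z + t *\<^sub>R w" and g = f, OF _ D])
         (auto intro!: derivative_eq_intros)
    from has_derivative_scaleR[OF der\<eta> this] show ?thesis
      unfolding G_def G'_def .
  next
    case False
    then have "G' t w = (\<lambda>v. 0)" by (simp add: G'_def \<eta>0 \<eta>'0 fun_eq_iff)
    moreover have "(G t has_derivative (\<lambda>v. 0)) (at w)"
    proof (rule has_derivative_transform_within_open[where s = "- cball 0 \<rho>"])
      show "((\<lambda>w. 0) has_derivative (\<lambda>v. 0)) (at w)" by simp
    qed (use False G0 in \<open>auto simp: not_le\<close>)
    ultimately show ?thesis by simp
  qed
  have bdG: "cmod (G' t w v) \<le> (\<rho>^4 * L * 2 + 4 * \<rho>^3 * M) * norm v" if t: "\<bar>t\<bar> \<le> 2" for t w v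
  proof (cases "norm w \<le> \<rho>")
    case True
    note m = mem[OF t True]
    have "z + t *\<^sub>R w \<in> cball z (3 * \<rho>)" using m \<rho> by auto
    note M' = M[OF this]
    have "cmod (?f' (z + t *\<^sub>R w) (t *\<^sub>R v)) \<le> L * (2 * norm v)"
      by (rule order_trans[OF f'L[OF m]]) (use t L0 in \<open>auto intro!: mult_left_mono mult_right_mono\<close>)
    then have "cmod (\<eta> w *\<^sub>R ?f' (z + t *\<^sub>R w) (t *\<^sub>R v)) \<le> \<rho>^4 * (L * (2 * norm v))"
      using \<eta>le[of w] \<rho> by (auto intro!: mult_mono)
    moreover have "cmod (\<eta>' w v *\<^sub>R f (z + t *\<^sub>R w)) \<le> (4 * \<rho>^3 * norm v) * M"
      unfolding norm_scaleR by (intro mult_mono \<eta>'le M') (use \<rho> in auto)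
    ultimately show ?thesis
      unfolding G'_def by (intro order_trans[OF norm_triangle_ineq]) (simp add: algebra_simps)
  next
    case False
    then show ?thesis using L0 M0 \<rho> by (simp add: G'_def \<eta>0 \<eta>'0)
  qed
  \<comment> \<open>Complex linearity turns the derivative along \<open>\<i> w\<close> into \<open>\<i>\<close> times the derivative along \<open>w\<close>. The case \<open>t = 0\<close>
      is lost here, which is why only continuity is used at that end of the interval.\<close>
  have rot0: "(\<integral>w. \<eta> w *\<^sub>R ?f' (z + t *\<^sub>R w) w \<partial>lborel) = 0" if t: "\<bar>t\<bar> \<le> 2" "t \<noteq> 0" for t
  proof -
    have "(\<integral>w. G' t w (\<i> *s w) \<partial>lborel) = 0"
      by (rule integral_rotation_derivative_eq_0[OF derG[OF t(1)] bdG[OF t(1)] G0])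
    moreover have "G' t w (\<i> *s w) = (of_real t * \<i>) * (\<eta> w *\<^sub>R ?f' (z + t *\<^sub>R w) w)" for w
    proof (cases "norm w \<le> \<rho>")
      case True
      have "z + t *\<^sub>R w \<in> \<Omega>" using mem[OF t(1) True] sub2 by auto
      note D = holomorphic_CnD(2)[OF f this]
      have "\<eta>' w (\<i> *s w) = 0"
        using inner_vector_smult_i[of w] by (simp add: \<eta>'_def inner_commute)
      moreover have "?f' (z + t *\<^sub>R w) (t *\<^sub>R (\<i> *s w)) = of_real t * \<i> * ?f' (z + t *\<^sub>R w) w"
        by (simp only: scaleR_eq_vector_smult[of t "\<i> *s w"] D mult.assoc)
      ultimately show ?thesis by (simp add: G'_def scaleR_conv_of_real)
    qed (simp add: G'_def \<eta>0 \<eta>'0)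
    ultimately have "(of_real t * \<i>) * (\<integral>w. \<eta> w *\<^sub>R ?f' (z + t *\<^sub>R w) w \<partial>lborel) = 0"
      by (simp only: integral_mult_right_zero)
    then show ?thesis using t(2) by simp
  qed
  have dI: "((\<lambda>t. \<integral>w. G t w \<partial>lborel) has_vector_derivative (\<integral>w. \<eta> w *\<^sub>R ?f' (z + t *\<^sub>R w) w \<partial>lborel)) (at t)"
    if t: "t \<in> {0..1}" for t
  proof (rule has_vector_derivative_integral(1)[where d = 1 and w = "\<lambda>w. \<rho>^4 * (L * \<rho>) * indicator (cball 0 \<rho>) w"])
    show "integrable lborel (G s)" if "\<bar>s - t\<bar> < 1" for s
    proof (rule integrable_continuous_bounded_support[OF _ G0])
      have "\<bar>s\<bar> \<le> 2" using that t by auto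
      from derG[OF this] show "continuous_on UNIV (G s)"
        using has_derivative_continuous_on has_derivative_at_withinI by blast
    qed
    show "((\<lambda>t. G t w) has_vector_derivative \<eta> w *\<^sub>R ?f' (z + t *\<^sub>R w) w) (at t)" for w
    proof (cases "norm w \<le> \<rho>")
      case True
      have "\<bar>t\<bar> \<le> 2" using t by auto
      from bounded_linear.has_vector_derivative[OF bounded_linear_scaleR_right line[OF this True], of "\<eta> w"]
      show ?thesis unfolding G_def .
    qed (simp add: G_def \<eta>0)
    show "integrable lborel (\<lambda>w. \<rho>^4 * (L * \<rho>) * indicator (cball 0 \<rho>) w :: real)"
      using emeasure_lborel_cball_finite[of 0 \<rho>]
      by (intro integrable_mult_right integrable_real_indicator) (auto simp: less_top)
    show "cmod (G s w - G t w) \<le> \<bar>s - t\<bar> * (\<rho>^4 * (L * \<rho>) * indicator (cball 0 \<rho>) w)"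
      if s: "\<bar>s - t\<bar> < 1" for s w
    proof (cases "norm w \<le> \<rho>")
      case True
      have "cmod ((\<lambda>t. f (z + t *\<^sub>R w)) s - (\<lambda>t. f (z + t *\<^sub>R w)) t) \<le> (L * \<rho>) * norm (s - t)"
      proof (rule differentiable_bound[of "{-2..2}"])
        fix u :: real assume "u \<in> {-2..2}"
        then have u: "\<bar>u\<bar> \<le> 2" by auto
        show "((\<lambda>t. f (z + t *\<^sub>R w)) has_derivative (\<lambda>r. r *\<^sub>R ?f' (z + u *\<^sub>R w) w)) (at u within {-2..2})"
          using line[OF u True] by (simp add: has_vector_derivative_def has_derivative_at_withinI)
        have "cmod (?f' (z + u *\<^sub>R w) w) \<le> L * \<rho>"
          by (rule order_trans[OF f'L[OF mem[OF u True]]]) (use True L0 in \<open>auto intro: mult_left_mono\<close>)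
        from mult_right_mono[OF this abs_ge_zero]
        show "onorm (\<lambda>r. r *\<^sub>R ?f' (z + u *\<^sub>R w) w) \<le> L * \<rho>"
          by (intro onorm_le) (simp add: mult.commute)
      qed (use s t in auto)
      then have "\<eta> w * cmod (f (z + s *\<^sub>R w) - f (z + t *\<^sub>R w)) \<le> \<rho>^4 * (L * \<rho> * \<bar>s - t\<bar>)"
        using \<eta>le[of w] \<rho> by (intro mult_mono) auto
      moreover have "cmod (G s w - G t w) = \<eta> w * cmod (f (z + s *\<^sub>R w) - f (z + t *\<^sub>R w))"
        using \<eta>le(1)[of w] by (simp add: G_def flip: scaleR_diff_right)
      ultimately show ?thesis using True by (simp add: mult_ac)
    next
      case False
      then show ?thesis by (simp add: G_def \<eta>0)
    qed
  qed auto
  have "(\<lambda>t. \<integral>w. G t w \<partial>lborel) 1 = (\<integral>w. G 0 w \<partial>lborel)"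
  proof (rule has_derivative_zero_unique_strong_convex[where S = "{0..1}" and K = "{0}" and c = 0
        and f = "\<lambda>t. \<integral>w. G t w \<partial>lborel"])
    show "continuous_on {0..1} (\<lambda>t. \<integral>w. G t w \<partial>lborel)"
      using dI by (intro continuous_at_imp_continuous_on ballI has_vector_derivative_continuous) 
    show "((\<lambda>t. \<integral>w. G t w \<partial>lborel) has_derivative (\<lambda>h. 0)) (at t within {0..1})" if "t \<in> {0..1} - {0}" for t
      using dI[of t] rot0[of t] that by (auto simp: has_vector_derivative_def intro: has_derivative_at_withinI)
  qed auto
  moreover have "integrable lborel \<eta>"
  proof (rule integrable_continuous_bounded_support[where R = \<rho>])
    show "continuous_on UNIV \<eta>"
      using der\<eta> has_derivative_continuous_on has_derivative_at_withinI by blast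
  qed (use \<eta>0 in auto)
  ultimately show ?thesis by (simp add: G_def)
qed

text \<open>
  Weierstrass' theorem: by the Cauchy estimate the derivatives are locally uniformly Cauchy as well,
  and complex linearity passes to their limits.
\<close>
lemma holomorphic_Cn_limit:
  fixes g :: "nat \<Rightarrow> complex ^ 'n::finite \<Rightarrow> complex"
  assumes hol: "\<And>n. g n \<in> holomorphic_Cn \<Omega>"
    and cau: "\<And>z. z \<in> \<Omega> \<Longrightarrow> \<exists>r>0. cball z r \<subseteq> \<Omega> \<and>
       (\<forall>e>0. \<exists>N. \<forall>m\<ge>N. \<forall>n\<ge>N. \<forall>w\<in>cball z r. cmod (g m w - g n w) \<le> e)"
  obtains h where "h \<in> holomorphic_Cn \<Omega>" "\<And>z. z \<in> \<Omega> \<Longrightarrow> (\<lambda>n. g n z) \<longlonglongrightarrow> h z"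
proof -
  let ?d = "\<lambda>n z. frechet_derivative (g n) (at z)"
  have "convergent (\<lambda>n. g n z)" if z: "z \<in> \<Omega>" for z
  proof -
    obtain r where r: "r > 0" "\<And>e. e > 0 \<Longrightarrow> \<exists>N. \<forall>m\<ge>N. \<forall>n\<ge>N. \<forall>w\<in>cball z r. cmod (g m w - g n w) \<le> e"
      using cau[OF z] by blast
    have "Cauchy (\<lambda>n. g n z)"
    proof (rule metric_CauchyI)
      fix e :: real assume "e > 0"
      then obtain N where "\<forall>m\<ge>N. \<forall>n\<ge>N. \<forall>w\<in>cball z r. cmod (g m w - g n w) \<le> e/2"
        using r(2)[of "e/2"] by auto
      moreover have "z \<in> cball z r" using r(1) by simp
      ultimately have "\<forall>m\<ge>N. \<forall>n\<ge>N. dist (g m z) (g n z) \<le> e/2"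
        unfolding dist_norm by blast
      moreover have "e/2 < e" using \<open>e > 0\<close> by simp
      ultimately show "\<exists>N. \<forall>m\<ge>N. \<forall>n\<ge>N. dist (g m z) (g n z) < e"
        using le_less_trans by blast
    qed
    then show ?thesis by (rule Cauchy_convergent)
  qed
  then have lim: "(\<lambda>n. g n z) \<longlonglongrightarrow> lim (\<lambda>n. g n z)" if "z \<in> \<Omega>" for z
    using that by (simp add: convergent_LIMSEQ_iff)
  define h where "h z = lim (\<lambda>n. g n z)" for z
  have "\<exists>D. (h has_derivative D) (at z) \<and> (\<forall>c v. D (c *s v) = c * D v)" if z: "z \<in> \<Omega>" for z
  proof -
    obtain r where r: "r > 0" "cball z r \<subseteq> \<Omega>"
      "\<And>e. e > 0 \<Longrightarrow> \<exists>N. \<forall>m\<ge>N. \<forall>n\<ge>N. \<forall>w\<in>cball z r. cmod (g m w - g n w) \<le> e"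
      using cau[OF z] by blast
    define S where "S = ball z (r/2)"
    have S: "S \<subseteq> \<Omega>" "convex S" "open S" "z \<in> S" using r by (auto simp: S_def subset_iff)
    have dd: "\<exists>N. \<forall>m\<ge>N. \<forall>n\<ge>N. \<forall>w\<in>S. \<forall>v. cmod (?d m w v - ?d n w v) \<le> e * norm v" if e: "e > 0" for e
    proof -
      obtain N where N: "\<And>m n w. m \<ge> N \<Longrightarrow> n \<ge> N \<Longrightarrow> w \<in> cball z r \<Longrightarrow> cmod (g m w - g n w) \<le> e * (r/2)"
        using r(3)[OF mult_pos_pos[OF e half_gt_zero[OF r(1)]]] by meson
      have "cmod (?d m w v - ?d n w v) \<le> e * norm v" if mn: "m \<ge> N" "n \<ge> N" and w: "w \<in> S" for m n w v
      proof -
        have sub: "cball w (r/2) \<subseteq> cball z r"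
          using w by (intro cball_subset_cball_iff[THEN iffD2] disjI1) (simp add: S_def dist_commute)
        have w\<Omega>: "w \<in> \<Omega>" using w S by blast
        have "((\<lambda>z. g m z - g n z) has_derivative (\<lambda>v. ?d m w v - ?d n w v)) (at w)"
          by (intro has_derivative_diff holomorphic_CnD(1)[OF hol w\<Omega>])
        from frechet_derivative_at[OF this]
        have "cmod (?d m w v - ?d n w v) = cmod (frechet_derivative (\<lambda>z. g m z - g n z) (at w) v)" by metis
        also have "\<dots> \<le> e * (r/2) / (r/2) * norm v"
        proof (rule holomorphic_Cn_cauchy_estimate[where f = "\<lambda>z. g m z - g n z"])
          show "(\<lambda>z. g m z - g n z) \<in> holomorphic_Cn \<Omega>" by (rule holomorphic_Cn_diff[OF hol hol])
          show "cball w (r/2) \<subseteq> \<Omega>" using sub r(2) by blast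
          show "r/2 > 0" using r(1) by simp
          show "cmod (g m x - g n x) \<le> e * (r/2)" if "x \<in> cball w (r/2)" for x
            by (rule N[OF mn subsetD[OF sub that]])
        qed
        finally show ?thesis using r(1) by simp
      qed
      then show ?thesis by blast
    qed
    have "convergent (\<lambda>n. ?d n w v)" if w: "w \<in> S" for w v
    proof -
      have "Cauchy (\<lambda>n. ?d n w v)"
      proof (rule metric_CauchyI)
        fix e :: real assume e: "e > 0"
        then have "e / (norm v + 1) > 0" by (simp add: add_nonneg_pos)
        then obtain N where N: "\<forall>m\<ge>N. \<forall>n\<ge>N. \<forall>w\<in>S. \<forall>v'. cmod (?d m w v' - ?d n w v') \<le> e / (norm v + 1) * norm v'"
          using dd by meson
        have "norm v + 1 > 0" by (simp add: add_nonneg_pos)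
        then have "e / (norm v + 1) * norm v < e" using e by (simp add: pos_divide_less_eq)
        moreover have "\<forall>m\<ge>N. \<forall>n\<ge>N. dist (?d m w v) (?d n w v) \<le> e / (norm v + 1) * norm v"
          using N w unfolding dist_norm by blast
        ultimately show "\<exists>N. \<forall>m\<ge>N. \<forall>n\<ge>N. dist (?d m w v) (?d n w v) < e"
          using le_less_trans by blast
      qed
      then show ?thesis by (rule Cauchy_convergent)
    qed
    then have dlim: "(\<lambda>n. ?d n w v) \<longlonglongrightarrow> lim (\<lambda>n. ?d n w v)" if "w \<in> S" for w v
      using that by (simp add: convergent_LIMSEQ_iff)
    define D where "D w v = lim (\<lambda>n. ?d n w v)" for w v
    have unif: "\<forall>\<^sub>F n in sequentially. \<forall>w\<in>S. \<forall>v. cmod (?d n w v - D w v) \<le> e * norm v" if e: "e > 0" for e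
    proof -
      obtain N where N: "\<forall>m\<ge>N. \<forall>n\<ge>N. \<forall>w\<in>S. \<forall>v. cmod (?d m w v - ?d n w v) \<le> e * norm v"
        using dd[OF e] by blast
      have "cmod (?d n w v - D w v) \<le> e * norm v" if n: "n \<ge> N" and w: "w \<in> S" for n w v
      proof (rule LIMSEQ_le_const2)
        show "(\<lambda>m. cmod (?d n w v - ?d m w v)) \<longlonglongrightarrow> cmod (?d n w v - D w v)"
          unfolding D_def by (intro tendsto_intros dlim w)
        show "\<exists>N. \<forall>m\<ge>N. cmod (?d n w v - ?d m w v) \<le> e * norm v"
          using N n w by blast
      qed
      then show ?thesis unfolding eventually_sequentially by blast
    qed
    have "\<exists>g'. \<forall>x\<in>S. (\<lambda>n. g n x) \<longlonglongrightarrow> g' x \<and> (g' has_derivative D x) (at x within S)"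
    proof (rule has_derivative_sequence[where f = g and g' = D and f' = ?d, OF \<open>convex S\<close> _ unif \<open>z \<in> S\<close> lim[OF z]])
      show "(g n has_derivative ?d n x) (at x within S)" if "x \<in> S" for n x
        by (rule has_derivative_at_withinI[OF holomorphic_CnD(1)[OF hol subsetD[OF S(1) that]]])
    qed
    then obtain g' where g': "\<And>x. x \<in> S \<Longrightarrow> (\<lambda>n. g n x) \<longlonglongrightarrow> g' x"
      "\<And>x. x \<in> S \<Longrightarrow> (g' has_derivative D x) (at x within S)" by blast
    have "(h has_derivative D z) (at z)"
    proof (rule has_derivative_transform_within_open[OF _ S(3,4)])
      show "(g' has_derivative D z) (at z)"
        using g'(2)[OF S(4)] at_within_open[OF S(4,3)] by simp
      show "g' x = h x" if "x \<in> S" for x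
        unfolding h_def by (rule limI[OF g'(1)[OF that], symmetric])
    qed
    moreover have "D z (c *s v) = c * D z v" for c v
    proof (rule LIMSEQ_unique)
      show "(\<lambda>n. ?d n z (c *s v)) \<longlonglongrightarrow> D z (c *s v)" unfolding D_def by (rule dlim[OF S(4)])
      have "(\<lambda>n. c * ?d n z v) \<longlonglongrightarrow> c * D z v" unfolding D_def by (intro tendsto_intros dlim[OF S(4)])
      then show "(\<lambda>n. ?d n z (c *s v)) \<longlonglongrightarrow> c * D z v"
        by (simp add: holomorphic_CnD(2)[OF hol z])
    qed
    ultimately show ?thesis by blast
  qed
  then have "h \<in> holomorphic_Cn \<Omega>" unfolding holomorphic_Cn_def by blast
  with lim that show thesis unfolding h_def by blast
qed

section \<open>Square-integrable functions and the Bergman space\<close>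

definition L2_norm_sq :: "(complex ^ 'n::finite) set \<Rightarrow> (complex ^ 'n \<Rightarrow> complex) \<Rightarrow> real" where
  "L2_norm_sq \<Omega> f = integral\<^sup>L (lebesgue_on \<Omega>) (\<lambda>z. (cmod (f z))\<^sup>2)"

lemma Lp_space_2_iff:
  "f \<in> Lp_space \<Omega> 2 \<longleftrightarrow> f \<in> borel_measurable (lebesgue_on \<Omega>) \<and> integrable (lebesgue_on \<Omega>) (\<lambda>z. (cmod (f z))\<^sup>2)"
  by (simp add: Lp_space_def)

lemma L2_norm_sq_nonneg: "L2_norm_sq \<Omega> f \<ge> 0"
  by (simp add: L2_norm_sq_def)

lemma Lp_space_2_linear:
  assumes f: "f \<in> Lp_space \<Omega> 2" and g: "g \<in> Lp_space \<Omega> 2"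
  shows "(\<lambda>z. f z + c * g z) \<in> Lp_space \<Omega> 2"
proof -
  have [measurable]: "f \<in> borel_measurable (lebesgue_on \<Omega>)" "g \<in> borel_measurable (lebesgue_on \<Omega>)"
    using assms by (auto simp: Lp_space_2_iff)
  have "(cmod (f z + c * g z))\<^sup>2 \<le> 2 * (cmod (f z))\<^sup>2 + 2 * (cmod c)\<^sup>2 * (cmod (g z))\<^sup>2" for z
  proof -
    have "(cmod (f z + c * g z))\<^sup>2 \<le> (cmod (f z) + cmod (c * g z))\<^sup>2"
      by (intro power_mono norm_triangle_ineq) auto
    also have "\<dots> \<le> 2 * (cmod (f z))\<^sup>2 + 2 * (cmod (c * g z))\<^sup>2"
      using sum_squares_bound[of "cmod (f z)" "cmod (c * g z)"] by (simp add: power2_sum)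
    finally show ?thesis by (simp add: norm_mult power_mult_distrib)
  qed
  note le = this
  have int: "integrable (lebesgue_on \<Omega>) (\<lambda>z. 2 * (cmod (f z))\<^sup>2 + 2 * (cmod c)\<^sup>2 * (cmod (g z))\<^sup>2)"
    using assms unfolding Lp_space_2_iff
    by (intro Bochner_Integration.integrable_add integrable_mult_right) auto
  have "integrable (lebesgue_on \<Omega>) (\<lambda>z. (cmod (f z + c * g z))\<^sup>2)"
    by (rule Bochner_Integration.integrable_bound[OF int]) (measurable, rule AE_I2, use le in simp)
  then show ?thesis unfolding Lp_space_2_iff by simp
qed

lemma Lp_space_2_mult_cnj_integrable:
  assumes f: "f \<in> Lp_space \<Omega> 2" and g: "g \<in> Lp_space \<Omega> 2"
  shows "integrable (lebesgue_on \<Omega>) (\<lambda>z. f z * cnj (g z))"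
proof -
  have [measurable]: "f \<in> borel_measurable (lebesgue_on \<Omega>)" "g \<in> borel_measurable (lebesgue_on \<Omega>)"
    using assms by (auto simp: Lp_space_2_iff)
  have gm: "g \<in> borel_measurable (lebesgue_on \<Omega>)" by measurable
  have cnj: "(\<lambda>z. cnj (g z)) \<in> borel_measurable (lebesgue_on \<Omega>)"
    by (rule borel_measurable_continuous_on[of cnj, OF _ gm]) (intro continuous_intros)
  have "cmod (f z * cnj (g z)) \<le> (cmod (f z))\<^sup>2 + (cmod (g z))\<^sup>2" for z
    using sum_squares_bound[of "cmod (f z)" "cmod (g z)"] mult_nonneg_nonneg[OF norm_ge_zero[of "f z"] norm_ge_zero[of "g z"]]
    unfolding norm_mult complex_mod_cnj by linarith
  note le = this
  have int: "integrable (lebesgue_on \<Omega>) (\<lambda>z. (cmod (f z))\<^sup>2 + (cmod (g z))\<^sup>2)"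
    using assms unfolding Lp_space_2_iff by (intro Bochner_Integration.integrable_add) auto
  have "(\<lambda>z. f z * cnj (g z)) \<in> borel_measurable (lebesgue_on \<Omega>)"
    by (intro borel_measurable_times cnj) measurable
  then show ?thesis
    by (rule Bochner_Integration.integrable_bound[OF int]) (rule AE_I2, use le in simp)
qed

text \<open>The parallelogram law and the variational argument below are both read off from this expansion.\<close>
lemma L2_norm_sq_add:
  assumes f: "f \<in> Lp_space \<Omega> 2" and g: "g \<in> Lp_space \<Omega> 2"
  shows "L2_norm_sq \<Omega> (\<lambda>z. f z + c * g z) = L2_norm_sq \<Omega> f + 2 * Re (cnj c * L2_inner \<Omega> f g) + (cmod c)\<^sup>2 * L2_norm_sq \<Omega> g"
proof -
  have eq: "(cmod (f z + c * g z))\<^sup>2 = (cmod (f z))\<^sup>2 + 2 * Re (cnj c * (f z * cnj (g z))) + (cmod c)\<^sup>2 * (cmod (g z))\<^sup>2" for z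
    unfolding cmod_power2 by (simp add: algebra_simps power2_eq_square)
  note i = Lp_space_2_mult_cnj_integrable[OF f g]
  have "integrable (lebesgue_on \<Omega>) (\<lambda>z. cnj c * (f z * cnj (g z)))"
    using i by simp
  then have "integrable (lebesgue_on \<Omega>) (\<lambda>z. Re (cnj c * (f z * cnj (g z))))"
    and "(\<integral>z. Re (cnj c * (f z * cnj (g z))) \<partial>lebesgue_on \<Omega>) = Re (cnj c * L2_inner \<Omega> f g)"
    using integral_Re[of "lebesgue_on \<Omega>" "\<lambda>z. cnj c * (f z * cnj (g z))"]
    by (auto simp: L2_inner_def simp del: complex_cnj_mult times_complex.sel)
  moreover have "integrable (lebesgue_on \<Omega>) (\<lambda>z. (cmod (f z))\<^sup>2)" "integrable (lebesgue_on \<Omega>) (\<lambda>z. (cmod (g z))\<^sup>2)"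
    using f g by (auto simp: Lp_space_2_iff)
  ultimately show ?thesis
    unfolding L2_norm_sq_def eq by (simp del: times_complex.sel)
qed

lemma bergman_space_linear:
  assumes "f \<in> bergman_space \<Omega> 2" "g \<in> bergman_space \<Omega> 2"
  shows "(\<lambda>z. f z + c * g z) \<in> bergman_space \<Omega> 2"
  using assms unfolding bergman_space_def
  by (auto intro!: holomorphic_Cn_add holomorphic_Cn_mult holomorphic_Cn_const Lp_space_2_linear)

lemma integral_weight_pos:
  assumes \<rho>: "\<rho> > 0"
  shows "(\<integral>w. (max 0 (\<rho>\<^sup>2 - w \<bullet> (w :: 'a::euclidean_space)))\<^sup>2 \<partial>lborel) > 0"
proof -
  let ?\<eta> = "\<lambda>w::'a. (max 0 (\<rho>\<^sup>2 - w \<bullet> w))\<^sup>2"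
  have int: "integrable lborel ?\<eta>"
  proof (rule integrable_continuous_bounded_support[where R = \<rho>])
    show "continuous_on UNIV ?\<eta>" by (intro continuous_intros)
    show "?\<eta> w = 0" if "norm w > \<rho>" for w
      using power_strict_mono[OF that, of 2] \<rho> by (simp add: dot_square_norm)
  qed
  have "0 < (3/4 * \<rho>\<^sup>2)\<^sup>2 * measure lborel (ball (0::'a) (\<rho>/2))"
    using \<rho> content_ball_pos[of "\<rho>/2" "0::'a"] by (simp)
  also have "\<dots> = (\<integral>w. (3/4 * \<rho>\<^sup>2)\<^sup>2 * indicator (ball (0::'a) (\<rho>/2)) w \<partial>lborel)"
    by simp
  also have "\<dots> \<le> (\<integral>w. ?\<eta> w \<partial>lborel)"
  proof (rule integral_mono[OF _ int])
    show "integrable lborel (\<lambda>w::'a. (3/4 * \<rho>\<^sup>2)\<^sup>2 * indicator (ball 0 (\<rho>/2)) w :: real)"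
      using emeasure_lborel_ball_finite[of "0::'a" "\<rho>/2"]
      by (intro integrable_mult_right integrable_real_indicator) (auto simp: less_top)
    fix w :: 'a
    show "(3/4 * \<rho>\<^sup>2)\<^sup>2 * indicator (ball 0 (\<rho>/2)) w \<le> ?\<eta> w"
    proof (cases "norm w < \<rho>/2")
      case True
      have "(norm w)\<^sup>2 \<le> (\<rho>/2)\<^sup>2" using True by (intro power_mono) auto
      then have "3/4 * \<rho>\<^sup>2 \<le> \<rho>\<^sup>2 - w \<bullet> w"
        by (simp add: dot_square_norm power_divide)
      then have "3/4 * \<rho>\<^sup>2 \<le> max 0 (\<rho>\<^sup>2 - w \<bullet> w)" by (rule max.coboundedI2)
      then show ?thesis using True by (simp add: power_mono)
    qed simp
  qed
  finally show ?thesis .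
qed

text \<open>
  Point evaluations are bounded on the Bergman space, with a constant that depends only on the
  distance to the complement. The mean value formula is applied to \<open>f\<^sup>2\<close>, which is holomorphic too
  and whose modulus is already the integrand of the squared norm.
\<close>
lemma bergman_space_sup_bound:
  assumes \<rho>: "\<rho> > 0"
  obtains C where "C > 0"
    "\<And>\<Omega> (f :: complex ^ 'n::finite \<Rightarrow> complex) z. open \<Omega> \<Longrightarrow> f \<in> bergman_space \<Omega> 2 \<Longrightarrow> cball z (3 * \<rho>) \<subseteq> \<Omega> \<Longrightarrow>
       (cmod (f z))\<^sup>2 \<le> C * L2_norm_sq \<Omega> f"
proof -
  define \<eta> where "\<eta> w = (max 0 (\<rho>\<^sup>2 - w \<bullet> w))\<^sup>2" for w :: "complex ^ 'n"
  define c where "c = (\<integral>w. \<eta> w \<partial>lborel)"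
  have c: "c > 0" unfolding c_def \<eta>_def by (rule integral_weight_pos[OF \<rho>])
  have \<eta>0: "\<eta> w = 0" if "norm w \<ge> \<rho>" for w
    using power_mono[OF that, of 2] \<rho> by (simp add: \<eta>_def dot_square_norm)
  have \<eta>le: "0 \<le> \<eta> w" "\<eta> w \<le> \<rho>^4" for w
  proof -
    show "0 \<le> \<eta> w" by (simp add: \<eta>_def)
    have "(max 0 (\<rho>\<^sup>2 - w \<bullet> w))\<^sup>2 \<le> (\<rho>\<^sup>2)\<^sup>2"
      by (rule power_mono) auto
    then show "\<eta> w \<le> \<rho>^4" by (simp add: \<eta>_def)
  qed
  show thesis
  proof (rule that[of "\<rho>^4 / c"])
    show "\<rho>^4 / c > 0" using \<rho> c by simp
    fix \<Omega> and f :: "complex ^ 'n \<Rightarrow> complex" and z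
    assume op: "open \<Omega>" and f: "f \<in> bergman_space \<Omega> 2" and sub: "cball z (3 * \<rho>) \<subseteq> \<Omega>"
    have hol: "f \<in> holomorphic_Cn \<Omega>" and L2: "f \<in> Lp_space \<Omega> 2" using f by (auto simp: bergman_space_def)
    define F where "F x = \<eta> (x - z) * (cmod (f x))\<^sup>2" for x
    have contF: "continuous_on UNIV F"
    proof -
      have "continuous_on (- cball z \<rho>) F"
        by (rule continuous_on_eq[where f = "\<lambda>x. 0"]) (auto simp: F_def \<eta>0 dist_norm norm_minus_commute)
      moreover have "continuous_on \<Omega> F"
        unfolding F_def \<eta>_def by (intro continuous_intros holomorphic_Cn_continuous_on[OF hol])
      ultimately have "continuous_on (\<Omega> \<union> - cball z \<rho>) F"
        using op by (intro continuous_on_open_Un) auto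
      moreover have "\<Omega> \<union> - cball z \<rho> = UNIV" using sub \<rho> by (auto simp: subset_iff)
      ultimately show ?thesis by simp
    qed
    have Fmeas: "F \<in> borel_measurable borel"
      using contF by (rule borel_measurable_continuous_onI)
    have F0: "F x = 0" if "norm x > norm z + \<rho>" for x
      using that norm_triangle_ineq2[of x z] by (simp add: F_def \<eta>0)
    have Fint: "integrable lborel F"
      by (rule integrable_continuous_bounded_support[OF contF F0])
    have "c * (cmod (f z))\<^sup>2 = cmod (\<integral>w. \<eta> w *\<^sub>R (f (z + w) * f (z + w)) \<partial>lborel)"
      using holomorphic_Cn_weighted_mean_value[OF holomorphic_Cn_mult[OF hol hol] sub \<rho>] c
      unfolding \<eta>_def[symmetric] c_def[symmetric] by (simp add: norm_mult power2_eq_square)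
    also have "\<dots> \<le> (\<integral>w. cmod (\<eta> w *\<^sub>R (f (z + w) * f (z + w))) \<partial>lborel)"
      by (rule integral_norm_bound)
    also have "\<dots> = (\<integral>w. F (w + z) \<partial>lborel)"
      using \<eta>le(1) by (intro Bochner_Integration.integral_cong) (auto simp: F_def norm_mult power2_eq_square add.commute)
    also have "\<dots> = (\<integral>x. F x \<partial>lebesgue)"
      by (simp add: integral_lborel_translation[OF Fmeas] integral_completion Fmeas)
    also have "\<dots> \<le> (\<integral>x. indicator \<Omega> x *\<^sub>R (\<rho>^4 * (cmod (f x))\<^sup>2) \<partial>lebesgue)"
    proof (rule integral_mono)
      show "integrable lebesgue F" using Fint Fmeas by (simp add: integrable_completion)
      have "integrable (lebesgue_on \<Omega>) (\<lambda>x. \<rho>^4 * (cmod (f x))\<^sup>2)"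
        using L2 by (simp add: Lp_space_2_iff)
      then show "integrable lebesgue (\<lambda>x. indicator \<Omega> x *\<^sub>R (\<rho>^4 * (cmod (f x))\<^sup>2))"
        using op by (subst (asm) integrable_restrict_space) auto
      show "F x \<le> indicator \<Omega> x *\<^sub>R (\<rho>^4 * (cmod (f x))\<^sup>2)" for x
      proof (cases "x \<in> \<Omega>")
        case True
        then show ?thesis using \<eta>le(2)[of "x - z"] by (simp add: F_def mult_right_mono)
      next
        case False
        then have "x \<notin> cball z \<rho>" using sub \<rho> by (auto simp: subset_iff)
        then show ?thesis using False by (simp add: F_def \<eta>0 dist_norm norm_minus_commute)
      qed
    qed
    also have "\<dots> = \<rho>^4 * L2_norm_sq \<Omega> f"
      using op by (subst integral_restrict_space[symmetric]) (auto simp: L2_norm_sq_def)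
    finally show "(cmod (f z))\<^sup>2 \<le> \<rho>^4 / c * L2_norm_sq \<Omega> f"
      using c by (simp add: field_simps)
  qed
qed

section \<open>Existence of the Bergman projection\<close>

text \<open>Fatou's lemma; it replaces the completeness of \<open>L\<^sup>2\<close> in the construction of the projection.\<close>
lemma L2_norm_sq_le_of_tendsto:
  assumes f: "\<And>n. f n \<in> Lp_space \<Omega> 2"
    and lim: "\<And>z. z \<in> \<Omega> \<Longrightarrow> (\<lambda>n. f n z) \<longlonglongrightarrow> h z"
    and d: "\<And>n. L2_norm_sq \<Omega> (f n) \<le> d n" "d \<longlonglongrightarrow> D"
  shows "h \<in> Lp_space \<Omega> 2" "L2_norm_sq \<Omega> h \<le> D"
proof -
  let ?M = "lebesgue_on \<Omega>"
  have fm: "f n \<in> borel_measurable ?M" for n using f[of n] by (simp add: Lp_space_2_iff)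
  have hm[measurable]: "h \<in> borel_measurable ?M"
    by (rule borel_measurable_LIMSEQ_metric[OF fm]) (use lim in auto)
  have D: "D \<ge> 0"
    by (rule LIMSEQ_le_const[OF d(2)]) (use d(1) L2_norm_sq_nonneg order_trans in blast)
  have d0: "d n \<ge> 0" for n using d(1) L2_norm_sq_nonneg order_trans by blast
  have "(\<integral>\<^sup>+z. ennreal ((cmod (h z))\<^sup>2) \<partial>?M) = (\<integral>\<^sup>+z. liminf (\<lambda>n. ennreal ((cmod (f n z))\<^sup>2)) \<partial>?M)"
  proof (rule nn_integral_cong)
    fix z assume "z \<in> space ?M"
    then have "z \<in> \<Omega>" by simp
    then have "(\<lambda>n. ennreal ((cmod (f n z))\<^sup>2)) \<longlonglongrightarrow> ennreal ((cmod (h z))\<^sup>2)"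
      by (intro tendsto_intros lim)
    then show "ennreal ((cmod (h z))\<^sup>2) = liminf (\<lambda>n. ennreal ((cmod (f n z))\<^sup>2))"
      by (rule lim_imp_Liminf[OF trivial_limit_sequentially, symmetric])
  qed
  also have "\<dots> \<le> liminf (\<lambda>n. \<integral>\<^sup>+z. ennreal ((cmod (f n z))\<^sup>2) \<partial>?M)"
    by (rule nn_integral_liminf) (use fm in measurable)
  also have "\<dots> \<le> liminf (\<lambda>n. ennreal (d n))"
  proof (rule Liminf_mono, rule always_eventually, rule allI)
    fix n
    have "(\<integral>\<^sup>+z. ennreal ((cmod (f n z))\<^sup>2) \<partial>?M) = ennreal (L2_norm_sq \<Omega> (f n))"
      unfolding L2_norm_sq_def using f[of n] by (intro nn_integral_eq_integral) (auto simp: Lp_space_2_iff)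
    then show "(\<integral>\<^sup>+z. ennreal ((cmod (f n z))\<^sup>2) \<partial>?M) \<le> ennreal (d n)"
      using d(1) by (simp add: ennreal_leI)
  qed
  also have "\<dots> = ennreal D"
    by (intro lim_imp_Liminf tendsto_intros d(2)) simp
  finally have le: "(\<integral>\<^sup>+z. ennreal ((cmod (h z))\<^sup>2) \<partial>?M) \<le> ennreal D" .
  have int: "integrable ?M (\<lambda>z. (cmod (h z))\<^sup>2)"
    by (rule integrableI_bounded) (use le in \<open>auto simp: less_top[symmetric] top_unique\<close>)
  then show "h \<in> Lp_space \<Omega> 2" by (simp add: Lp_space_2_iff)
  have "ennreal (L2_norm_sq \<Omega> h) \<le> ennreal D"
    unfolding L2_norm_sq_def using le by (subst nn_integral_eq_integral[symmetric, OF int]) auto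
  then show "L2_norm_sq \<Omega> h \<le> D" using D by simp
qed

text \<open>
  A minimizing sequence \<open>g\<close> is Cauchy in the \<open>L\<^sup>2\<close> norm by the parallelogram law, since the midpoint of
  two of its members is no closer to \<open>f\<close> than the infimum \<open>d\<close>. By the bound on point evaluations it
  converges locally uniformly to a holomorphic function, and by Fatou's lemma the limit still
  attains the infimum.
\<close>
lemma bergman_best_approximation:
  fixes \<Omega> :: "(complex ^ 'n::finite) set"
  assumes op: "open \<Omega>" and f: "f \<in> Lp_space \<Omega> 2"
  obtains g where "g \<in> bergman_space \<Omega> 2"
    "\<And>h. h \<in> bergman_space \<Omega> 2 \<Longrightarrow> L2_norm_sq \<Omega> (\<lambda>z. f z - g z) \<le> L2_norm_sq \<Omega> (\<lambda>z. f z - h z)"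
proof -
  let ?A = "bergman_space \<Omega> 2"
  let ?N = "\<lambda>h. L2_norm_sq \<Omega> (\<lambda>z. f z - h z)"
  have A: "h \<in> Lp_space \<Omega> 2" "h \<in> holomorphic_Cn \<Omega>" if "h \<in> ?A" for h
    using that by (auto simp: bergman_space_def)
  have fA: "(\<lambda>z. f z - h z) \<in> Lp_space \<Omega> 2" if "h \<in> ?A" for h
    using Lp_space_2_linear[OF f A(1)[OF that], of "-1"] by simp
  define d where "d = (INF h\<in>?A. ?N h)"
  have bdd: "bdd_below (?N ` ?A)" by (rule bdd_belowI[of _ 0]) (auto simp: L2_norm_sq_nonneg)
  have dle: "d \<le> ?N h" if "h \<in> ?A" for h
    unfolding d_def by (rule cINF_lower[OF bdd that])
  have "(\<lambda>z. 0) \<in> ?A"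
    by (simp add: bergman_space_def Lp_space_2_iff holomorphic_Cn_const)
  then have ne: "?A \<noteq> {}" by blast
  have "\<exists>g\<in>?A. ?N g < d + 1 / real (Suc n)" for n
    using cINF_less_iff[OF ne bdd, of "d + 1 / real (Suc n)"] unfolding d_def by simp
  then obtain g where g: "\<And>n. g n \<in> ?A" "\<And>n. ?N (g n) < d + 1 / real (Suc n)" by metis
  have cauchy: "L2_norm_sq \<Omega> (\<lambda>z. g m z - g n z) \<le> 2 / real (Suc m) + 2 / real (Suc n)" for m n
  proof -
    let ?u = "\<lambda>z. f z - g m z" and ?v = "\<lambda>z. f z - g n z"
    note u = fA[OF g(1)[of m]] and v = fA[OF g(1)[of n]]
    have mid: "(\<lambda>z. (1/2) * g m z + (1/2) * g n z) \<in> ?A"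
      using bergman_space_linear[OF bergman_space_linear[OF \<open>(\<lambda>z. 0) \<in> ?A\<close> g(1)[of m], of "1/2"] g(1)[of n], of "1/2"]
      by simp
    have "L2_norm_sq \<Omega> (\<lambda>z. ?u z + 1 * ?v z) = 4 * ?N (\<lambda>z. (1/2) * g m z + (1/2) * g n z)"
    proof -
      have "(cmod (?u z + 1 * ?v z))\<^sup>2 = 4 * (cmod (f z - ((1/2) * g m z + (1/2) * g n z)))\<^sup>2" for z
      proof -
        have "?u z + 1 * ?v z = 2 * (f z - ((1/2) * g m z + (1/2) * g n z))" by (simp add: algebra_simps)
        then show ?thesis by (simp only: norm_mult power_mult_distrib) simp
      qed
      then show ?thesis unfolding L2_norm_sq_def by simp
    qed
    then have "4 * d \<le> L2_norm_sq \<Omega> (\<lambda>z. ?u z + 1 * ?v z)" using dle[OF mid] by linarith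
    moreover have "L2_norm_sq \<Omega> (\<lambda>z. ?u z + 1 * ?v z) + L2_norm_sq \<Omega> (\<lambda>z. ?u z + (-1) * ?v z) = 2 * L2_norm_sq \<Omega> ?u + 2 * L2_norm_sq \<Omega> ?v"
      unfolding L2_norm_sq_add[OF u v] by simp
    moreover have "L2_norm_sq \<Omega> (\<lambda>z. ?u z + (-1) * ?v z) = L2_norm_sq \<Omega> (\<lambda>z. g m z - g n z)"
      unfolding L2_norm_sq_def by (simp add: norm_minus_commute)
    ultimately show ?thesis using g(2)[of m] g(2)[of n] by simp
  qed
  obtain h where h: "h \<in> holomorphic_Cn \<Omega>" "\<And>z. z \<in> \<Omega> \<Longrightarrow> (\<lambda>n. g n z) \<longlonglongrightarrow> h z"
  proof (rule holomorphic_Cn_limit[of g \<Omega>])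
    show "g n \<in> holomorphic_Cn \<Omega>" for n using A(2) g(1) by blast
    fix z assume "z \<in> \<Omega>"
    then obtain R where R: "R > 0" "cball z R \<subseteq> \<Omega>" using op open_contains_cball by blast
    define r where "r = R / 4"
    have r: "r > 0" using R by (simp add: r_def)
    obtain C where C: "C > 0" "\<And>\<Omega> (f :: complex ^ 'n \<Rightarrow> complex) z. open \<Omega> \<Longrightarrow> f \<in> bergman_space \<Omega> 2 \<Longrightarrow> cball z (3 * r) \<subseteq> \<Omega> \<Longrightarrow>
       (cmod (f z))\<^sup>2 \<le> C * L2_norm_sq \<Omega> f" using bergman_space_sup_bound[OF r] by blast
    have sub: "cball w (3 * r) \<subseteq> \<Omega>" if "w \<in> cball z r" for w
    proof -
      have "cball w (3 * r) \<subseteq> cball z R"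
        using that by (intro cball_subset_cball_iff[THEN iffD2] disjI1) (simp add: r_def dist_commute)
      then show ?thesis using R by blast
    qed
    have "\<exists>N. \<forall>m\<ge>N. \<forall>n\<ge>N. \<forall>w\<in>cball z r. cmod (g m w - g n w) \<le> e" if e: "e > 0" for e
    proof -
      obtain N where N: "inverse (real (Suc N)) < e\<^sup>2 / (4 * C)"
        using reals_Archimedean[of "e\<^sup>2 / (4 * C)"] e C by auto
      have "cmod (g m w - g n w) \<le> e" if mn: "m \<ge> N" "n \<ge> N" and w: "w \<in> cball z r" for m n w
      proof -
        have "(\<lambda>z. g m z - g n z) \<in> ?A"
          using bergman_space_linear[OF g(1)[of m] g(1)[of n], of "-1"] by simp
        from C(2)[OF op this sub[OF w]]
        have "(cmod (g m w - g n w))\<^sup>2 \<le> C * L2_norm_sq \<Omega> (\<lambda>z. g m z - g n z)" .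
        also have "\<dots> \<le> C * (2 / real (Suc m) + 2 / real (Suc n))"
          using C(1) cauchy by (intro mult_left_mono) auto
        also have "\<dots> \<le> C * (4 * inverse (real (Suc N)))"
        proof (intro mult_left_mono)
          have "2 / real (Suc m) \<le> 2 / real (Suc N)" "2 / real (Suc n) \<le> 2 / real (Suc N)"
            using mn by (auto intro!: divide_left_mono)
          then show "2 / real (Suc m) + 2 / real (Suc n) \<le> 4 * inverse (real (Suc N))"
            by (simp add: inverse_eq_divide)
        qed (use C in auto)
        also have "\<dots> \<le> C * (4 * (e\<^sup>2 / (4 * C)))"
          using N C(1) by (intro mult_left_mono) auto
        also have "\<dots> = e\<^sup>2" using C(1) by simp
        finally show ?thesis using e by (simp add: power2_le_iff_abs_le)
      qed
      then show ?thesis by blast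
    qed
    moreover have "cball z r \<subseteq> \<Omega>" using R r by (auto simp: r_def subset_iff)
    ultimately show "\<exists>r>0. cball z r \<subseteq> \<Omega> \<and>
       (\<forall>e>0. \<exists>N. \<forall>m\<ge>N. \<forall>n\<ge>N. \<forall>w\<in>cball z r. cmod (g m w - g n w) \<le> e)"
      using r by blast
  qed blast
  have lim: "(\<lambda>n. d + 1 / real (Suc n)) \<longlonglongrightarrow> d"
    using tendsto_add[OF tendsto_const[of d] LIMSEQ_inverse_real_of_nat] by (simp add: inverse_eq_divide)
  have conv: "(\<lambda>n. f z - g n z) \<longlonglongrightarrow> f z - h z" if "z \<in> \<Omega>" for z
    by (intro tendsto_intros h(2) that)
  note fh = L2_norm_sq_le_of_tendsto[where f = "\<lambda>n z. f z - g n z", OF fA[OF g(1)] conv less_imp_le[OF g(2)] lim]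
  have "(\<lambda>z. f z + (-1) * (f z - h z)) \<in> Lp_space \<Omega> 2"
    by (rule Lp_space_2_linear[OF f fh(1)])
  then have "h \<in> ?A" using h(1) by (simp add: bergman_space_def)
  moreover have "?N h \<le> ?N h'" if "h' \<in> ?A" for h'
    using fh(2) dle[OF that] by linarith
  ultimately show thesis using that by blast
qed

lemma bergman_projection_exists:
  fixes \<Omega> :: "(complex ^ 'n::finite) set"
  assumes op: "open \<Omega>" and f: "f \<in> Lp_space \<Omega> 2"
  shows "\<exists>g. g \<in> bergman_space \<Omega> 2 \<and> (\<forall>h\<in>bergman_space \<Omega> 2. L2_inner \<Omega> (\<lambda>z. f z - g z) h = 0)"
proof -
  obtain g where g: "g \<in> bergman_space \<Omega> 2"
    "\<And>h. h \<in> bergman_space \<Omega> 2 \<Longrightarrow> L2_norm_sq \<Omega> (\<lambda>z. f z - g z) \<le> L2_norm_sq \<Omega> (\<lambda>z. f z - h z)"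
    using bergman_best_approximation[OF assms] by blast
  have fg: "(\<lambda>z. f z - g z) \<in> Lp_space \<Omega> 2"
    using Lp_space_2_linear[OF f, of g "-1"] g(1) by (simp add: bergman_space_def)
  have "L2_inner \<Omega> (\<lambda>z. f z - g z) h = 0" if h: "h \<in> bergman_space \<Omega> 2" for h
  proof (rule ccontr)
    let ?a = "L2_inner \<Omega> (\<lambda>z. f z - g z) h"
    assume a: "?a \<noteq> 0"
    \<comment> \<open>Moving the minimizer by \<open>s a h\<close> changes the squared distance by \<open>s \<bar>a\<bar>\<^sup>2 (s \<parallel>h\<parallel>\<^sup>2 - 2)\<close>. This step size
        makes the bracket negative also when \<open>h\<close> has norm \<open>0\<close>.\<close>
    define s where "s = 1 / (L2_norm_sq \<Omega> h + 1)"
    have s: "s > 0" "s * L2_norm_sq \<Omega> h < 1"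
      using L2_norm_sq_nonneg[of \<Omega> h] by (auto simp: s_def field_simps)
    have hL: "h \<in> Lp_space \<Omega> 2" using h by (simp add: bergman_space_def)
    define c where "c = - (of_real s * ?a)"
    have "L2_norm_sq \<Omega> (\<lambda>z. f z - g z) \<le> L2_norm_sq \<Omega> (\<lambda>z. f z - (g z + (- c) * h z))"
      by (rule g(2)[OF bergman_space_linear[OF g(1) h]])
    also have "\<dots> = L2_norm_sq \<Omega> (\<lambda>z. (f z - g z) + c * h z)"
      by (simp add: algebra_simps)
    also have "\<dots> = L2_norm_sq \<Omega> (\<lambda>z. f z - g z) + 2 * Re (cnj c * ?a) + (cmod c)\<^sup>2 * L2_norm_sq \<Omega> h"
      by (rule L2_norm_sq_add[OF fg hL])
    also have "Re (cnj c * ?a) = - s * (cmod ?a)\<^sup>2"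
      unfolding c_def cmod_power2 by (simp add: power2_eq_square algebra_simps)
    also have "(cmod c)\<^sup>2 = s\<^sup>2 * (cmod ?a)\<^sup>2"
      by (simp add: c_def norm_mult power_mult_distrib)
    finally have "0 \<le> s * (cmod ?a)\<^sup>2 * (s * L2_norm_sq \<Omega> h - 2)"
      by (simp add: power2_eq_square algebra_simps)
    moreover have "s * (cmod ?a)\<^sup>2 > 0" using s a by simp
    ultimately show False using s(2) by (simp add: zero_le_mult_iff)
  qed
  with g(1) show ?thesis by blast
qed

lemma bergman_projection:
  fixes \<Omega> :: "(complex ^ 'n::finite) set"
  assumes op: "open \<Omega>" and f: "f \<in> Lp_space \<Omega> 2"
  shows "bergman_projection \<Omega> f \<in> bergman_space \<Omega> 2"
    and "h \<in> bergman_space \<Omega> 2 \<Longrightarrow> L2_inner \<Omega> (\<lambda>z. f z - bergman_projection \<Omega> f z) h = 0"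
  using someI_ex[OF bergman_projection_exists[OF assms]] unfolding bergman_projection_def by auto

lemma L2_inner_diff_left:
  assumes "f \<in> Lp_space \<Omega> 2" "g \<in> Lp_space \<Omega> 2" "h \<in> Lp_space \<Omega> 2"
  shows "L2_inner \<Omega> (\<lambda>z. f z - g z) h = L2_inner \<Omega> f h - L2_inner \<Omega> g h"
  using Lp_space_2_mult_cnj_integrable[OF assms(1,3)] Lp_space_2_mult_cnj_integrable[OF assms(2,3)]
  by (simp add: L2_inner_def algebra_simps)

lemma L2_inner_cnj: "L2_inner \<Omega> g f = cnj (L2_inner \<Omega> f g)"
proof -
  have "cnj (L2_inner \<Omega> f g) = (\<integral>z. cnj (f z * cnj (g z)) \<partial>lebesgue_on \<Omega>)"
    unfolding L2_inner_def by (rule Bochner_Integration.integral_cnj[symmetric])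
  then show ?thesis by (simp add: L2_inner_def mult.commute)
qed

text \<open>
  Here \<open>h\<close> is a projection of \<open>u\<close>, so this reads \<open>\<langle>P f, u\<rangle> = \<langle>P f, P u\<rangle> = \<langle>f, P u\<rangle>\<close>.
\<close>
lemma bergman_projection_self_adjoint:
  fixes \<Omega> :: "(complex ^ 'n::finite) set"
  assumes op: "open \<Omega>" and f: "f \<in> Lp_space \<Omega> 2" and u: "u \<in> Lp_space \<Omega> 2"
    and h: "h \<in> bergman_space \<Omega> 2"
    and orth: "\<And>g. g \<in> bergman_space \<Omega> 2 \<Longrightarrow> L2_inner \<Omega> (\<lambda>z. u z - h z) g = 0"
  shows "L2_inner \<Omega> (bergman_projection \<Omega> f) u = L2_inner \<Omega> f h"
proof -
  let ?P = "bergman_projection \<Omega> f"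
  note P = bergman_projection[OF op f]
  have L: "?P \<in> Lp_space \<Omega> 2" "h \<in> Lp_space \<Omega> 2" using P(1) h by (auto simp: bergman_space_def)
  have "L2_inner \<Omega> u ?P = L2_inner \<Omega> h ?P"
    using orth[OF P(1)] L2_inner_diff_left[OF u L(2) L(1)] by simp
  then have "L2_inner \<Omega> ?P u = L2_inner \<Omega> ?P h"
    using L2_inner_cnj by metis
  also have "\<dots> = L2_inner \<Omega> f h"
    using P(2)[OF h] L2_inner_diff_left[OF f L] by simp
  finally show ?thesis .
qed

text \<open>
  Identifies a projection that is known explicitly with the one selected by the choice operator: the
  difference of the two lies in the Bergman space and is orthogonal to it.
\<close>
lemma bergman_projection_AE_eq:
  fixes \<Omega> :: "(complex ^ 'n::finite) set"
  assumes op: "open \<Omega>" and u: "u \<in> Lp_space \<Omega> 2"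
    and h: "h \<in> bergman_space \<Omega> 2"
    and orth: "\<And>g. g \<in> bergman_space \<Omega> 2 \<Longrightarrow> L2_inner \<Omega> (\<lambda>z. u z - h z) g = 0"
  shows "AE z in lebesgue_on \<Omega>. bergman_projection \<Omega> u z = h z"
proof -
  let ?P = "bergman_projection \<Omega> u"
  note P = bergman_projection[OF op u]
  have L: "?P \<in> Lp_space \<Omega> 2" "h \<in> Lp_space \<Omega> 2" using P(1) h by (auto simp: bergman_space_def)
  have d: "(\<lambda>z. ?P z - h z) \<in> bergman_space \<Omega> 2"
    using bergman_space_linear[OF P(1) h, of "-1"] by simp
  then have dL: "(\<lambda>z. ?P z - h z) \<in> Lp_space \<Omega> 2" by (simp add: bergman_space_def)
  have "L2_inner \<Omega> (\<lambda>z. ?P z - h z) (\<lambda>z. ?P z - h z) = 0"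
    using orth[OF d] P(2)[OF d] L2_inner_diff_left[OF u L(2) dL] L2_inner_diff_left[OF u L(1) dL]
      L2_inner_diff_left[OF L dL] by simp
  moreover have "L2_inner \<Omega> (\<lambda>z. ?P z - h z) (\<lambda>z. ?P z - h z) = of_real (L2_norm_sq \<Omega> (\<lambda>z. ?P z - h z))"
    unfolding L2_inner_def L2_norm_sq_def by (subst integral_complex_of_real[symmetric]) (simp only: complex_norm_square)
  ultimately have "L2_norm_sq \<Omega> (\<lambda>z. ?P z - h z) = 0" by simp
  moreover have "integrable (lebesgue_on \<Omega>) (\<lambda>z. (cmod (?P z - h z))\<^sup>2)"
    using dL by (simp add: Lp_space_2_iff)
  ultimately show ?thesis
    unfolding L2_norm_sq_def by (subst (asm) integral_nonneg_eq_0_iff_AE) auto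
qed

section \<open>Functions orthogonal to the Bergman space\<close>

lemma holomorphic_Cn_derivative_bounded_on_compact:
  fixes \<Omega> :: "(complex ^ 'n::finite) set"
  assumes op: "open \<Omega>" and g: "g \<in> holomorphic_Cn \<Omega>" and K: "compact K" "K \<subseteq> \<Omega>"
  obtains B where "B \<ge> 0" "\<And>z. z \<in> K \<Longrightarrow> cmod (g z) \<le> B"
    "\<And>z v. z \<in> K \<Longrightarrow> cmod (frechet_derivative g (at z) v) \<le> B * norm v"
proof -
  obtain \<rho> where \<rho>: "\<rho> > 0" "(\<Union>x\<in>K. cball x \<rho>) \<subseteq> \<Omega>"
    using compact_subset_open_imp_cball_epsilon_subset[OF K(1) op K(2)] by blast
  have "compact (g ` (\<Union>x\<in>K. cball x \<rho>))"
    by (intro compact_continuous_image compact_minkowski_sum_cball K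
        continuous_on_subset[OF holomorphic_Cn_continuous_on[OF g] \<rho>(2)])
  then obtain M where M: "\<And>w. w \<in> (\<Union>x\<in>K. cball x \<rho>) \<Longrightarrow> cmod (g w) \<le> M"
    by (drule_tac compact_imp_bounded) (unfold bounded_iff, blast)
  define B where "B = max \<bar>M\<bar> (\<bar>M\<bar> / \<rho>)"
  show thesis
  proof (rule that[of B])
    show "B \<ge> 0" by (simp add: B_def)
    show "cmod (g z) \<le> B" if "z \<in> K" for z
    proof -
      have "z \<in> (\<Union>x\<in>K. cball x \<rho>)" using that \<rho>(1) by force
      from M[OF this] show ?thesis by (simp add: B_def)
    qed
    show "cmod (frechet_derivative g (at z) v) \<le> B * norm v" if z: "z \<in> K" for z v
    proof -
      have "cmod (frechet_derivative g (at z) v) \<le> \<bar>M\<bar> / \<rho> * norm v"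
      proof (rule holomorphic_Cn_cauchy_estimate[OF g _ \<rho>(1)])
        show "cball z \<rho> \<subseteq> \<Omega>" using \<rho>(2) z by blast
        show "cmod (g w) \<le> \<bar>M\<bar>" if "w \<in> cball z \<rho>" for w
          using M[of w] that z by fastforce
      qed
      also have "\<dots> \<le> B * norm v" by (intro mult_right_mono) (auto simp: B_def)
      finally show ?thesis .
    qed
  qed
qed

text \<open>
  A continuously differentiable substitute for \<open>max 0 (t - \<delta>)\<close> on the positive half-line. It
  vanishes for \<open>t \<le> \<delta>\<close>, and it tends to the identity as \<open>\<delta>\<close> tends to \<open>0\<close>, with derivatives that
  stay in the unit interval and tend to \<open>1\<close>.
\<close>
definition soft_cutoff :: "real \<Rightarrow> real \<Rightarrow> real" where
  "soft_cutoff \<delta> t = (max 0 (t - \<delta>))\<^sup>2 / t"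

definition soft_cutoff' :: "real \<Rightarrow> real \<Rightarrow> real" where
  "soft_cutoff' \<delta> t = (2 * max 0 (t - \<delta>) * t - (max 0 (t - \<delta>))\<^sup>2) / t\<^sup>2"

lemma soft_cutoff_has_derivative:
  assumes "t > 0" shows "(soft_cutoff \<delta> has_real_derivative soft_cutoff' \<delta> t) (at t)"
proof -
  have "((\<lambda>t. (max 0 (t - \<delta>))\<^sup>2 / t) has_real_derivative soft_cutoff' \<delta> t) (at t)"
    using DERIV_divide[OF max_square_has_derivative DERIV_ident, of t \<delta>] assms
    by (simp add: soft_cutoff'_def power2_eq_square)
  then show ?thesis by (simp add: soft_cutoff_def[abs_def])
qed

lemma soft_cutoff_bounds:
  assumes "t > 0" "\<delta> > 0"
  shows "0 \<le> soft_cutoff \<delta> t" "soft_cutoff \<delta> t \<le> t" "0 \<le> soft_cutoff' \<delta> t" "soft_cutoff' \<delta> t \<le> 1"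
proof -
  define m where "m = max 0 (t - \<delta>)"
  have m: "0 \<le> m" "m \<le> t" using assms by (auto simp: m_def)
  have mt: "m\<^sup>2 \<le> m * t" "0 \<le> m * t" "m * t \<le> t * t"
    unfolding power2_eq_square using m by (auto intro: mult_left_mono mult_right_mono)
  have "0 \<le> (t - m)\<^sup>2" by simp
  then have "2 * m * t - m\<^sup>2 \<le> t\<^sup>2" by (simp add: power2_diff mult_ac)
  moreover have "0 \<le> 2 * m * t - m\<^sup>2" using mt by linarith
  moreover have "m\<^sup>2 \<le> t * t" using mt by linarith
  ultimately show "0 \<le> soft_cutoff \<delta> t" "soft_cutoff \<delta> t \<le> t" "0 \<le> soft_cutoff' \<delta> t" "soft_cutoff' \<delta> t \<le> 1"
    using assms unfolding soft_cutoff_def soft_cutoff'_def m_def[symmetric]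
    by (auto simp: divide_le_eq)
qed

lemma soft_cutoff_eq_0: "t \<le> \<delta> \<Longrightarrow> soft_cutoff \<delta> t = 0" "t \<le> \<delta> \<Longrightarrow> soft_cutoff' \<delta> t = 0"
  by (auto simp: soft_cutoff_def soft_cutoff'_def)

lemma soft_cutoff_tendsto:
  assumes t: "t > 0"
  shows "(\<lambda>k. soft_cutoff (1 / real (Suc k)) t) \<longlonglongrightarrow> t" "(\<lambda>k. soft_cutoff' (1 / real (Suc k)) t) \<longlonglongrightarrow> 1"
proof -
  have l: "(\<lambda>k. 1 / real (Suc k)) \<longlonglongrightarrow> 0"
    using LIMSEQ_inverse_real_of_nat by (simp add: inverse_eq_divide)
  have "(\<lambda>k. soft_cutoff (1 / real (Suc k)) t) \<longlonglongrightarrow> (max 0 (t - 0))\<^sup>2 / t"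
    unfolding soft_cutoff_def by (intro tendsto_intros l) (use t in auto)
  then show "(\<lambda>k. soft_cutoff (1 / real (Suc k)) t) \<longlonglongrightarrow> t" using t by (simp add: power2_eq_square)
  have "(\<lambda>k. soft_cutoff' (1 / real (Suc k)) t) \<longlonglongrightarrow> (2 * max 0 (t - 0) * t - (max 0 (t - 0))\<^sup>2) / t\<^sup>2"
    unfolding soft_cutoff'_def by (intro tendsto_intros l) (use t in auto)
  then show "(\<lambda>k. soft_cutoff' (1 / real (Suc k)) t) \<longlonglongrightarrow> 1" using t by (simp add: power2_eq_square)
qed

text \<open>
  For a real-linear form \<open>L\<close>, the value at \<open>e\<close> of its complex-linear part. Applied to the derivative of
  \<open>r\<close>, this is the Wirtinger derivative \<open>\<partial>r\<close> in the direction \<open>e\<close>.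
\<close>
definition type_1_0_part :: "complex ^ 'n::finite \<Rightarrow> (complex ^ 'n \<Rightarrow> real) \<Rightarrow> complex" where
  "type_1_0_part e L = (complex_of_real (L e) - \<i> * complex_of_real (L (\<i> *s e))) / 2"

text \<open>
  The function on the left is \<open>\<partial>(r h)\<close>. As \<open>\<partial> (cnj g) = 0\<close>, its product with \<open>cnj g\<close> is \<open>\<partial>(r h cnj g)\<close>, which
  should integrate to \<open>0\<close> because \<open>r\<close> vanishes on the boundary. Nothing is known about \<open>g\<close> near the
  boundary, so \<open>- r\<close> is first replaced by its soft cutoff at height \<open>\<delta>\<close>. The product then has compact
  support in \<open>\<Omega>\<close>, where \<open>g\<close> and its derivative are bounded. The derivatives of the cutoffs
  are bounded uniformly in \<open>\<delta>\<close>, so a constant multiple of \<open>1 + \<bar>g\<bar>\<^sup>2\<close> dominates as \<open>\<delta>\<close> tends to \<open>0\<close>.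
\<close>
lemma orthogonal_to_bergman_space:
  fixes \<Omega> :: "(complex ^ 'n::finite) set" and r :: "complex ^ 'n \<Rightarrow> real"
  assumes op: "open \<Omega>" and bd: "bounded \<Omega>"
    and rc: "continuous_on (closure \<Omega>) r" and neg: "\<Omega> = {z \<in> closure \<Omega>. r z < 0}"
    and rder: "\<And>z. z \<in> \<Omega> \<Longrightarrow> (r has_derivative r' z) (at z)"
    and r'e: "\<And>z. z \<in> \<Omega> \<Longrightarrow> \<bar>r' z e\<bar> \<le> L" and r'ie: "\<And>z. z \<in> \<Omega> \<Longrightarrow> \<bar>r' z (\<i> *s e)\<bar> \<le> L"
    and hol: "h \<in> holomorphic_Cn \<Omega>" and hH: "\<And>z. z \<in> \<Omega> \<Longrightarrow> cmod (h z) \<le> H"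
    and h'H: "\<And>z. z \<in> \<Omega> \<Longrightarrow> cmod (frechet_derivative h (at z) e) \<le> H"
    and g: "g \<in> bergman_space \<Omega> 2"
  shows "L2_inner \<Omega> (\<lambda>z. frechet_derivative h (at z) e * of_real (r z) + h z * type_1_0_part e (r' z)) g = 0"
proof (cases "\<Omega> = {}")
  case True
  then show ?thesis by (simp add: L2_inner_def integral_restrict_space)
next
  case ne: False
  let ?h' = "\<lambda>z. frechet_derivative h (at z)" and ?g' = "\<lambda>z. frechet_derivative g (at z)"
  have gh: "g \<in> holomorphic_Cn \<Omega>" and gL: "g \<in> Lp_space \<Omega> 2" using g by (auto simp: bergman_space_def)
  obtain z0 where z0: "z0 \<in> \<Omega>" using ne by blast
  have L0: "L \<ge> 0" using r'e[OF z0] by linarith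
  have H0: "H \<ge> 0" using hH[OF z0] norm_ge_zero order_trans by blast
  have rneg: "- r z > 0" if "z \<in> \<Omega>" for z
    using that by (subst (asm) neg) simp
  have mem: "z \<in> \<Omega>" if "z \<in> closure \<Omega>" "r z < 0" for z
    using that by (subst neg) simp
  have cl: "compact (closure \<Omega>)" using bd by (simp add: compact_closure)
  obtain R0 where R0: "\<And>z. z \<in> \<Omega> \<Longrightarrow> \<bar>r z\<bar> \<le> R0"
  proof -
    have "compact (r ` closure \<Omega>)" by (rule compact_continuous_image[OF rc cl])
    then obtain B where "\<forall>x\<in>r ` closure \<Omega>. norm x \<le> B"
      by (drule_tac compact_imp_bounded) (unfold bounded_iff, blast)
    then show thesis using that[of B] closure_subset by fastforce
  qed
  have R00: "R0 \<ge> 0" using R0[OF z0] by linarith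
  obtain Rb where Rb: "\<And>z. z \<in> \<Omega> \<Longrightarrow> norm z \<le> Rb" using bd unfolding bounded_iff by blast
  have Om: "\<Omega> \<in> sets lebesgue" using op by simp
  define w where "w \<delta> z = (of_real (soft_cutoff \<delta> (- r z)) * ?h' z e - of_real (soft_cutoff' \<delta> (- r z)) * h z * type_1_0_part e (r' z)) * cnj (g z)" for \<delta> z
  have trunc_int: "integrable (lebesgue_on \<Omega>) (w \<delta>) \<and> (\<integral>z. w \<delta> z \<partial>lebesgue_on \<Omega>) = 0" if \<delta>: "\<delta> > 0" for \<delta>
  proof -
    define F where "F z = (if z \<in> \<Omega> then soft_cutoff \<delta> (- r z) *\<^sub>R (h z * cnj (g z)) else 0)" for z
    define F' where "F' z v = (if z \<in> \<Omega> then soft_cutoff \<delta> (- r z) *\<^sub>R (h z * cnj (?g' z v) + ?h' z v * cnj (g z))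
        + (soft_cutoff' \<delta> (- r z) * (- r' z v)) *\<^sub>R (h z * cnj (g z)) else 0)" for z v
    define K where "K = {z \<in> closure \<Omega>. r z \<le> - \<delta>}"
    have K: "compact K"
    proof -
      have "closed (closure \<Omega> \<inter> r -` {..- \<delta>})"
        by (rule continuous_closed_preimage[OF rc]) auto
      from compact_Int_closed[OF cl this]
      have "compact (closure \<Omega> \<inter> (closure \<Omega> \<inter> r -` {..- \<delta>}))" .
      moreover have "closure \<Omega> \<inter> (closure \<Omega> \<inter> r -` {..- \<delta>}) = K" by (auto simp: K_def)
      ultimately show ?thesis by simp
    qed
    have K\<Omega>: "K \<subseteq> \<Omega>"
    proof
      fix z assume "z \<in> K"
      then show "z \<in> \<Omega>" using \<delta> by (intro mem) (auto simp: K_def)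
    qed
    have notK: "- r z \<le> \<delta>" if "z \<in> \<Omega>" "z \<notin> K" for z
      using that closure_subset by (fastforce simp: K_def)
    have FK: "F z = 0" if "z \<notin> K" for z
      using notK[OF _ that] by (auto simp: F_def soft_cutoff_eq_0)
    have F'K: "F' z v = 0" if "z \<notin> K" for z v
      using notK[OF _ that] by (auto simp: F'_def soft_cutoff_eq_0)
    have der: "(F has_derivative F' z) (at z)" for z
    proof (cases "z \<in> \<Omega>")
      case True
      have dt: "((\<lambda>z. soft_cutoff \<delta> (- r z)) has_derivative (\<lambda>v. soft_cutoff' \<delta> (- r z) * (- r' z v))) (at z)"
        by (rule has_derivative_compose[where f = "\<lambda>z. - r z" and g = "soft_cutoff \<delta>", OF has_derivative_minus[OF rder[OF True]]
              soft_cutoff_has_derivative[OF rneg[OF True], unfolded has_field_derivative_def]])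
      have "((\<lambda>z. soft_cutoff \<delta> (- r z) *\<^sub>R (h z * cnj (g z))) has_derivative
         (\<lambda>v. soft_cutoff \<delta> (- r z) *\<^sub>R (h z * cnj (?g' z v) + ?h' z v * cnj (g z))
        + (soft_cutoff' \<delta> (- r z) * (- r' z v)) *\<^sub>R (h z * cnj (g z)))) (at z)"
        by (intro has_derivative_scaleR has_derivative_mult dt holomorphic_CnD(1)[OF hol True]
            has_derivative_cnj holomorphic_CnD(1)[OF gh True])
      then have "(F has_derivative
         (\<lambda>v. soft_cutoff \<delta> (- r z) *\<^sub>R (h z * cnj (?g' z v) + ?h' z v * cnj (g z))
        + (soft_cutoff' \<delta> (- r z) * (- r' z v)) *\<^sub>R (h z * cnj (g z)))) (at z)"
        by (rule has_derivative_transform_within_open[OF _ op True]) (simp add: F_def)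
      then show ?thesis using True by (simp add: F'_def[abs_def])
    next
      case False
      then have "z \<notin> K" using K\<Omega> by blast
      then have "F' z = (\<lambda>v. 0)" using F'K by blast
      moreover have "(F has_derivative (\<lambda>v. 0)) (at z)"
      proof (rule has_derivative_transform_within_open[where s = "- K"])
        show "((\<lambda>w. 0) has_derivative (\<lambda>v. 0)) (at z)" by simp
        show "open (- K)" using K compact_imp_closed by blast
      qed (use \<open>z \<notin> K\<close> FK in auto)
      ultimately show ?thesis by simp
    qed
    obtain B where B: "B \<ge> 0" "\<And>z. z \<in> K \<Longrightarrow> cmod (g z) \<le> B"
      "\<And>z v. z \<in> K \<Longrightarrow> cmod (?g' z v) \<le> B * norm v"
      using holomorphic_Cn_derivative_bounded_on_compact[OF op gh K K\<Omega>] by blast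
    have bnd: "cmod (F' z v) \<le> R0 * (H * (B * norm v) + H * B) + L * (H * B)"
      if v: "v = e \<or> v = \<i> *s e" for z v
    proof (cases "z \<in> K")
      case True
      then have z: "z \<in> \<Omega>" using K\<Omega> by blast
      note T = soft_cutoff_bounds[OF rneg[OF z] \<delta>]
      have h'v: "cmod (?h' z v) \<le> H"
        using v h'H[OF z] holomorphic_CnD(2)[OF hol z] by (auto simp: norm_mult)
      have r'v: "\<bar>r' z v\<bar> \<le> L" using v r'e[OF z] r'ie[OF z] by blast
      have "\<bar>soft_cutoff \<delta> (- r z)\<bar> \<le> R0" using T R0[OF z] by linarith
      moreover have "cmod (h z * cnj (?g' z v) + ?h' z v * cnj (g z)) \<le> H * (B * norm v) + H * B"
      proof (rule norm_triangle_le, rule add_mono)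
        show "cmod (h z * cnj (?g' z v)) \<le> H * (B * norm v)"
          unfolding norm_mult complex_mod_cnj using hH[OF z] B(3)[OF True] H0 by (intro mult_mono) auto
        show "cmod (?h' z v * cnj (g z)) \<le> H * B"
          unfolding norm_mult complex_mod_cnj using h'v B(2)[OF True] H0 by (intro mult_mono) auto
      qed
      ultimately have 1: "cmod (soft_cutoff \<delta> (- r z) *\<^sub>R (h z * cnj (?g' z v) + ?h' z v * cnj (g z))) \<le> R0 * (H * (B * norm v) + H * B)"
        unfolding norm_scaleR using R00 by (intro mult_mono) auto
      have "\<bar>soft_cutoff' \<delta> (- r z) * (- r' z v)\<bar> \<le> 1 * L"
        unfolding abs_mult using T r'v by (intro mult_mono) auto
      moreover have "cmod (h z * cnj (g z)) \<le> H * B"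
        unfolding norm_mult complex_mod_cnj using hH[OF z] B(2)[OF True] H0 by (intro mult_mono) auto
      ultimately have 2: "cmod ((soft_cutoff' \<delta> (- r z) * (- r' z v)) *\<^sub>R (h z * cnj (g z))) \<le> L * (H * B)"
        unfolding norm_scaleR using L0 by (intro mult_mono) auto
      show ?thesis
        using z norm_triangle_le[OF add_mono[OF 1 2]] by (simp add: F'_def)
    next
      case False
      then show ?thesis using F'K B(1) H0 L0 R00 by simp
    qed
    have supp: "F z = 0" if "norm z > Rb" for z
      using that Rb[of z] by (auto simp: F_def)
    have "e = e \<or> e = \<i> *s e" "\<i> *s e = e \<or> \<i> *s e = \<i> *s e" by auto
    note I1 = integral_directional_derivative_eq_0[where F = F and F' = F', OF der bnd[OF this(1)] supp]
      and I2 = integral_directional_derivative_eq_0[where F = F and F' = F', OF der bnd[OF this(2)] supp]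
    have meas: "(\<lambda>z. (F' z e - \<i> * F' z (\<i> *s e)) / 2) \<in> borel_measurable borel"
      using borel_measurable_integrable[OF I1(2)] borel_measurable_integrable[OF I2(2)] by simp
    have meas': "(\<lambda>z. (F' z e - \<i> * F' z (\<i> *s e)) / 2) \<in> borel_measurable lborel"
      using meas by simp
    have "integrable lborel (\<lambda>z. (F' z e - \<i> * F' z (\<i> *s e)) / 2)"
      using I1(2) I2(2) by simp
    then have int: "integrable lebesgue (\<lambda>z. (F' z e - \<i> * F' z (\<i> *s e)) / 2)"
      using meas by (simp add: integrable_completion)
    have "(\<integral>z. (F' z e - \<i> * F' z (\<i> *s e)) / 2 \<partial>lborel) = 0"
      using I1 I2 by simp
    then have int0: "(\<integral>z. (F' z e - \<i> * F' z (\<i> *s e)) / 2 \<partial>lebesgue) = 0"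
      by (simp only: integral_completion[OF meas'])
    \<comment> \<open>The terms with the derivative of \<open>g\<close> cancel, because \<open>cnj g\<close> is antiholomorphic.\<close>
    have eq: "(F' z e - \<i> * F' z (\<i> *s e)) / 2 = indicator \<Omega> z *\<^sub>R w \<delta> z" for z
    proof (cases "z \<in> \<Omega>")
      case True
      have "?g' z (\<i> *s e) = \<i> * ?g' z e" "?h' z (\<i> *s e) = \<i> * ?h' z e"
        using holomorphic_CnD(2)[OF gh True] holomorphic_CnD(2)[OF hol True] by auto
      then show ?thesis
        using True unfolding F'_def w_def type_1_0_part_def
        by (simp add: scaleR_conv_of_real field_simps)
    qed (simp add: F'_def)
    show ?thesis
      using int int0 Om unfolding eq by (simp add: integrable_restrict_space integral_restrict_space)
  qed
  define u where "u z = ?h' z e * of_real (r z) + h z * type_1_0_part e (r' z)" for z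
  have "(\<lambda>k. \<integral>z. w (1 / real (Suc k)) z \<partial>lebesgue_on \<Omega>) \<longlonglongrightarrow> (\<integral>z. - (u z * cnj (g z)) \<partial>lebesgue_on \<Omega>)"
  proof (rule integral_dominated_convergence)
    have wm: "w (1 / real (Suc k)) \<in> borel_measurable (lebesgue_on \<Omega>)" for k
      using trunc_int[of "1 / real (Suc k)"] by auto
    show "w (1 / real (Suc k)) \<in> borel_measurable (lebesgue_on \<Omega>)" for k by (rule wm)
    have conv: "(\<lambda>k. w (1 / real (Suc k)) z) \<longlonglongrightarrow> - (u z * cnj (g z))" if "z \<in> space (lebesgue_on \<Omega>)" for z
    proof -
      have "z \<in> \<Omega>" using that by simp
      note t = soft_cutoff_tendsto[OF rneg[OF this]]
      have "(\<lambda>k. w (1 / real (Suc k)) z) \<longlonglongrightarrow> (of_real (- r z) * ?h' z e - of_real 1 * h z * type_1_0_part e (r' z)) * cnj (g z)"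
        unfolding w_def by (intro tendsto_intros t)
      also have "(of_real (- r z) * ?h' z e - of_real 1 * h z * type_1_0_part e (r' z)) * cnj (g z) = - (u z * cnj (g z))"
        by (simp add: u_def algebra_simps)
      finally show ?thesis .
    qed
    then show "AE z in lebesgue_on \<Omega>. (\<lambda>k. w (1 / real (Suc k)) z) \<longlonglongrightarrow> - (u z * cnj (g z))"
      by (intro AE_I2)
    show "(\<lambda>z. - (u z * cnj (g z))) \<in> borel_measurable (lebesgue_on \<Omega>)"
      by (rule borel_measurable_LIMSEQ_metric[OF wm conv])
    have "finite_measure (lebesgue_on \<Omega>)"
      by (rule finite_measure_lebesgue_on[OF bounded_set_imp_lmeasurable[OF bd Om]])
    then have "integrable (lebesgue_on \<Omega>) (\<lambda>z. 1 + (cmod (g z))\<^sup>2)"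
      using gL by (intro Bochner_Integration.integrable_add finite_measure.integrable_const) (auto simp: Lp_space_2_iff)
    then show "integrable (lebesgue_on \<Omega>) (\<lambda>z. (R0 * H + H * L) * (1 + (cmod (g z))\<^sup>2))"
      by (rule integrable_mult_right)
    show "AE z in lebesgue_on \<Omega>. cmod (w (1 / real (Suc k)) z) \<le> (R0 * H + H * L) * (1 + (cmod (g z))\<^sup>2)" for k
    proof (rule AE_I2)
      fix z assume "z \<in> space (lebesgue_on \<Omega>)"
      then have z: "z \<in> \<Omega>" by simp
      note T = soft_cutoff_bounds[OF rneg[OF z], of "1 / real (Suc k)"]
      have d: "cmod (type_1_0_part e (r' z)) \<le> L"
      proof -
        have "cmod (complex_of_real (r' z e) - \<i> * complex_of_real (r' z (\<i> *s e))) \<le> \<bar>r' z e\<bar> + \<bar>r' z (\<i> *s e)\<bar>"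
          by (rule order_trans[OF norm_triangle_ineq4]) (simp add: norm_mult)
        then show ?thesis using r'e[OF z] r'ie[OF z] by (simp add: type_1_0_part_def norm_divide)
      qed
      have "cmod (of_real (soft_cutoff (1 / real (Suc k)) (- r z)) * ?h' z e) \<le> R0 * H"
        unfolding norm_mult using T R0[OF z] h'H[OF z] R00 by (intro mult_mono) auto
      moreover have "cmod (of_real (soft_cutoff' (1 / real (Suc k)) (- r z)) * h z * type_1_0_part e (r' z)) \<le> 1 * H * L"
        unfolding norm_mult using T hH[OF z] d H0 by (intro mult_mono) auto
      ultimately have "cmod (of_real (soft_cutoff (1 / real (Suc k)) (- r z)) * ?h' z e
          - of_real (soft_cutoff' (1 / real (Suc k)) (- r z)) * h z * type_1_0_part e (r' z)) \<le> R0 * H + H * L"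
        by (intro order_trans[OF norm_triangle_ineq4]) simp
      moreover have "cmod (g z) \<le> 1 + (cmod (g z))\<^sup>2"
        using sum_squares_bound[of 1 "cmod (g z)"] norm_ge_zero[of "g z"] by (simp del: norm_ge_zero)
      ultimately show "cmod (w (1 / real (Suc k)) z) \<le> (R0 * H + H * L) * (1 + (cmod (g z))\<^sup>2)"
        unfolding w_def norm_mult complex_mod_cnj using R00 H0 L0 by (intro mult_mono) auto
    qed
  qed
  then have "(\<lambda>k::nat. 0 :: complex) \<longlonglongrightarrow> (\<integral>z. - (u z * cnj (g z)) \<partial>lebesgue_on \<Omega>)"
    using trunc_int by simp
  then have "(\<integral>z. - (u z * cnj (g z)) \<partial>lebesgue_on \<Omega>) = 0"
    using LIMSEQ_unique tendsto_const by metis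
  then show ?thesis by (simp add: L2_inner_def u_def)
qed

section \<open>Geometry at a farthest boundary point\<close>

lemma smooth_on_derivative:
  assumes "smooth_on U f" "x \<in> U"
  shows "(f has_derivative frechet_derivative f (at x)) (at x)"
    and "(\<lambda>x. frechet_derivative f (at x) v) differentiable (at x)"
proof -
  have "Ck_on (Suc (Suc 0)) U f" using assms(1) unfolding smooth_on_def by blast
  then show "(f has_derivative frechet_derivative f (at x)) (at x)"
    "(\<lambda>x. frechet_derivative f (at x) v) differentiable (at x)"
    using assms(2) by (auto simp: frechet_derivative_works)
qed

lemma continuous_on_closure_bounded:
  fixes f :: "'a::heine_borel \<Rightarrow> 'b::real_normed_vector"
  assumes "continuous_on (closure S) f" "bounded S"
  obtains B where "B \<ge> 0" "\<And>z. z \<in> closure S \<Longrightarrow> norm (f z) \<le> B"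
proof -
  have "compact (f ` closure S)"
    using assms by (intro compact_continuous_image) (auto simp: compact_closure)
  then obtain B where "\<And>z. z \<in> closure S \<Longrightarrow> norm (f z) \<le> B"
    by (drule_tac compact_imp_bounded) (unfold bounded_iff, blast)
  then show thesis using that[of "\<bar>B\<bar>"] by force
qed

text \<open>
  A point of the closure with maximal norm. If \<open>v\<close> makes an acute angle with \<open>\<zeta>\<close>, then moving from \<open>\<zeta>\<close>
  in the direction \<open>v\<close> leaves the ball that contains \<open>\<Omega>\<close>, so the derivative of \<open>r\<close> at \<open>\<zeta>\<close> is
  nonnegative on an open half-space. A nonzero linear form with this property is a positive
  multiple of the inner product with \<open>\<zeta>\<close>.
\<close>
lemma farthest_boundary_point:
  fixes \<Omega> :: "(complex ^ 'n::finite) set"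
  assumes dom: "bounded_domain \<Omega>" and def: "defining_function \<Omega> U r"
  obtains \<zeta> where "\<zeta> \<in> closure \<Omega>" "\<And>z. z \<in> \<Omega> \<Longrightarrow> norm z < norm \<zeta>" "\<zeta> \<noteq> 0" "\<zeta> \<in> U" "r \<zeta> = 0"
    "frechet_derivative r (at \<zeta>) \<zeta> > 0"
proof -
  have op: "open \<Omega>" and ne: "\<Omega> \<noteq> {}" and bd: "bounded \<Omega>"
    using dom by (auto simp: bounded_domain_def)
  have U: "open U" "closure \<Omega> \<subseteq> U" and sm: "smooth_on U r"
    and d0: "\<And>z. z \<in> U \<Longrightarrow> r z = 0 \<Longrightarrow> frechet_derivative r (at z) \<noteq> (\<lambda>_. 0)"
    and Om: "\<Omega> = {z \<in> U. r z < 0}"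
    using def unfolding defining_function_def by auto
  have Omd: "r z < 0" if "z \<in> \<Omega>" for z using that by (subst (asm) Om) simp
  have Omi: "z \<in> \<Omega>" if "z \<in> U" "r z < 0" for z using that by (subst Om) simp
  obtain \<zeta> where \<zeta>: "\<zeta> \<in> closure \<Omega>" "\<And>z. z \<in> closure \<Omega> \<Longrightarrow> norm z \<le> norm \<zeta>"
    using distance_attains_sup[of "closure \<Omega>" 0] ne bd by (auto simp: compact_closure)
  have lt: "norm z < norm \<zeta>" if z: "z \<in> \<Omega>" for z
  proof -
    obtain s where s: "s > 0" "ball z s \<subseteq> \<Omega>" using op z open_contains_ball by blast
    obtain b :: "complex ^ 'n" where b: "b \<in> Basis" using SOME_Basis by blast
    define u where "u = (if z = 0 then b else sgn z)"
    have u: "norm u = 1" using b by (simp add: u_def norm_sgn)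
    have "norm (z + (s/2) *\<^sub>R u) = norm z + s/2"
    proof (cases "z = 0")
      case False
      then have "z + (s/2) *\<^sub>R u = (norm z + s/2) *\<^sub>R sgn z"
        by (simp add: u_def sgn_div_norm algebra_simps)
      then show ?thesis using False s by (simp add: norm_sgn)
    qed (use s u in simp)
    moreover have "z + (s/2) *\<^sub>R u \<in> ball z s" using s u by (simp add: dist_norm)
    then have "z + (s/2) *\<^sub>R u \<in> closure \<Omega>" using s(2) closure_subset by blast
    ultimately show ?thesis using \<zeta>(2)[of "z + (s/2) *\<^sub>R u"] s by linarith
  qed
  have nz: "\<zeta> \<noteq> 0"
  proof -
    obtain z where "z \<in> \<Omega>" using ne by blast
    then show ?thesis using lt[of z] norm_ge_zero[of z] by auto
  qed
  have \<zeta>U: "\<zeta> \<in> U" using \<zeta> U by blast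
  have rd: "(r has_derivative frechet_derivative r (at z)) (at z)" if "z \<in> U" for z
    by (rule smooth_on_derivative(1)[OF sm that])
  have "continuous_on U r"
    using rd has_derivative_continuous continuous_at_imp_continuous_on by blast
  then have rc: "continuous_on (closure \<Omega>) r" using U(2) continuous_on_subset by blast
  have "r \<zeta> \<le> 0"
    by (rule continuous_le_on_closure[OF rc \<zeta>(1)]) (use Omd in force)
  moreover have "\<not> r \<zeta> < 0" using Omi[OF \<zeta>U] lt by blast
  ultimately have r0: "r \<zeta> = 0" by simp
  let ?L = "frechet_derivative r (at \<zeta>)"
  have lin: "linear ?L" using rd[OF \<zeta>U] has_derivative_bounded_linear bounded_linear.linear by blast
  have pos: "?L v \<ge> 0" if v: "v \<bullet> \<zeta> > 0" for v
  proof (rule ccontr)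
    assume neg: "\<not> ?L v \<ge> 0"
    have rd': "(r has_derivative ?L) (at (\<zeta> + 0 *\<^sub>R v))" using rd[OF \<zeta>U] by simp
    have "((\<lambda>t. r (\<zeta> + t *\<^sub>R v)) has_derivative (\<lambda>s. ?L (s *\<^sub>R v))) (at 0)"
      by (rule has_derivative_compose[where f = "\<lambda>t. \<zeta> + t *\<^sub>R v" and g = r, OF _ rd'])
         (auto intro!: derivative_eq_intros)
    then have "((\<lambda>t. r (\<zeta> + t *\<^sub>R v)) has_real_derivative ?L v) (at 0)"
      by (simp add: has_field_derivative_def linear_scale[OF lin] mult_commute_abs)
    from DERIV_neg_dec_right[OF this] neg
    obtain d where d: "d > 0" "\<And>h. 0 < h \<Longrightarrow> h < d \<Longrightarrow> r (\<zeta> + h *\<^sub>R v) < r \<zeta>" by auto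
    obtain d' where d': "d' > 0" "ball \<zeta> d' \<subseteq> U" using U(1) \<zeta>U open_contains_ball by blast
    have vn: "norm v > 0" using v by auto
    define h where "h = min (d/2) (d' / (2 * norm v))"
    have h: "0 < h" "h < d" "h * norm v < d'"
    proof -
      show "0 < h" "h < d" using d(1) d'(1) vn by (auto simp: h_def)
      have "h * norm v \<le> d' / (2 * norm v) * norm v" by (intro mult_right_mono) (auto simp: h_def)
      also have "\<dots> = d' / 2" using vn by simp
      finally show "h * norm v < d'" using d'(1) by simp
    qed
    have "\<zeta> + h *\<^sub>R v \<in> U" using d' h by (auto simp: subset_iff dist_norm)
    then have "\<zeta> + h *\<^sub>R v \<in> \<Omega>" using Omi d(2)[OF h(1,2)] r0 by simp
    then have "norm (\<zeta> + h *\<^sub>R v) < norm \<zeta>" by (rule lt)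
    then have "(norm (\<zeta> + h *\<^sub>R v))\<^sup>2 < (norm \<zeta>)\<^sup>2" by (intro power_strict_mono) auto
    moreover have "(norm (\<zeta> + h *\<^sub>R v))\<^sup>2 = (norm \<zeta>)\<^sup>2 + 2 * h * (v \<bullet> \<zeta>) + h\<^sup>2 * (norm v)\<^sup>2"
      unfolding power2_norm_eq_inner by (simp add: algebra_simps inner_commute power2_eq_square)
    moreover have "2 * h * (v \<bullet> \<zeta>) > 0" using h v by simp
    moreover have "0 \<le> h\<^sup>2 * (norm v)\<^sup>2" by simp
    ultimately show False by linarith
  qed
  have "?L \<zeta> > 0"
  proof (rule ccontr)
    assume "\<not> ?L \<zeta> > 0"
    then have L0: "?L \<zeta> = 0" using pos[of \<zeta>] nz by simp
    obtain v where "?L v \<noteq> 0" using d0[OF \<zeta>U r0] by blast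
    then obtain w where w: "?L w < 0"
      using linear_neg[OF lin, of v] by (metis linorder_neqE_linordered_idom neg_less_0_iff_less)
    define s where "s = (\<bar>w \<bullet> \<zeta>\<bar> + 1) / (\<zeta> \<bullet> \<zeta>)"
    have "\<zeta> \<bullet> \<zeta> > 0" using nz by simp
    then have "(w + s *\<^sub>R \<zeta>) \<bullet> \<zeta> > 0" by (simp add: inner_add_left s_def)
    then have "?L (w + s *\<^sub>R \<zeta>) \<ge> 0" by (rule pos)
    then show False using w L0 by (simp add: linear_add[OF lin] linear_scale[OF lin])
  qed
  then show thesis using that \<zeta>(1) lt nz \<zeta>U r0 by blast
qed

text \<open>
  The first-order expansion of \<open>r\<close> at \<open>\<zeta>\<close> shows that \<open>\<Omega>\<close> contains the balls with centre \<open>\<zeta> - t e\<close>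
  and radius \<open>\<eta> t\<close> for small \<open>t\<close>; one with \<open>t\<close> proportional to \<open>\<epsilon>\<close> lies within distance \<open>\<epsilon>\<close> of \<open>\<zeta>\<close>.
\<close>
lemma measure_near_boundary_point:
  fixes \<Omega> :: "'a::euclidean_space set"
  assumes op: "open \<Omega>" and U: "open U" "\<zeta> \<in> U" and Om: "\<And>z. z \<in> U \<Longrightarrow> r z < 0 \<Longrightarrow> z \<in> \<Omega>"
    and rd: "(r has_derivative L) (at \<zeta>)" and r0: "r \<zeta> = (0::real)" and a: "L e > 0" and e: "norm e = 1"
  obtains \<kappa> where "\<kappa> > 0"
    "\<And>\<epsilon>. 0 < \<epsilon> \<Longrightarrow> \<epsilon> \<le> 1 \<Longrightarrow> \<kappa> * \<epsilon> ^ DIM('a) \<le> measure lebesgue (\<Omega> \<inter> ball \<zeta> \<epsilon>)"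
proof -
  have bl: "bounded_linear L" using rd has_derivative_bounded_linear by blast
  then obtain K where K: "K > 0" "\<And>y. norm (L y) \<le> norm y * K"
    using bounded_linear.pos_bounded by blast
  have lin: "linear L" using bl bounded_linear.linear by blast
  define a' where "a' = L e"
  have a': "a' > 0" using a by (simp add: a'_def)
  \<comment> \<open>At \<open>\<zeta> - t e + y\<close> the linear term \<open>- t a'\<close> has to absorb \<open>K \<bar>y\<bar>\<close>, at most \<open>t a' / 4\<close> by this choice, and
      the remainder, at most \<open>t a' / 4\<close> by the choice of \<open>d\<close> below.\<close>
  define \<eta> where "\<eta> = min 1 (a' / (4 * K))"
  have \<eta>: "\<eta> > 0" "\<eta> \<le> 1" "\<eta> * K \<le> a' / 4"
  proof -
    show "\<eta> > 0" "\<eta> \<le> 1" using a' K by (auto simp: \<eta>_def)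
    have "\<eta> * K \<le> a' / (4 * K) * K" using K by (intro mult_right_mono) (auto simp: \<eta>_def)
    then show "\<eta> * K \<le> a' / 4" using K by simp
  qed
  have "a' / 8 > 0" using a' by simp
  then obtain d where d: "d > 0"
    "\<And>y. norm (y - \<zeta>) < d \<Longrightarrow> norm (r y - r \<zeta> - L (y - \<zeta>)) \<le> a' / 8 * norm (y - \<zeta>)"
    using rd unfolding has_derivative_at_alt by blast
  obtain d' where d': "d' > 0" "ball \<zeta> d' \<subseteq> U" using U open_contains_ball by blast
  define \<tau> where "\<tau> = min (1/4) (min (d/4) (d'/4))"
  have \<tau>: "\<tau> > 0" "\<tau> \<le> 1/4" "\<tau> \<le> d/4" "\<tau> \<le> d'/4" using d(1) d'(1) by (auto simp: \<tau>_def)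
  show thesis
  proof (rule that[of "unit_ball_vol (DIM('a)) * (\<eta> * \<tau>) ^ DIM('a)"])
    show "unit_ball_vol (DIM('a)) * (\<eta> * \<tau>) ^ DIM('a) > 0" using \<eta> \<tau> by simp
    fix \<epsilon> :: real assume \<epsilon>: "0 < \<epsilon>" "\<epsilon> \<le> 1"
    define t where "t = \<tau> * \<epsilon>"
    have t: "t > 0" "4 * t \<le> \<epsilon>" "4 * t \<le> d" "4 * t \<le> d'"
    proof -
      show "t > 0" using \<tau> \<epsilon> by (simp add: t_def)
      show "4 * t \<le> \<epsilon>" using \<tau>(2) \<epsilon> mult_right_mono[of \<tau> "1/4" \<epsilon>] by (simp add: t_def)
      have "t \<le> \<tau>" using \<tau>(1) \<epsilon> by (simp add: t_def mult_left_le)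
      then show "4 * t \<le> d" "4 * t \<le> d'" using \<tau> by auto
    qed
    have sub: "ball (\<zeta> - t *\<^sub>R e) (\<eta> * t) \<subseteq> \<Omega> \<inter> ball \<zeta> \<epsilon>"
    proof
      fix y assume "y \<in> ball (\<zeta> - t *\<^sub>R e) (\<eta> * t)"
      then have y: "norm ((y - \<zeta>) + t *\<^sub>R e) < \<eta> * t"
        by (simp add: dist_norm norm_minus_commute algebra_simps)
      have \<eta>t: "\<eta> * t \<le> t" using \<eta> t by simp
      have u: "norm (y - \<zeta>) < 2 * t"
      proof -
        have "norm (y - \<zeta>) \<le> norm ((y - \<zeta>) + t *\<^sub>R e) + t"
          using norm_triangle_ineq4[of "(y - \<zeta>) + t *\<^sub>R e" "t *\<^sub>R e"] e t by simp
        then show ?thesis using y \<eta>t by linarith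
      qed
      have "L (y - \<zeta>) = L ((y - \<zeta>) + t *\<^sub>R e) - t * a'"
        by (simp only: linear_add[OF lin] linear_scale[OF lin] a'_def) simp
      moreover have "L ((y - \<zeta>) + t *\<^sub>R e) \<le> t * (a' / 4)"
      proof -
        have "L ((y - \<zeta>) + t *\<^sub>R e) \<le> norm ((y - \<zeta>) + t *\<^sub>R e) * K"
          using K(2)[of "(y - \<zeta>) + t *\<^sub>R e"] by simp
        also have "\<dots> \<le> (\<eta> * t) * K" using y K by (intro mult_right_mono) auto
        also have "\<dots> = t * (\<eta> * K)" by simp
        also have "\<dots> \<le> t * (a' / 4)" using \<eta>(3) t by (intro mult_left_mono) auto
        finally show ?thesis .
      qed
      moreover have "r y - L (y - \<zeta>) \<le> a' / 8 * (2 * t)"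
      proof -
        have "r y - L (y - \<zeta>) \<le> a' / 8 * norm (y - \<zeta>)" using d(2)[of y] u t r0
          unfolding real_norm_def by linarith
        also have "\<dots> \<le> a' / 8 * (2 * t)" using u a' by (intro mult_left_mono) auto
        finally show ?thesis .
      qed
      moreover have "t * a' > 0" using t a' by simp
      ultimately have "r y < 0" by (simp add: mult_ac)
      moreover have "y \<in> U" using u t d'(2) by (auto simp: subset_iff dist_norm norm_minus_commute)
      ultimately show "y \<in> \<Omega> \<inter> ball \<zeta> \<epsilon>"
        using Om u t by (simp add: dist_norm norm_minus_commute)
    qed
    have nn: "0 \<le> \<eta> * t" using \<eta> t by simp
    have "unit_ball_vol (DIM('a)) * (\<eta> * \<tau>) ^ DIM('a) * \<epsilon> ^ DIM('a)
        = measure lebesgue (ball (\<zeta> - t *\<^sub>R e) (\<eta> * t))"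
      using content_ball[OF nn, of "\<zeta> - t *\<^sub>R e"] by (simp add: t_def power_mult_distrib mult_ac)
    also have "\<dots> \<le> measure lebesgue (\<Omega> \<inter> ball \<zeta> \<epsilon>)"
      by (rule measure_mono_fmeasurable[OF sub])
         (use op in \<open>auto intro!: bounded_set_imp_lmeasurable\<close>)
    finally show "unit_ball_vol (DIM('a)) * (\<eta> * \<tau>) ^ DIM('a) * \<epsilon> ^ DIM('a) \<le> measure lebesgue (\<Omega> \<inter> ball \<zeta> \<epsilon>)" .
  qed
qed

text \<open>
  The height \<open>(\<zeta> - z) \<bullet> sgn \<zeta>\<close> of the tangent hyperplane at \<open>\<zeta>\<close> above \<open>z\<close> controls \<open>\<bar>\<zeta> - z\<bar>\<^sup>2\<close> inside the
  ball: the sphere is curved away from its tangent hyperplane.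
\<close>
lemma inner_farthest_direction:
  fixes z \<zeta> :: "'a::real_inner"
  assumes "norm z \<le> norm \<zeta>" "\<zeta> \<noteq> 0"
  shows "(norm (\<zeta> - z))\<^sup>2 / (2 * norm \<zeta>) \<le> (\<zeta> - z) \<bullet> sgn \<zeta>"
proof -
  have "(norm (\<zeta> - z))\<^sup>2 = (norm \<zeta>)\<^sup>2 - 2 * (z \<bullet> \<zeta>) + (norm z)\<^sup>2"
    unfolding power2_norm_eq_inner by (simp add: algebra_simps inner_commute)
  moreover have "(norm z)\<^sup>2 \<le> (norm \<zeta>)\<^sup>2" using assms by (intro power_mono) auto
  moreover have "(\<zeta> - z) \<bullet> \<zeta> = (norm \<zeta>)\<^sup>2 - z \<bullet> \<zeta>"
    by (simp add: inner_diff_left power2_norm_eq_inner)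
  ultimately have "(norm (\<zeta> - z))\<^sup>2 \<le> 2 * ((\<zeta> - z) \<bullet> \<zeta>)" by linarith
  moreover have "(\<zeta> - z) \<bullet> sgn \<zeta> = ((\<zeta> - z) \<bullet> \<zeta>) / norm \<zeta>"
    by (simp add: sgn_div_norm divide_inverse mult.commute)
  ultimately show ?thesis using assms(2) by (simp add: field_simps)
qed

text \<open>
  Moving from \<open>z\<close> in the direction \<open>sgn \<zeta>\<close> by the height of the tangent hyperplane leads out of the ball and hence out
  of \<open>\<Omega>\<close>, to a point where \<open>r\<close> is nonnegative. Near \<open>\<zeta>\<close> the mean value theorem on this segment bounds
  \<open>\<bar>r\<bar>\<close> by a multiple of the height. Away from \<open>\<zeta>\<close> the height is bounded below.
\<close>
lemma defining_function_le_height: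
  fixes \<Omega> :: "'a::euclidean_space set"
  assumes bd: "bounded \<Omega>" and U: "open U" "closure \<Omega> \<subseteq> U" and Om: "\<Omega> = {z \<in> U. r z < (0::real)}"
    and rd: "\<And>z. z \<in> U \<Longrightarrow> (r has_derivative r' z) (at z)"
    and r'c: "continuous_on U (\<lambda>z. r' z (sgn \<zeta>))"
    and \<zeta>: "\<zeta> \<in> closure \<Omega>" "\<zeta> \<noteq> 0" and lt: "\<And>z. z \<in> \<Omega> \<Longrightarrow> norm z < norm \<zeta>"
  obtains C where "C \<ge> 0" "\<And>z. z \<in> \<Omega> \<Longrightarrow> \<bar>r z\<bar> \<le> C * ((\<zeta> - z) \<bullet> sgn \<zeta>)"
proof -
  have Omd: "r z < 0" "z \<in> U" if "z \<in> \<Omega>" for z using that by (auto simp: Om)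
  have Omi: "z \<in> \<Omega>" if "z \<in> U" "r z < 0" for z using that by (simp add: Om)
  define e where "e = sgn \<zeta>"
  have e: "norm e = 1" using \<zeta> by (simp add: e_def norm_sgn)
  have \<zeta>e: "\<zeta> \<bullet> e = norm \<zeta>" using \<zeta>(2)
    by (simp add: e_def sgn_div_norm dot_square_norm power2_eq_square)
  have "continuous_on U r"
    using rd has_derivative_continuous continuous_at_imp_continuous_on by blast
  then have rc: "continuous_on (closure \<Omega>) r" using U(2) continuous_on_subset by blast
  obtain B where B: "B \<ge> 0" "\<And>z. z \<in> closure \<Omega> \<Longrightarrow> norm (r z) \<le> B"
    using continuous_on_closure_bounded[OF rc bd] by blast
  obtain d where d: "d > 0" "cball \<zeta> d \<subseteq> U" using U \<zeta> open_contains_cball by blast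
  have "continuous_on (closure (ball \<zeta> d)) (\<lambda>z. r' z (sgn \<zeta>))"
    using d by (intro continuous_on_subset[OF r'c]) simp
  from continuous_on_closure_bounded[OF this bounded_ball]
  obtain L where L: "L \<ge> 0" "\<And>z. z \<in> cball \<zeta> d \<Longrightarrow> \<bar>r' z e\<bar> \<le> L"
    using d(1) by (auto simp: e_def)
  define C where "C = L + B * (8 * norm \<zeta> / d\<^sup>2)"
  show thesis
  proof (rule that[of C])
    show "C \<ge> 0" using L B by (simp add: C_def)
    fix z assume z: "z \<in> \<Omega>"
    define t where "t = (\<zeta> - z) \<bullet> sgn \<zeta>"
    have tge: "(norm (\<zeta> - z))\<^sup>2 / (2 * norm \<zeta>) \<le> t"
      unfolding t_def using inner_farthest_direction[OF less_imp_le[OF lt[OF z]] \<zeta>(2)] .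
    have t0: "t \<ge> 0" by (rule order_trans[OF _ tge]) simp
    have tle: "t \<le> norm (\<zeta> - z)"
      using norm_cauchy_schwarz[of "\<zeta> - z" e] e by (simp add: t_def e_def)
    show "\<bar>r z\<bar> \<le> C * t"
    proof (cases "norm (\<zeta> - z) < d/2")
      case True
      have seg: "z + s *\<^sub>R e \<in> cball \<zeta> d" if "s \<in> {0..t}" for s
      proof -
        have "norm (\<zeta> - (z + s *\<^sub>R e)) \<le> norm (\<zeta> - z) + norm (s *\<^sub>R e)"
          using norm_triangle_ineq4[of "\<zeta> - z" "s *\<^sub>R e"] by (simp add: algebra_simps)
        then show ?thesis using that e True tle by (simp add: dist_norm)
      qed
      have "norm (r (z + t *\<^sub>R e) - r (z + 0 *\<^sub>R e)) \<le> L * norm (t - 0)"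
      proof (rule differentiable_bound[of "{0..t}" "\<lambda>s. r (z + s *\<^sub>R e)"])
        fix s assume s: "s \<in> {0..t}"
        have D: "(r has_derivative r' (z + s *\<^sub>R e)) (at (z + s *\<^sub>R e))"
          using seg[OF s] d by (intro rd) auto
        have "((\<lambda>s. r (z + s *\<^sub>R e)) has_derivative (\<lambda>h. r' (z + s *\<^sub>R e) (h *\<^sub>R e))) (at s)"
          by (rule has_derivative_compose[where f = "\<lambda>s. z + s *\<^sub>R e" and g = r, OF _ D])
             (auto intro!: derivative_eq_intros)
        then show "((\<lambda>s. r (z + s *\<^sub>R e)) has_derivative (\<lambda>h. r' (z + s *\<^sub>R e) (h *\<^sub>R e))) (at s within {0..t})"
          by (rule has_derivative_at_withinI)
        have lin: "linear (r' (z + s *\<^sub>R e))" using D has_derivative_bounded_linear bounded_linear.linear by blast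
        show "onorm (\<lambda>h. r' (z + s *\<^sub>R e) (h *\<^sub>R e)) \<le> L"
          using mult_left_mono[OF L(2)[OF seg[OF s]] abs_ge_zero]
          by (intro onorm_le) (simp add: linear_scale[OF lin] abs_mult mult.commute)
      qed (use t0 in auto)
      moreover have "r (z + t *\<^sub>R e) \<ge> 0"
      proof (rule ccontr)
        assume "\<not> 0 \<le> r (z + t *\<^sub>R e)"
        moreover have "z + t *\<^sub>R e \<in> U" using seg[of t] t0 d by auto
        ultimately have "norm (z + t *\<^sub>R e) < norm \<zeta>" using Omi lt by auto
        moreover have "(z + t *\<^sub>R e) \<bullet> e = norm \<zeta>"
          using e \<zeta>e by (simp add: t_def inner_add_left inner_diff_left dot_square_norm flip: e_def)
        ultimately show False using norm_cauchy_schwarz[of "z + t *\<^sub>R e" e] e by simp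
      qed
      ultimately have "\<bar>r z\<bar> \<le> L * t" using Omd(1)[OF z] t0 by simp
      moreover have "B * (8 * norm \<zeta> / d\<^sup>2) * t \<ge> 0" using B t0 by simp
      ultimately show ?thesis by (simp add: C_def algebra_simps)
    next
      case False
      have "(d/2)\<^sup>2 \<le> (norm (\<zeta> - z))\<^sup>2" using False d by (intro power_mono) auto
      then have "(d/2)\<^sup>2 / (2 * norm \<zeta>) \<le> (norm (\<zeta> - z))\<^sup>2 / (2 * norm \<zeta>)"
        by (rule divide_right_mono) simp
      also note tge
      finally have "d\<^sup>2 \<le> 8 * norm \<zeta> * t" using \<zeta>(2) by (simp add: field_simps)
      then have "1 \<le> 8 * norm \<zeta> / d\<^sup>2 * t" using d by (simp add: field_simps)
      from mult_left_mono[OF this B(1)] have "B \<le> B * (8 * norm \<zeta> / d\<^sup>2) * t" by simp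
      moreover have "\<bar>r z\<bar> \<le> B" using B(2)[of z] z closure_subset by auto
      moreover have "L * t \<ge> 0" using L t0 by simp
      ultimately show ?thesis by (simp add: C_def algebra_simps)
    qed
  qed
qed

lemma differentiable_at_lipschitz_at:
  fixes \<psi> :: "'a::real_normed_vector \<Rightarrow> 'b::real_normed_vector"
  assumes d: "\<psi> differentiable (at \<zeta>)" and B: "\<And>z. z \<in> S \<Longrightarrow> norm (\<psi> z) \<le> B"
  obtains C where "C \<ge> 0" "\<And>z. z \<in> S \<Longrightarrow> norm (\<psi> z - \<psi> \<zeta>) \<le> C * norm (z - \<zeta>)"
proof -
  obtain D where D: "(\<psi> has_derivative D) (at \<zeta>)" using d differentiable_def by blast
  then obtain K where K: "K > 0" "\<And>y. norm (D y) \<le> norm y * K"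
    using has_derivative_bounded_linear bounded_linear.pos_bounded by blast
  obtain \<delta> where \<delta>: "\<delta> > 0"
    "\<And>y. norm (y - \<zeta>) < \<delta> \<Longrightarrow> norm (\<psi> y - \<psi> \<zeta> - D (y - \<zeta>)) \<le> 1 * norm (y - \<zeta>)"
    using D unfolding has_derivative_at_alt using zero_less_one by blast
  define C where "C = (1 + K) + (\<bar>B\<bar> + norm (\<psi> \<zeta>)) / \<delta>"
  show thesis
  proof (rule that[of C])
    show "C \<ge> 0" using K \<delta> by (simp add: C_def)
    fix z assume z: "z \<in> S"
    let ?n = "norm (z - \<zeta>)"
    show "norm (\<psi> z - \<psi> \<zeta>) \<le> C * ?n"
    proof (cases "?n < \<delta>")
      case True
      have "norm (\<psi> z - \<psi> \<zeta>) \<le> norm (\<psi> z - \<psi> \<zeta> - D (z - \<zeta>)) + norm (D (z - \<zeta>))"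
        using norm_triangle_ineq[of "\<psi> z - \<psi> \<zeta> - D (z - \<zeta>)" "D (z - \<zeta>)"] by simp
      also have "\<dots> \<le> (1 + K) * ?n" using \<delta>(2)[OF True] K(2)[of "z - \<zeta>"] by (simp add: algebra_simps)
      also have "\<dots> \<le> C * ?n" using \<delta> by (intro mult_right_mono) (auto simp: C_def)
      finally show ?thesis .
    next
      case False
      have "norm (\<psi> z - \<psi> \<zeta>) \<le> \<bar>B\<bar> + norm (\<psi> \<zeta>)"
        using norm_triangle_ineq4[of "\<psi> z" "\<psi> \<zeta>"] B[OF z] by linarith
      also have "\<dots> \<le> (\<bar>B\<bar> + norm (\<psi> \<zeta>)) / \<delta> * ?n"
        using False \<delta>(1) mult_left_mono[of \<delta> ?n "\<bar>B\<bar> + norm (\<psi> \<zeta>)"] by (simp add: field_simps)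
      also have "\<dots> \<le> C * ?n" using K by (intro mult_right_mono) (auto simp: C_def)
      finally show ?thesis .
    qed
  qed
qed

text \<open>
  The exponent \<open>1 / 2\<close> fits the quadratic lower bound for the height: it lets a factor \<open>\<bar>z - \<zeta>\<bar>\<close> absorb
  the logarithm.
\<close>
lemma cmod_Ln_le:
  assumes "w \<noteq> 0"
  shows "cmod (Ln w) \<le> pi + cmod w + 2 / sqrt (cmod w)"
proof -
  let ?x = "cmod w"
  have x: "?x > 0" using assms by simp
  have "ln ?x \<le> ?x" using ln_bound[OF x] .
  moreover have "- ln ?x \<le> 2 / sqrt ?x"
  proof -
    have "- ln ?x = 2 * ln (1 / sqrt ?x)" using x by (simp add: ln_div ln_sqrt)
    also have "\<dots> \<le> 2 * (1 / sqrt ?x)" using ln_bound[of "1 / sqrt ?x"] x by simp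
    finally show ?thesis by simp
  qed
  moreover have "2 / sqrt ?x > 0" using x by simp
  ultimately have "\<bar>ln ?x\<bar> \<le> ?x + 2 / sqrt ?x" using x by linarith
  moreover have "\<bar>Im (Ln w)\<bar> \<le> pi" using mpi_less_Im_Ln[OF assms] Im_Ln_le_pi[OF assms] by linarith
  moreover have "cmod (Ln w) \<le> \<bar>Re (Ln w)\<bar> + \<bar>Im (Ln w)\<bar>" by (rule cmod_le)
  ultimately show ?thesis using Re_Ln[OF assms] by linarith
qed

section \<open>Bounded functions with logarithmic projection\<close>

lemma bounded_in_Lp_space:
  assumes bd: "bounded \<Omega>" "\<Omega> \<in> sets lebesgue"
    and f: "f \<in> borel_measurable (lebesgue_on \<Omega>)" and B: "\<And>z. z \<in> \<Omega> \<Longrightarrow> cmod (f z) \<le> B" and p: "p \<ge> 0"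
  shows "f \<in> Lp_space \<Omega> p"
proof -
  interpret finite_measure "lebesgue_on \<Omega>"
    by (rule finite_measure_lebesgue_on[OF bounded_set_imp_lmeasurable[OF bd]])
  have "integrable (lebesgue_on \<Omega>) (\<lambda>z. cmod (f z) powr p)"
    by (rule integrable_const_bound[where B = "B powr p"])
       (use f B p in \<open>auto intro!: AE_I2 powr_mono2\<close>)
  then show ?thesis using f by (simp add: Lp_space_def)
qed

definition hermitian :: "complex ^ 'n::finite \<Rightarrow> complex ^ 'n \<Rightarrow> complex" where
  "hermitian e z = (\<Sum>j\<in>UNIV. z $ j * cnj (e $ j))"

lemma hermitian_smult: "hermitian e (c *s z) = c * hermitian e z"
  by (simp add: hermitian_def sum_distrib_left mult_ac)

lemma Re_hermitian: "Re (hermitian e z) = z \<bullet> e"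
  by (simp add: hermitian_def inner_vec_def inner_complex_def)

lemma hermitian_self: "hermitian e e = of_real ((norm e)\<^sup>2)"
  by (rule complex_eqI) (simp_all add: Re_hermitian dot_square_norm, simp add: hermitian_def)

lemma cmod_hermitian_le: "cmod (hermitian e z) \<le> norm z * norm e"
proof -
  have "cmod (hermitian e z) \<le> (\<Sum>j\<in>UNIV. \<bar>cmod (z $ j)\<bar> * \<bar>cmod (e $ j)\<bar>)"
    unfolding hermitian_def by (rule order_trans[OF norm_sum]) (simp add: norm_mult)
  also have "\<dots> \<le> norm z * norm e"
    unfolding norm_vec_def by (rule L2_set_mult_ineq)
  finally show ?thesis .
qed

lemma bounded_linear_hermitian: "bounded_linear (hermitian e)"
  by (rule bounded_linear_intro[where K = "norm e"])
     (auto simp: cmod_hermitian_le, auto simp: hermitian_def sum.distrib algebra_simps scaleR_sum_right)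

text \<open>
  A bounded function \<open>f\<close> with projection \<open>h\<close>, together with a set \<open>S\<close> of measure of order \<open>\<epsilon>\<^sup>2\<^sup>n\<close> on which \<open>h\<close>
  is as large as \<open>ln \<epsilon>\<close>. The bounds \<open>M\<close> and \<open>\<kappa>\<close> are parameters because they must not depend on \<open>\<epsilon>\<close>.
\<close>
definition logarithmic_test_pair ::
    "(complex ^ 'n::finite) set \<Rightarrow> real \<Rightarrow> real \<Rightarrow> real \<Rightarrow>
      (complex ^ 'n \<Rightarrow> complex) \<Rightarrow> (complex ^ 'n \<Rightarrow> complex) \<Rightarrow> (complex ^ 'n) set \<Rightarrow> bool" where
  "logarithmic_test_pair \<Omega> M \<kappa> \<epsilon> f h S \<longleftrightarrow>
     f \<in> borel_measurable (lebesgue_on \<Omega>) \<and> (\<forall>z\<in>\<Omega>. cmod (f z) \<le> M) \<and>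
     h \<in> bergman_space \<Omega> 2 \<and>
     (\<forall>g\<in>bergman_space \<Omega> 2. L2_inner \<Omega> (\<lambda>z. f z - h z) g = 0) \<and>
     S \<in> sets lebesgue \<and> S \<subseteq> \<Omega> \<and> \<kappa> * \<epsilon> ^ DIM(complex ^ 'n) \<le> measure lebesgue S \<and>
     (\<forall>z\<in>S. Re (h z) \<le> ln (2 * \<epsilon>))"

text \<open>
  Here \<open>h = Ln (\<phi> + \<epsilon>)\<close> and \<open>f = h - \<partial>(r h) / c\<close>. As \<open>\<partial>\<phi> = -1\<close>, this equals
  \<open>(h (c - \<partial>r) + r / (\<phi> + \<epsilon>)) / c\<close>. The first summand is bounded because \<open>c - \<partial>r\<close> vanishes at \<open>\<zeta>\<close>
  and \<open>h\<close> grows only logarithmically there, the second because \<open>\<bar>r\<bar>\<close> is at most a multiple of \<open>Re \<phi>\<close>.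
  The shift by \<open>\<epsilon>\<close> keeps \<open>h\<close> bounded, so that no integrability question arises.
\<close>
lemma logarithmic_test_functions:
  fixes \<Omega> :: "(complex ^ 'n::finite) set"
  assumes dom: "bounded_domain \<Omega>" and def: "defining_function \<Omega> U r"
  obtains M \<kappa> where "M > 0" "\<kappa> > 0"
    "\<And>\<epsilon>. 0 < \<epsilon> \<Longrightarrow> \<epsilon> \<le> 1 \<Longrightarrow> \<exists>f h S. logarithmic_test_pair \<Omega> M \<kappa> \<epsilon> f h S"
proof -
  have op: "open \<Omega>" and bd: "bounded \<Omega>"
    using dom by (auto simp: bounded_domain_def)
  have U: "open U" "closure \<Omega> \<subseteq> U" and sm: "smooth_on U r" and Om: "\<Omega> = {z \<in> U. r z < 0}"
    using def unfolding defining_function_def by auto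
  have Omi: "z \<in> \<Omega>" if "z \<in> U" "r z < 0" for z using that by (subst Om) simp
  have OmL: "\<Omega> \<in> sets lebesgue" using op by simp
  obtain \<zeta> where \<zeta>: "\<zeta> \<in> closure \<Omega>" "\<And>z. z \<in> \<Omega> \<Longrightarrow> norm z < norm \<zeta>" "\<zeta> \<noteq> 0" "\<zeta> \<in> U" "r \<zeta> = 0"
    "frechet_derivative r (at \<zeta>) \<zeta> > 0"
    using farthest_boundary_point[OF dom def] by metis
  define R where "R = norm \<zeta>"
  have R: "R > 0" using \<zeta>(3) by (simp add: R_def)
  define e where "e = sgn \<zeta>"
  have e: "norm e = 1" using \<zeta>(3) by (simp add: e_def norm_sgn)
  let ?r' = "\<lambda>z. frechet_derivative r (at z)"
  have rd: "(r has_derivative ?r' z) (at z)" if "z \<in> U" for z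
    by (rule smooth_on_derivative(1)[OF sm that])
  have r'd: "(\<lambda>z. ?r' z v) differentiable (at z)" if "z \<in> U" for z v
    by (rule smooth_on_derivative(2)[OF sm that])
  have r'c: "continuous_on U (\<lambda>z. ?r' z v)" for v
    using r'd differentiable_imp_continuous_within continuous_at_imp_continuous_on by blast
  have rc: "continuous_on (closure \<Omega>) r"
    using rd U(2) has_derivative_continuous continuous_at_imp_continuous_on continuous_on_subset by metis
  have lin\<zeta>: "linear (?r' \<zeta>)" using rd[OF \<zeta>(4)] has_derivative_bounded_linear bounded_linear.linear by blast
  have r'e: "?r' \<zeta> e > 0"
  proof -
    have "e = inverse R *\<^sub>R \<zeta>" by (simp add: e_def R_def sgn_div_norm)
    then show ?thesis using \<zeta>(6) R by (simp add: linear_scale[OF lin\<zeta>])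
  qed
  obtain \<kappa> where \<kappa>: "\<kappa> > 0"
    "\<And>\<epsilon>. 0 < \<epsilon> \<Longrightarrow> \<epsilon> \<le> 1 \<Longrightarrow> \<kappa> * \<epsilon> ^ DIM(complex ^ 'n) \<le> measure lebesgue (\<Omega> \<inter> ball \<zeta> \<epsilon>)"
    using measure_near_boundary_point[OF op U(1) \<zeta>(4) Omi rd[OF \<zeta>(4)] \<zeta>(5) r'e e] by blast
  obtain C1 where C1: "C1 \<ge> 0" "\<And>z. z \<in> \<Omega> \<Longrightarrow> \<bar>r z\<bar> \<le> C1 * ((\<zeta> - z) \<bullet> e)"
    using defining_function_le_height[OF bd U Om rd r'c \<zeta>(1,3,2)] unfolding e_def by blast
  define D where "D z = type_1_0_part e (?r' z)" for z
  define c where "c = D \<zeta>"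
  have c: "c \<noteq> 0"
  proof
    assume "c = 0"
    then have "Re c = 0" by simp
    then show False using r'e by (simp add: c_def D_def type_1_0_part_def)
  qed
  obtain L1 where L1: "L1 \<ge> 0" "\<And>z. z \<in> closure \<Omega> \<Longrightarrow> \<bar>?r' z e\<bar> \<le> L1"
    using continuous_on_closure_bounded[OF continuous_on_subset[OF r'c U(2)] bd, of e] unfolding real_norm_def by blast
  obtain L2 where L2: "L2 \<ge> 0" "\<And>z. z \<in> closure \<Omega> \<Longrightarrow> \<bar>?r' z (\<i> *s e)\<bar> \<le> L2"
    using continuous_on_closure_bounded[OF continuous_on_subset[OF r'c U(2)] bd, of "\<i> *s e"] unfolding real_norm_def by blast
  have cl: "z \<in> closure \<Omega>" if "z \<in> \<Omega>" for z using that closure_subset by blast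
  have D_bd: "cmod (D z) \<le> L1 + L2" if z: "z \<in> \<Omega>" for z
  proof -
    have "cmod (complex_of_real (?r' z e) - \<i> * complex_of_real (?r' z (\<i> *s e))) \<le> \<bar>?r' z e\<bar> + \<bar>?r' z (\<i> *s e)\<bar>"
      by (rule order_trans[OF norm_triangle_ineq4]) (simp add: norm_mult)
    then show ?thesis using L1(2)[OF cl[OF z]] L2(2)[OF cl[OF z]] by (simp add: D_def type_1_0_part_def norm_divide)
  qed
  have cr: "(\<lambda>z. complex_of_real (?r' z v)) differentiable (at \<zeta>)" for v
  proof -
    obtain T where "((\<lambda>z. ?r' z v) has_derivative T) (at \<zeta>)"
      using r'd[OF \<zeta>(4)] unfolding differentiable_def by blast
    then have "((\<lambda>z. complex_of_real (?r' z v)) has_derivative (\<lambda>h. complex_of_real (T h))) (at \<zeta>)"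
      by (rule has_derivative_of_real)
    then show ?thesis unfolding differentiable_def by blast
  qed
  have "D differentiable (at \<zeta>)"
    unfolding D_def[abs_def] type_1_0_part_def divide_inverse
    by (intro differentiable_mult differentiable_diff differentiable_const cr)
  then obtain C2 where C2: "C2 \<ge> 0" "\<And>z. z \<in> \<Omega> \<Longrightarrow> cmod (D z - c) \<le> C2 * norm (z - \<zeta>)"
    using differentiable_at_lipschitz_at[of D \<zeta> \<Omega>, OF _ D_bd] unfolding c_def by blast
  have D_cont: "continuous_on \<Omega> D"
    unfolding D_def type_1_0_part_def
    using continuous_on_subset[OF continuous_on_subset[OF r'c U(2)] closure_subset]
    by (intro continuous_intros) auto
  define \<phi> where "\<phi> z = hermitian e (\<zeta> - z)" for z
  have Re\<phi>: "Re (\<phi> z) = (\<zeta> - z) \<bullet> e" for z by (simp add: \<phi>_def Re_hermitian)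
  have \<phi>le: "cmod (\<phi> z) \<le> norm (\<zeta> - z)" for z using cmod_hermitian_le[of e "\<zeta> - z"] e by (simp add: \<phi>_def)
  have Re\<phi>ge: "(norm (\<zeta> - z))\<^sup>2 / (2 * R) \<le> Re (\<phi> z)" if "z \<in> \<Omega>" for z
    using inner_farthest_direction[OF less_imp_le[OF \<zeta>(2)[OF that]] \<zeta>(3)] by (simp add: Re\<phi> e_def R_def)
  have dle: "norm (\<zeta> - z) \<le> 2 * R" if "z \<in> \<Omega>" for z
    using norm_triangle_ineq4[of \<zeta> z] \<zeta>(2)[OF that] by (simp add: R_def)
  define M where "M = (C2 * (2 * R * (pi + (2 * R + 1)) + 2 * sqrt (2 * R)) + C1) / cmod c + 1"
  have Mpos: "M > 0"
  proof -
    have "(C2 * (2 * R * (pi + (2 * R + 1)) + 2 * sqrt (2 * R)) + C1) / cmod c \<ge> 0"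
      using C1(1) C2(1) R pi_gt_zero by (intro divide_nonneg_nonneg add_nonneg_nonneg mult_nonneg_nonneg) auto
    then show ?thesis by (simp add: M_def)
  qed
  show thesis
  proof (rule that[OF Mpos \<kappa>(1)])
    fix \<epsilon> :: real assume \<epsilon>: "0 < \<epsilon>" "\<epsilon> \<le> 1"
    define x where "x z = \<phi> z + of_real \<epsilon>" for z
    have Rex: "Re (x z) \<ge> \<epsilon>" "Re (x z) \<ge> (norm (\<zeta> - z))\<^sup>2 / (2 * R)" "Re (x z) \<ge> Re (\<phi> z)" if z: "z \<in> \<Omega>" for z
    proof -
      have "0 \<le> (norm (\<zeta> - z))\<^sup>2 / (2 * R)" using R by simp
      then show "Re (x z) \<ge> \<epsilon>" "Re (x z) \<ge> (norm (\<zeta> - z))\<^sup>2 / (2 * R)" "Re (x z) \<ge> Re (\<phi> z)"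
        using Re\<phi>ge[OF z] \<epsilon> by (auto simp: x_def)
    qed
    have x_le: "cmod (x z) \<le> norm (\<zeta> - z) + \<epsilon>" for z
      unfolding x_def using \<phi>le[of z] \<epsilon> by (intro norm_triangle_le) simp
    have x0: "x z \<noteq> 0" "x z \<notin> \<real>\<^sub>\<le>\<^sub>0" if "z \<in> \<Omega>" for z
      using Rex(1)[OF that] \<epsilon> by (auto simp: complex_nonpos_Reals_iff)
    have Rexle: "Re (x z) \<le> cmod (x z)" for z by (rule complex_Re_le_cmod)
    define h where "h z = Ln (x z)" for z
    have dh: "(h has_derivative (\<lambda>v. - hermitian e v / x z)) (at z)" if "z \<in> \<Omega>" for z
    proof -
      have dx: "(x has_derivative (\<lambda>v. - hermitian e v)) (at z)"
        unfolding x_def \<phi>_def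
        by (auto intro!: derivative_eq_intros bounded_linear.has_derivative[OF bounded_linear_hermitian]
            simp: linear_neg[OF bounded_linear.linear[OF bounded_linear_hermitian]] simp del: )
      have "(h has_derivative (\<lambda>v. inverse (x z) * (- hermitian e v))) (at z)"
        unfolding h_def
        by (rule has_derivative_compose[OF dx has_field_derivative_Ln[OF x0(2)[OF that], unfolded has_field_derivative_def]])
      then show ?thesis by (simp add: field_simps)
    qed
    have fdh: "frechet_derivative h (at z) = (\<lambda>v. - hermitian e v / x z)" if "z \<in> \<Omega>" for z
      using frechet_derivative_at[OF dh[OF that]] by simp
    have fdhe: "frechet_derivative h (at z) e = - 1 / x z" if "z \<in> \<Omega>" for z
      using fdh[OF that] e by (simp add: hermitian_self)
    have hol: "h \<in> holomorphic_Cn \<Omega>"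
      by (rule holomorphic_CnI[OF dh]) (auto simp: hermitian_smult)
    have h_le: "cmod (h z) \<le> pi + (2 * R + 1) + 2 / sqrt (cmod (x z))" if z: "z \<in> \<Omega>" for z
      using cmod_Ln_le[OF x0(1)[OF z]] x_le[of z] dle[OF z] \<epsilon> by (simp add: h_def)
    define H where "H = pi + (2 * R + 1) + 2 / sqrt \<epsilon> + 1 / \<epsilon>"
    have hH: "cmod (h z) \<le> H" if z: "z \<in> \<Omega>" for z
    proof -
      have "2 / sqrt (cmod (x z)) \<le> 2 / sqrt \<epsilon>"
        using Rex(1)[OF z] Rexle[of z] \<epsilon> x0(1)[OF z] by (intro divide_left_mono) auto
      moreover have "1 / \<epsilon> > 0" using \<epsilon> by simp
      ultimately show ?thesis using h_le[OF z] unfolding H_def by linarith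
    qed
    have h'H: "cmod (frechet_derivative h (at z) e) \<le> H" if z: "z \<in> \<Omega>" for z
    proof -
      have "1 / cmod (x z) \<le> 1 / \<epsilon>"
        using Rex(1)[OF z] Rexle[of z] \<epsilon> x0(1)[OF z] by (intro divide_left_mono) auto
      moreover have "2 / sqrt \<epsilon> > 0" using \<epsilon> by simp
      moreover have "cmod (frechet_derivative h (at z) e) = 1 / cmod (x z)"
        by (simp add: fdhe[OF z] norm_divide)
      ultimately show ?thesis using R pi_gt_zero unfolding H_def by linarith
    qed
    have hc: "continuous_on \<Omega> h" by (rule holomorphic_Cn_continuous_on[OF hol])
    have hm: "h \<in> borel_measurable (lebesgue_on \<Omega>)"
      by (rule continuous_imp_measurable_on_sets_lebesgue[OF hc OmL])
    have hA: "h \<in> bergman_space \<Omega> 2"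
      using hol bounded_in_Lp_space[OF bd OmL hm hH, of 2] by (simp add: bergman_space_def)
    define f where "f z = h z - (- 1 / x z * of_real (r z) + h z * D z) / c" for z
    have xc: "continuous_on \<Omega> x"
      unfolding x_def \<phi>_def
      by (intro continuous_on_add continuous_on_const bounded_linear.continuous_on[OF bounded_linear_hermitian]
          continuous_on_diff continuous_on_id)
    have fc: "continuous_on \<Omega> f"
      unfolding f_def
      by (intro continuous_on_diff continuous_on_divide continuous_on_add continuous_on_mult continuous_on_of_real
          continuous_on_const hc D_cont xc continuous_on_subset[OF rc closure_subset]) (use x0 c in auto)
    have fm: "f \<in> borel_measurable (lebesgue_on \<Omega>)"
      by (rule continuous_imp_measurable_on_sets_lebesgue[OF fc OmL])
    have fM: "cmod (f z) \<le> M" if z: "z \<in> \<Omega>" for z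
    proof -
      let ?d = "norm (\<zeta> - z)"
      have "f z = (h z * (c - D z) + of_real (r z) / x z) / c"
        using c by (simp add: f_def field_simps)
      then have "cmod (f z) \<le> (cmod (h z) * cmod (D z - c) + \<bar>r z\<bar> / cmod (x z)) / cmod c"
        by (simp add: norm_divide norm_mult norm_minus_commute divide_right_mono
            norm_triangle_le)
      also have "\<dots> \<le> (C2 * (2 * R * (pi + (2 * R + 1)) + 2 * sqrt (2 * R)) + C1) / cmod c"
      proof (intro divide_right_mono add_mono)
        have "cmod (h z) * cmod (D z - c) \<le> (pi + (2 * R + 1) + 2 / sqrt (cmod (x z))) * (C2 * ?d)"
          using h_le[OF z] C2(2)[OF z] by (intro mult_mono) (auto simp: norm_minus_commute intro: order_trans[OF norm_ge_zero])
        also have "\<dots> = C2 * (?d * (pi + (2 * R + 1)) + 2 * (?d / sqrt (cmod (x z))))"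
          by (simp add: algebra_simps)
        also have "\<dots> \<le> C2 * (2 * R * (pi + (2 * R + 1)) + 2 * sqrt (2 * R))"
        proof (intro mult_left_mono add_mono mult_right_mono)
          have "?d\<^sup>2 / (2 * R) \<le> cmod (x z)" using Rex(2)[OF z] Rexle[of z] by linarith
          then have "sqrt (?d\<^sup>2 / (2 * R)) \<le> sqrt (cmod (x z))" by (rule real_sqrt_le_mono)
          then have "?d \<le> sqrt (2 * R) * sqrt (cmod (x z))"
            using R by (simp add: real_sqrt_divide field_simps)
          then show "?d / sqrt (cmod (x z)) \<le> sqrt (2 * R)"
            using x0(1)[OF z] by (simp add: pos_divide_le_eq)
        qed (use dle[OF z] C2 R pi_gt_zero in auto)
        finally show "cmod (h z) * cmod (D z - c) \<le> C2 * (2 * R * (pi + (2 * R + 1)) + 2 * sqrt (2 * R))" .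
        have "\<bar>r z\<bar> \<le> C1 * cmod (x z)"
          using C1(2)[OF z] mult_left_mono[OF order_trans[OF Rex(3)[OF z] Rexle[of z]] C1(1)]
          unfolding Re\<phi> by linarith
        then show "\<bar>r z\<bar> / cmod (x z) \<le> C1" using x0(1)[OF z] by (simp add: pos_divide_le_eq)
      qed simp
      finally show ?thesis by (simp add: M_def)
    qed
    have orth: "L2_inner \<Omega> (\<lambda>z. f z - h z) g = 0" if g: "g \<in> bergman_space \<Omega> 2" for g
    proof -
      let ?u = "\<lambda>z. frechet_derivative h (at z) e * of_real (r z) + h z * type_1_0_part e (?r' z)"
      have "L2_inner \<Omega> ?u g = 0"
      proof (rule orthogonal_to_bergman_space[OF op bd rc _ _ _ _ hol hH h'H g, where L = "L1 + L2"])
        show "\<Omega> = {z \<in> closure \<Omega>. r z < 0}"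
        proof (intro set_eqI iffI)
          show "z \<in> {z \<in> closure \<Omega>. r z < 0}" if "z \<in> \<Omega>" for z
            using that cl[OF that] by (subst (asm) Om) simp
          show "z \<in> \<Omega>" if "z \<in> {z \<in> closure \<Omega>. r z < 0}" for z
            using that U(2) by (intro Omi) auto
        qed
        fix z assume z: "z \<in> \<Omega>"
        show "(r has_derivative ?r' z) (at z)" using U(2) cl[OF z] by (intro rd) blast
        show "\<bar>?r' z e\<bar> \<le> L1 + L2" using L1(2)[OF cl[OF z]] L2(1) by linarith
        show "\<bar>?r' z (\<i> *s e)\<bar> \<le> L1 + L2" using L2(2)[OF cl[OF z]] L1(1) by linarith
      qed
      moreover have "L2_inner \<Omega> (\<lambda>z. f z - h z) g = (- 1 / c) * L2_inner \<Omega> ?u g"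
        unfolding L2_inner_def integral_mult_right_zero[symmetric]
        by (rule Bochner_Integration.integral_cong) (auto simp: f_def fdhe D_def field_simps)
      ultimately show ?thesis by simp
    qed
    have S: "\<Omega> \<inter> ball \<zeta> \<epsilon> \<in> sets lebesgue" using op by simp
    have hS: "Re (h z) \<le> ln (2 * \<epsilon>)" if "z \<in> \<Omega> \<inter> ball \<zeta> \<epsilon>" for z
    proof -
      have z: "z \<in> \<Omega>" "norm (\<zeta> - z) < \<epsilon>" using that by (auto simp: dist_norm)
      have "cmod (x z) \<le> 2 * \<epsilon>" using x_le[of z] z(2) by linarith
      then show ?thesis using x0(1)[OF z(1)] \<epsilon> by (simp add: h_def)
    qed
    show "\<exists>f h S. logarithmic_test_pair \<Omega> M \<kappa> \<epsilon> f h S"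
      unfolding logarithmic_test_pair_def using fm fM hA orth S hS \<kappa>(2)[OF \<epsilon>]
      by (intro exI[of _ f] exI[of _ h] exI[of _ "\<Omega> \<inter> ball \<zeta> \<epsilon>"]) blast
  qed
qed

section \<open>Lower bounds for the norm\<close>

lemma Lp_norm_projection_le_bergman_norm:
  assumes "f \<in> Lp_space \<Omega> p" "Lp_norm \<Omega> p f \<le> 1"
  shows "Lp_norm \<Omega> p (bergman_projection_Lp \<Omega> p f) \<le> bergman_norm \<Omega> p"
  unfolding bergman_norm_def by (rule SUP_upper) (use assms in simp)

lemma Lp_norm_cong_AE:
  assumes f: "f \<in> borel_measurable (lebesgue_on \<Omega>)" and g: "g \<in> borel_measurable (lebesgue_on \<Omega>)"
    and eq: "AE z in lebesgue_on \<Omega>. f z = g z"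
  shows "Lp_norm \<Omega> p f = Lp_norm \<Omega> p g"
proof -
  have m: "(\<lambda>z. cmod (f z) powr p) \<in> borel_measurable (lebesgue_on \<Omega>)"
    "(\<lambda>z. cmod (g z) powr p) \<in> borel_measurable (lebesgue_on \<Omega>)"
    using f g by measurable
  have e: "AE z in lebesgue_on \<Omega>. cmod (f z) powr p = cmod (g z) powr p"
    using eq by eventually_elim simp
  show ?thesis
    using integrable_cong_AE[OF m e] integral_cong_AE[OF m e] f g by (simp add: Lp_norm_def Lp_space_def)
qed

text \<open>
  Chebyshev's inequality. It also holds when \<open>h\<close> is not in \<open>L\<^sup>p\<close>, where the norm is infinite.
\<close>
lemma measure_powr_le_Lp_norm:
  assumes p: "p > 0" and S: "S \<in> sets lebesgue" "S \<subseteq> \<Omega>" and \<Omega>: "\<Omega> \<in> lmeasurable"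
    and a: "a \<ge> 0" and h: "\<And>z. z \<in> S \<Longrightarrow> a \<le> cmod (h z)"
  shows "ennreal (a * measure lebesgue S powr (1 / p)) \<le> Lp_norm \<Omega> p h"
proof (cases "h \<in> Lp_space \<Omega> p")
  case True
  let ?M = "lebesgue_on \<Omega>"
  interpret finite_measure ?M by (rule finite_measure_lebesgue_on[OF \<Omega>])
  have SM: "S \<in> sets ?M" using S \<Omega> by (simp add: sets_restrict_space_iff fmeasurable_def)
  have mS: "measure ?M S = measure lebesgue S"
    using S \<Omega> by (intro measure_restrict_space) (auto simp: fmeasurable_def)
  have int: "integrable ?M (\<lambda>z. cmod (h z) powr p)" using True by (simp add: Lp_space_def)
  have "a powr p * measure lebesgue S = (\<integral>z. a powr p * indicator S z \<partial>?M)"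
    using SM mS Int_absorb2[OF S(2)] by simp
  also have "\<dots> \<le> (\<integral>z. cmod (h z) powr p \<partial>?M)"
  proof (rule integral_mono[OF _ int])
    show "integrable ?M (\<lambda>z. a powr p * indicator S z :: real)"
      using SM emeasure_finite[of S] by (intro integrable_mult_right integrable_real_indicator) (auto simp flip: top.not_eq_extremum)
    show "a powr p * indicator S z \<le> cmod (h z) powr p" for z
      using h[of z] a p by (cases "z \<in> S") (auto intro: powr_mono2)
  qed
  finally have "(a powr p * measure lebesgue S) powr (1 / p) \<le> (\<integral>z. cmod (h z) powr p \<partial>?M) powr (1 / p)"
    using p by (intro powr_mono2) auto
  moreover have "(a powr p * measure lebesgue S) powr (1 / p) = a * measure lebesgue S powr (1 / p)"
    using p a by (simp add: powr_mult powr_powr)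
  ultimately show ?thesis using True by (simp add: Lp_norm_def ennreal_leI)
qed (simp add: Lp_norm_def)

text \<open>
  A weak form of Hoelder's inequality on a set of finite measure, from the pointwise bound
  \<open>x \<le> A + A powr (1 - p) * x powr p\<close> with \<open>A\<close> equal to the \<open>L\<^sup>p\<close> norm.
\<close>
lemma integral_norm_le_Lp:
  assumes p: "p \<ge> 1" and \<Omega>: "\<Omega> \<in> lmeasurable" and f: "f \<in> Lp_space \<Omega> p"
  defines "N \<equiv> (\<integral>z. cmod (f z) powr p \<partial>lebesgue_on \<Omega>) powr (1 / p)"
  shows "integrable (lebesgue_on \<Omega>) (\<lambda>z. cmod (f z))"
    and "(\<integral>z. cmod (f z) \<partial>lebesgue_on \<Omega>) \<le> N * (1 + measure lebesgue \<Omega>)"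
proof -
  let ?M = "lebesgue_on \<Omega>"
  interpret finite_measure ?M by (rule finite_measure_lebesgue_on[OF \<Omega>])
  have fm: "f \<in> borel_measurable ?M" and int: "integrable ?M (\<lambda>z. cmod (f z) powr p)"
    using f by (auto simp: Lp_space_def)
  have young: "x \<le> A + A powr (1 - p) * x powr p" if A: "A > 0" and x: "x \<ge> 0" for A x :: real
  proof (cases "x \<le> A")
    case True
    then show ?thesis by (simp add: add_increasing2)
  next
    case False
    have "x powr 1 = x powr (1 - p) * x powr p" using False A by (simp flip: powr_add)
    also have "\<dots> \<le> A powr (1 - p) * x powr p"
      using False A p by (intro mult_right_mono powr_mono2') auto
    finally show ?thesis using False A by simp
  qed
  have intA: "integrable ?M (\<lambda>z. A + A powr (1 - p) * cmod (f z) powr p)" for A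
    using int by (intro Bochner_Integration.integrable_add integrable_mult_right) auto
  show i: "integrable ?M (\<lambda>z. cmod (f z))"
    by (rule Bochner_Integration.integrable_bound[OF intA[of 1]])
       (use fm young[of 1] in \<open>auto intro!: AE_I2\<close>)
  define V where "V = measure lebesgue \<Omega>"
  have V: "measure ?M (space ?M) = V"
    using \<Omega> by (simp add: V_def measure_restrict_space fmeasurable_def)
  have le: "(\<integral>z. cmod (f z) \<partial>?M) \<le> A * V + A powr (1 - p) * (\<integral>z. cmod (f z) powr p \<partial>?M)" if A: "A > 0" for A
  proof -
    have "(\<integral>z. cmod (f z) \<partial>?M) \<le> (\<integral>z. A + A powr (1 - p) * cmod (f z) powr p \<partial>?M)"
      by (rule integral_mono[OF i intA]) (rule young[OF A], simp)
    also have "\<dots> = A * V + A powr (1 - p) * (\<integral>z. cmod (f z) powr p \<partial>?M)"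
      using int V by (simp add: mult.commute)
    finally show ?thesis .
  qed
  show "(\<integral>z. cmod (f z) \<partial>?M) \<le> N * (1 + V)" 
  proof (cases "(\<integral>z. cmod (f z) powr p \<partial>?M) = 0")
    case True
    then have "AE z in ?M. cmod (f z) powr p = 0"
      using int by (simp add: integral_nonneg_eq_0_iff_AE)
    then have "AE z in ?M. cmod (f z) = 0" by eventually_elim simp
    then have "(\<integral>z. cmod (f z) \<partial>?M) = 0"
      by (intro integral_eq_zero_AE)
    then show ?thesis by (simp add: N_def V_def)
  next
    case False
    then have I: "(\<integral>z. cmod (f z) powr p \<partial>?M) > 0"
      using Bochner_Integration.integral_nonneg[of ?M "\<lambda>z. cmod (f z) powr p"] by (simp add: less_le)
    then have N: "N > 0" by (simp add: N_def)
    have Np: "(\<integral>z. cmod (f z) powr p \<partial>?M) = N powr p"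
      using I p by (simp add: N_def powr_powr)
    have "N powr (1 - p) * N powr p = N" using N by (simp flip: powr_add)
    then show ?thesis using le[OF N] by (simp add: Np algebra_simps)
  qed
qed

text \<open>
  Tests the projection on \<open>f\<close>. The factor \<open>1 + \<bar>\<Omega>\<bar>\<close> dominates \<open>\<bar>\<Omega>\<bar> powr (1 / p)\<close> for every \<open>p\<close>, so
  that the normalization does not depend on \<open>p\<close>.
\<close>
lemma bergman_norm_ge_large_exponent:
  fixes \<Omega> :: "(complex ^ 'n::finite) set"
  assumes op: "open \<Omega>" and bd: "bounded \<Omega>" and p: "p \<ge> 1"
    and f: "f \<in> borel_measurable (lebesgue_on \<Omega>)" "\<And>z. z \<in> \<Omega> \<Longrightarrow> cmod (f z) \<le> M" and M: "M > 0"
    and h: "h \<in> bergman_space \<Omega> 2"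
    and orth: "\<And>g. g \<in> bergman_space \<Omega> 2 \<Longrightarrow> L2_inner \<Omega> (\<lambda>z. f z - h z) g = 0"
    and S: "S \<in> sets lebesgue" "S \<subseteq> \<Omega>" and a: "a \<ge> 0" "\<And>z. z \<in> S \<Longrightarrow> a \<le> cmod (h z)"
  shows "ennreal (a * measure lebesgue S powr (1 / p) / (M * (1 + measure lebesgue \<Omega>))) \<le> bergman_norm \<Omega> p"
proof -
  have OmL: "\<Omega> \<in> sets lebesgue" using op by simp
  have Om: "\<Omega> \<in> lmeasurable" by (rule bounded_set_imp_lmeasurable[OF bd OmL])
  define V where "V = measure lebesgue \<Omega>"
  have V: "V \<ge> 0" by (simp add: V_def)
  define k where "k = M * (1 + V)"
  have k: "k > 0" using M V by (simp add: k_def)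
  define F where "F z = f z / of_real k" for z
  define G where "G z = h z / of_real k" for z
  have Fm: "F \<in> borel_measurable (lebesgue_on \<Omega>)" unfolding F_def using f(1) by measurable
  have Fb: "cmod (F z) \<le> 1 / (1 + V)" if "z \<in> \<Omega>" for z
  proof -
    have "cmod (F z) \<le> M / k" using f(2)[OF that] k by (simp add: F_def norm_divide divide_right_mono)
    also have "\<dots> = 1 / (1 + V)" using M by (simp add: k_def)
    finally show ?thesis .
  qed
  have FL: "F \<in> Lp_space \<Omega> q" if "q \<ge> 0" for q
    by (rule bounded_in_Lp_space[OF bd OmL Fm Fb that])
  have GA: "G \<in> bergman_space \<Omega> 2"
    using bergman_space_linear[OF h h, of "1 / of_real k - 1"] by (simp add: G_def[abs_def] algebra_simps)
  have orthG: "L2_inner \<Omega> (\<lambda>z. F z - G z) g = 0" if "g \<in> bergman_space \<Omega> 2" for g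
  proof -
    have "L2_inner \<Omega> (\<lambda>z. F z - G z) g = (1 / of_real k) * L2_inner \<Omega> (\<lambda>z. f z - h z) g"
      unfolding L2_inner_def integral_mult_right_zero[symmetric]
      by (rule Bochner_Integration.integral_cong) (simp_all add: F_def G_def flip: diff_divide_distrib)
    then show ?thesis using orth[OF that] by simp
  qed
  have norm1: "Lp_norm \<Omega> p F \<le> 1"
  proof -
    let ?M = "lebesgue_on \<Omega>"
    interpret finite_measure ?M by (rule finite_measure_lebesgue_on[OF Om])
    have "(\<integral>z. cmod (F z) powr p \<partial>?M) \<le> (\<integral>z. (1 / (1 + V)) powr p \<partial>?M)"
    proof (rule integral_mono)
      show "integrable ?M (\<lambda>z. cmod (F z) powr p)" using FL[of p] p by (simp add: Lp_space_def)
      show "cmod (F z) powr p \<le> (1 / (1 + V)) powr p" if "z \<in> space ?M" for z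
        using Fb[of z] that p by (intro powr_mono2) auto
    qed simp
    also have "\<dots> = V * (1 / (1 + V)) powr p"
      using Om by (simp add: V_def measure_restrict_space fmeasurable_def)
    also have "\<dots> \<le> (1 + V) * (1 / (1 + V)) powr 1"
      using V p by (intro mult_mono powr_mono') auto
    also have "\<dots> = 1" using V by simp
    finally have "(\<integral>z. cmod (F z) powr p \<partial>?M) powr (1 / p) \<le> 1 powr (1 / p)"
      using p by (intro powr_mono2) auto
    then show ?thesis using FL[of p] p by (simp add: Lp_norm_def ennreal_le_1)
  qed
  have ae: "AE z in lebesgue_on \<Omega>. bergman_projection \<Omega> F z = G z"
    by (rule bergman_projection_AE_eq[OF op FL GA orthG]) simp
  have "bergman_projection \<Omega> F \<in> bergman_space \<Omega> 2" by (rule bergman_projection(1)[OF op FL]) simp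
  then have "Lp_norm \<Omega> p (bergman_projection \<Omega> F) = Lp_norm \<Omega> p G"
    using GA ae by (intro Lp_norm_cong_AE) (auto simp: bergman_space_def Lp_space_def)
  then have "Lp_norm \<Omega> p G \<le> bergman_norm \<Omega> p"
    using Lp_norm_projection_le_bergman_norm[OF FL norm1] FL[of 2] p by (simp add: bergman_projection_Lp_def)
  moreover have "ennreal (a / k * measure lebesgue S powr (1 / p)) \<le> Lp_norm \<Omega> p G"
    using p S Om a k by (intro measure_powr_le_Lp_norm) (auto simp: G_def norm_divide divide_right_mono)
  ultimately show ?thesis unfolding k_def V_def by simp
qed

text \<open>
  Tests the projection on \<open>u\<close>, the indicator function of \<open>S\<close> normalized in \<open>L\<^sup>p\<close>. By self-adjointness
  \<open>\<langle>P u, f\<rangle> = \<langle>u, h\<rangle>\<close>, whose modulus is at least \<open>a \<bar>S\<bar> powr (1 - 1 / p)\<close>, while the left side is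
  at most \<open>M\<close> times the \<open>L\<^sup>1\<close> norm of \<open>P u\<close>.
\<close>
lemma bergman_norm_ge_small_exponent:
  fixes \<Omega> :: "(complex ^ 'n::finite) set"
  assumes op: "open \<Omega>" and bd: "bounded \<Omega>" and p: "p > 1"
    and f: "f \<in> borel_measurable (lebesgue_on \<Omega>)" "\<And>z. z \<in> \<Omega> \<Longrightarrow> cmod (f z) \<le> M" and M: "M > 0"
    and h: "h \<in> bergman_space \<Omega> 2"
    and orth: "\<And>g. g \<in> bergman_space \<Omega> 2 \<Longrightarrow> L2_inner \<Omega> (\<lambda>z. f z - h z) g = 0"
    and S: "S \<in> sets lebesgue" "S \<subseteq> \<Omega>" "measure lebesgue S > 0" and a: "a \<ge> 0" "\<And>z. z \<in> S \<Longrightarrow> Re (h z) \<le> - a"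
  shows "ennreal (a * measure lebesgue S powr (1 - 1 / p) / (M * (1 + measure lebesgue \<Omega>))) \<le> bergman_norm \<Omega> p"
proof -
  let ?M = "lebesgue_on \<Omega>"
  have OmL: "\<Omega> \<in> sets lebesgue" using op by simp
  have Om: "\<Omega> \<in> lmeasurable" by (rule bounded_set_imp_lmeasurable[OF bd OmL])
  interpret finite_measure ?M by (rule finite_measure_lebesgue_on[OF Om])
  define V where "V = measure lebesgue \<Omega>"
  have V: "V \<ge> 0" by (simp add: V_def)
  define s where "s = measure lebesgue S"
  have s: "s > 0" using S by (simp add: s_def)
  have SM: "S \<in> sets ?M" using S OmL by (simp add: sets_restrict_space_iff)
  have mS: "measure ?M S = s" unfolding s_def
    using S OmL by (intro measure_restrict_space) auto
  define u where "u z = complex_of_real (s powr (- 1 / p) * indicator S z)" for z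
  have um: "u \<in> borel_measurable ?M" unfolding u_def using SM by measurable
  have ub: "cmod (u z) \<le> s powr (- 1 / p)" for z by (simp add: u_def indicator_def)
  have uL: "u \<in> Lp_space \<Omega> q" if "q \<ge> 0" for q
    by (rule bounded_in_Lp_space[OF bd OmL um ub that])
  have "cmod (u z) = s powr (- 1 / p) * indicator S z" for z
    by (simp add: u_def indicator_def)
  then have cu: "cmod (u z) = s powr (- 1 / p)" if "z \<in> S" for z using that by simp
  have "(s powr (- 1 / p)) powr p = s powr (- 1 / p * p)" by (rule powr_powr)
  also have "\<dots> = inverse s" using s p by (simp add: powr_minus)
  finally have sp: "(s powr (- 1 / p)) powr p = inverse s" .
  have "cmod (u z) powr p = inverse s * indicator S z" for z
  proof (cases "z \<in> S")
    case True
    then show ?thesis unfolding cu[OF True] sp by simp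
  qed (simp add: u_def)
  then have "(\<integral>z. cmod (u z) powr p \<partial>?M) = inverse s * s"
    using SM mS Int_absorb2[OF S(2)] by simp
  then have norm1: "Lp_norm \<Omega> p u \<le> 1"
    using s uL[of p] p by (simp add: Lp_norm_def)
  let ?P = "bergman_projection \<Omega> u"
  have fL: "f \<in> Lp_space \<Omega> 2" by (rule bounded_in_Lp_space[OF bd OmL f]) auto
  have PA: "?P \<in> bergman_space \<Omega> 2" by (rule bergman_projection(1)[OF op uL]) simp
  have inner: "L2_inner \<Omega> ?P f = L2_inner \<Omega> u h"
    by (rule bergman_projection_self_adjoint[OF op uL fL h orth]) simp
  have hL: "h \<in> Lp_space \<Omega> 2" using h by (simp add: bergman_space_def)
  have lower: "a * s powr (1 - 1 / p) \<le> cmod (L2_inner \<Omega> u h)"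
  proof -
    have int: "integrable ?M (\<lambda>z. u z * cnj (h z))"
      by (rule Lp_space_2_mult_cnj_integrable[OF uL hL]) simp
    have "a * s powr (1 - 1 / p) = (\<integral>z. a * s powr (- 1 / p) * indicator S z \<partial>?M)"
      using SM mS s Int_absorb2[OF S(2)] by (simp add: powr_diff powr_minus field_simps)
    also have "\<dots> \<le> (\<integral>z. - Re (u z * cnj (h z)) \<partial>?M)"
    proof (rule integral_mono)
      show "integrable ?M (\<lambda>z. a * s powr (- 1 / p) * indicator S z :: real)"
        using SM emeasure_finite[of S] by (intro integrable_mult_right integrable_real_indicator) (auto simp flip: top.not_eq_extremum)
      show "integrable ?M (\<lambda>z. - Re (u z * cnj (h z)))"
        using int by (intro Bochner_Integration.integrable_minus integrable_Re)
      show "a * s powr (- 1 / p) * indicator S z \<le> - Re (u z * cnj (h z))" for z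
        using a(2)[of z] mult_right_mono[of a "- Re (h z)" "s powr (- 1 / p)"]
        by (cases "z \<in> S") (auto simp: u_def mult.commute)
    qed
    also have "\<dots> = - Re (L2_inner \<Omega> u h)"
      unfolding L2_inner_def using int by (simp only: integral_minus integral_Re)
    also have "\<dots> \<le> cmod (L2_inner \<Omega> u h)" using abs_Re_le_cmod[of "L2_inner \<Omega> u h"] by linarith
    finally show ?thesis .
  qed
  have "ennreal (a * s powr (1 - 1 / p) / (M * (1 + V))) \<le> Lp_norm \<Omega> p ?P"
  proof (cases "?P \<in> Lp_space \<Omega> p")
    case True
    define N where "N = (\<integral>z. cmod (?P z) powr p \<partial>?M) powr (1 / p)"
    have p1: "p \<ge> 1" using p by simp
    note l1 = integral_norm_le_Lp[OF p1 Om True]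
    have "cmod (L2_inner \<Omega> ?P f) \<le> (\<integral>z. cmod (?P z * cnj (f z)) \<partial>?M)"
      unfolding L2_inner_def by (rule integral_norm_bound)
    also have "\<dots> \<le> (\<integral>z. M * cmod (?P z) \<partial>?M)"
    proof (rule integral_mono)
      show "integrable ?M (\<lambda>z. cmod (?P z * cnj (f z)))"
        using Lp_space_2_mult_cnj_integrable[OF _ fL, of ?P] PA
        by (intro integrable_norm) (simp add: bergman_space_def)
      show "integrable ?M (\<lambda>z. M * cmod (?P z))" using l1(1) by (rule integrable_mult_right)
      show "cmod (?P z * cnj (f z)) \<le> M * cmod (?P z)" if "z \<in> space ?M" for z
        using mult_left_mono[OF f(2)[of z] norm_ge_zero[of "?P z"]] that by (simp add: norm_mult mult.commute)
    qed
    also have "\<dots> = M * (\<integral>z. cmod (?P z) \<partial>?M)" by simp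
    also have "\<dots> \<le> M * (N * (1 + V))"
      using l1(2) M by (intro mult_left_mono) (auto simp: N_def V_def)
    finally have "a * s powr (1 - 1 / p) \<le> N * (M * (1 + V))" using lower inner by (simp add: mult_ac)
    then have "a * s powr (1 - 1 / p) / (M * (1 + V)) \<le> N"
      using M V by (simp add: pos_divide_le_eq)
    then show ?thesis using True by (simp add: Lp_norm_def N_def ennreal_leI)
  qed (simp add: Lp_norm_def)
  also have "\<dots> \<le> bergman_norm \<Omega> p"
    using Lp_norm_projection_le_bergman_norm[OF uL norm1] uL[of 2] p by (simp add: bergman_projection_Lp_def)
  finally show ?thesis by (simp add: s_def V_def)
qed

theorem corollary1p4:
  fixes \<Omega> :: "(complex ^ 'n::finite) set"
  assumes "bounded_domain \<Omega>"
    and "smoothly_bounded \<Omega>"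
    and "strongly_pseudoconvex \<Omega>"
  shows "\<exists>p0 q0 C' :: real. 2 < p0 \<and> 1 / p0 + 1 / q0 = 1 \<and> 0 < C' \<and>
           (\<forall>p \<in> {1<..<q0} \<union> {p0<..}. ennreal (C' * (p\<^sup>2 / (p - 1))) \<le> bergman_norm \<Omega> p)"
proof -
  have op: "open \<Omega>" and bd: "bounded \<Omega>"
    using assms(1) by (auto simp: bounded_domain_def)
  obtain U r where r: "defining_function \<Omega> U r"
    using assms(2) unfolding smoothly_bounded_def by blast
  obtain M \<kappa> where M: "M > 0" and \<kappa>: "\<kappa> > 0"
    and test: "\<And>\<epsilon>. 0 < \<epsilon> \<Longrightarrow> \<epsilon> \<le> 1 \<Longrightarrow> \<exists>f h S. logarithmic_test_pair \<Omega> M \<kappa> \<epsilon> f h S"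
    by (rule logarithmic_test_functions[OF assms(1) r]) (rule that)
  define n where "n = DIM(complex ^ 'n)"
  define V where "V = measure lebesgue \<Omega>"
  have V: "V \<ge> 0" by (simp add: V_def)
  define K where "K = min 1 \<kappa> * exp (- real n) / (2 * (M * (1 + V)))"
  have K: "K > 0" using M \<kappa> V by (simp add: K_def)
  \<comment> \<open>The exponent \<open>q\<close> is \<open>p\<close> itself in the range of large exponents and the conjugate of \<open>p\<close> in the range near \<open>1\<close>.
      With \<open>\<epsilon> = exp (- q)\<close> one has \<open>\<epsilon> ^ n powr (1 / q) = exp (- n)\<close> for every \<open>q\<close>.\<close>
  have main: "ennreal (K * q) \<le> bergman_norm \<Omega> p"
    if q: "q \<ge> 2" and p: "p > 1" and pq: "q = p \<or> 1 / q = 1 - 1 / p" for p q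
  proof -
    have "exp (- q) \<le> 1" "exp (- q) > 0" using q by auto
    from test[OF this(2,1)] obtain f h S where fhS: "logarithmic_test_pair \<Omega> M \<kappa> (exp (- q)) f h S"
      by blast
    have f: "f \<in> borel_measurable (lebesgue_on \<Omega>)" "\<And>z. z \<in> \<Omega> \<Longrightarrow> cmod (f z) \<le> M"
      and h: "h \<in> bergman_space \<Omega> 2"
      and orth: "\<And>g. g \<in> bergman_space \<Omega> 2 \<Longrightarrow> L2_inner \<Omega> (\<lambda>z. f z - h z) g = 0"
      and S: "S \<in> sets lebesgue" "S \<subseteq> \<Omega>"
      and mS: "\<kappa> * exp (- q) ^ n \<le> measure lebesgue S"
      and hS: "\<And>z. z \<in> S \<Longrightarrow> Re (h z) \<le> ln (2 * exp (- q))"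
      using fhS unfolding logarithmic_test_pair_def n_def by blast+
    have ln2: "ln 2 \<le> (1::real)" using ln_2_less_1 by simp
    have hS': "Re (h z) \<le> - (q / 2)" if "z \<in> S" for z
      using hS[OF that] ln2 q by (simp add: ln_mult)
    have hS'': "q / 2 \<le> cmod (h z)" if "z \<in> S" for z
      using hS'[OF that] abs_Re_le_cmod[of "h z"] by linarith
    have mSpos: "measure lebesgue S > 0"
      using mS \<kappa> mult_pos_pos[OF \<kappa> zero_less_power[OF exp_gt_zero[of "- q"], of n]] by linarith
    have pw: "min 1 \<kappa> * exp (- real n) \<le> measure lebesgue S powr (1 / q)"
    proof -
      have "(min 1 \<kappa> * exp (- real n)) = min 1 \<kappa> * (exp (- q) ^ n) powr (1 / q)"
        using q by (simp add: powr_def exp_of_nat_mult[symmetric])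
      also have "\<dots> \<le> \<kappa> powr (1 / q) * (exp (- q) ^ n) powr (1 / q)"
      proof (intro mult_right_mono)
        have "min 1 \<kappa> = min 1 \<kappa> powr 1" using \<kappa> by simp
        also have "\<dots> \<le> min 1 \<kappa> powr (1 / q)" using \<kappa> q by (intro powr_mono') auto
        also have "\<dots> \<le> \<kappa> powr (1 / q)" using \<kappa> q by (intro powr_mono2) auto
        finally show "min 1 \<kappa> \<le> \<kappa> powr (1 / q)" .
      qed simp
      also have "\<dots> = (\<kappa> * exp (- q) ^ n) powr (1 / q)" using \<kappa> by (simp add: powr_mult)
      also have "\<dots> \<le> measure lebesgue S powr (1 / q)" using mS \<kappa> q by (intro powr_mono2) auto
      finally show ?thesis .
    qed
    have "K * q = q / 2 * (min 1 \<kappa> * exp (- real n)) / (M * (1 + V))"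
      by (simp add: K_def)
    also have "\<dots> \<le> q / 2 * measure lebesgue S powr (1 / q) / (M * (1 + V))"
      using pw q M V by (intro divide_right_mono mult_left_mono) auto
    finally have le: "ennreal (K * q) \<le> ennreal (q / 2 * measure lebesgue S powr (1 / q) / (M * (1 + V)))"
      by (rule ennreal_leI)
    from pq show ?thesis
    proof
      assume "q = p"
      then show ?thesis
        using order_trans[OF le] bergman_norm_ge_large_exponent[OF op bd _ f M h orth S _ hS'', of p] p
        unfolding V_def by auto
    next
      assume eq: "1 / q = 1 - 1 / p"
      show ?thesis
        using order_trans[OF le] bergman_norm_ge_small_exponent[OF op bd p f M h orth S mSpos _ hS'] q
        unfolding V_def eq by auto
    qed
  qed
  have "ennreal (K / 2 * (p\<^sup>2 / (p - 1))) \<le> bergman_norm \<Omega> p" if p: "p \<in> {1<..<3/2} \<union> {3<..}" for p :: real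
  proof (cases "p > 3")
    case True
    have "p\<^sup>2 / (p - 1) \<le> 2 * p" using True by (simp add: field_simps power2_eq_square)
    then have "K / 2 * (p\<^sup>2 / (p - 1)) \<le> K / 2 * (2 * p)" using K by (intro mult_left_mono) auto
    then have "ennreal (K / 2 * (p\<^sup>2 / (p - 1))) \<le> ennreal (K * p)" by (intro ennreal_leI) simp
    also have "\<dots> \<le> bergman_norm \<Omega> p" using True by (intro main) auto
    finally show ?thesis .
  next
    case False
    then have p: "1 < p" "p < 3/2" using p by auto
    have "p\<^sup>2 \<le> 2 * p" using p by (simp add: power2_eq_square)
    then have "p\<^sup>2 / (p - 1) \<le> 2 * p / (p - 1)" using p by (intro divide_right_mono) auto
    then have "p\<^sup>2 / (p - 1) \<le> 2 * (p / (p - 1))" by simp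
    then have "K / 2 * (p\<^sup>2 / (p - 1)) \<le> K / 2 * (2 * (p / (p - 1)))" using K by (intro mult_left_mono) auto
    then have "ennreal (K / 2 * (p\<^sup>2 / (p - 1))) \<le> ennreal (K * (p / (p - 1)))" by (intro ennreal_leI) simp
    also have "\<dots> \<le> bergman_norm \<Omega> p" using p by (intro main) (auto simp: field_simps)
    finally show ?thesis .
  qed
  with K show ?thesis
    by (intro exI[of _ "3::real"] exI[of _ "3/2::real"] exI[of _ "K / 2"]) auto
qed

end
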